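(* Let $2\le V\le 4$ be an integer and let $\mathcal{P}\subset\mathbb{R}^d$ be a $d$-dimensional lattice polytope which is not a simplex, with $\mathrm{Vol}(\mathcal{P})=V$, such that $\mathbb{Z}((\mathcal{P},1)\cap\mathbb{Z}^{d+1})\ne\mathbb{Z}^{d+1}$, and which is not a lattice pyramid. Write $\mathbf{e}_1,\ldots,\mathbf{e}_d$ for the standard unit vectors and $\mathbf{0}$ for the origin. Then, up to unimodular equivalence, there are exactly the following $4$ possibilities for $\mathcal{P}$ (each the convex hull of the listed vertices), where $k\ge 2$ is an integer: <ol> <li>$\delta(\mathcal{P},t)=1+t+t^k+t^{k+1}$ and $\mathcal{P}$ is one of: <ul> <li>$\mathcal{A}^{(4)}_1$: $d=2k$, vertices $\mathbf{0},\mathbf{e}_1,\ldots,\mathbf{e}_{d-1},\ \sum_{j=1}^{d-2}\mathbf{e}_j+2\mathbf{e}_d,\ \mathbf{e}_1-\mathbf{e}_{d-1}$;</li> <li>$\mathcal{A}^{(4)}_2$: $d=2k+1$, vertices $\mathbf{0},\mathbf{e}_1,\ldots,\mathbf{e}_{d-1},\ \sum_{j=1}^{d-3}\mathbf{e}_j+2\mathbf{e}_d,\ \mathbf{e}_{d-2}+\mathbf{e}_{d-1}$;</li> <li>$\mathcal{A}^{(4)}_3$: $d=2k+2$, vertices $\mathbf{0},\mathbf{e}_1,\ldots,\mathbf{e}_{d-1},\ \sum_{j=1}^{d-4}\mathbf{e}_j+2\mathbf{e}_d,\ -\mathbf{e}_{d-3}+\mathbf{e}_{d-2}+\mathbf{e}_{d-1}$;</li>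 </ul></li> <li>$\delta(\mathcal{P},t)=1+t+2t^k$ and $\mathcal{P}$ is $\mathcal{B}^{(4)}$: $d=2k$, vertices $\mathbf{0},\mathbf{e}_1,\ldots,\mathbf{e}_{d-1},\ \sum_{j=1}^{d-2}\mathbf{e}_j+2\mathbf{e}_d,\ -\mathbf{e}_1+\mathbf{e}_{d-1}$.</li> </ol>
   Context: A lattice polytope is a convex polytope whose vertices lie in $\mathbb{Z}^d$. For a $d$-dimensional lattice polytope $\mathcal{P}\subset\mathbb{R}^d$, its $\delta$-polynomial is $\delta(\mathcal{P},t)=(1-t)^{d+1}\bigl[1+\sum_{n\ge1}|n\mathcal{P}\cap\mathbb{Z}^d|\,t^n\bigr]$, a polynomial of degree at most $d$; the sum of its coefficients is the normalized volume $\mathrm{Vol}(\mathcal{P})$. For $(\mathcal{P},1)\cap\mathbb{Z}^{d+1}=\{\mathbf{x}_1,\ldots,\mathbf{x}_n\}$ (the lattice points of $\mathcal{P}\times\{1\}$), $\mathbb{Z}((\mathcal{P},1)\cap\mathbb{Z}^{d+1})$ denotes the subgroup $\{z_1\mathbf{x}_1+\cdots+z_n\mathbf{x}_n: z_i\in\mathbb{Z}\}$ of $\mathbb{Z}^{d+1}$. Two lattice polytopes $\mathcal{P}\subset\mathbb{R}^d$, $\mathcal{Q}\subset\mathbb{R}^e$ are unimodularly equivalent if there is an affine map $\mathrm{aff}(\mathcal{P})\to\mathrm{aff}(\mathcal{Q})$ mapping $\mathbb{Z}^d\cap\mathrm{aff}(\mathcal{P})$ bijectively onto $\mathbb{Z}^e\cap\mathrm{aff}(\mathcal{Q})$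 and $\mathcal{P}$ onto $\mathcal{Q}$. For a $d$-dimensional lattice polytope $\mathcal{Q}\subset\mathbb{R}^d$, $\mathrm{Pyr}(\mathcal{Q})=\mathrm{conv}(\mathcal{Q}\times\{0\},(0,\ldots,0,1))\subset\mathbb{R}^{d+1}$; a lattice polytope is a lattice pyramid if it is unimodularly equivalent to $\mathrm{Pyr}(\mathcal{Q})$ for some lower-dimensional lattice polytope $\mathcal{Q}$. *)

theory Defs
  imports "HOL-Analysis.Analysis" "HOL-Analysis.Finite_Function_Topology"
    "HOL-Computational_Algebra.Formal_Power_Series"
begin

text \<open>
  The dimension \<open>d\<close> varies inside the statement (lattice pyramids, the families of examples), so
  it cannot be a type. All Euclidean spaces live in the real vector space of finitely
  supported functions \<open>nat \<Rightarrow>\<^sub>0 real\<close>; \<open>\<real>\<^sup>d\<close> is the subspace of those supported on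
  the coordinates \<open>1, \<dots>, d\<close>. In particular \<open>\<real>\<^sup>d \<subseteq> \<real>\<^sup>d\<^sup>+\<^sup>1\<close>, with the last coordinate zero.
\<close>

type_synonym vect = "nat \<Rightarrow>\<^sub>0 real"

definition Rd :: "nat \<Rightarrow> vect set" where
  "Rd d = {x. Poly_Mapping.keys x \<subseteq> {1..d}}"

definition Zd :: "nat \<Rightarrow> vect set" where
  "Zd d = {x \<in> Rd d. \<forall>i. Poly_Mapping.lookup x i \<in> \<int>}"

definition evec :: "nat \<Rightarrow> vect" where
  "evec i = Poly_Mapping.single i 1"

definition vertices :: "vect set \<Rightarrow> vect set" where
  "vertices P = {v. v extreme_point_of P}"

definition lattice_polytope :: "nat \<Rightarrow> vect set \<Rightarrow> bool" where
  "lattice_polytope d P \<longleftrightarrow> polytope P \<and> P \<subseteq> Rd d \<and> vertices P \<subseteq> Zd d"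

text \<open>
  The library constants \<^const>\<open>aff_dim\<close> and \<^const>\<open>simplex\<close> are restricted to the class
  \<^class>\<open>euclidean_space\<close>; the next two definitions are their defining properties.
\<close>

definition has_dim :: "vect set \<Rightarrow> nat \<Rightarrow> bool" where
  "has_dim P n \<longleftrightarrow>
     (\<exists>C. finite C \<and> \<not> affine_dependent C \<and> card C = n + 1 \<and> affine hull C = affine hull P)"

definition is_simplex :: "vect set \<Rightarrow> bool" where
  "is_simplex P \<longleftrightarrow> (\<exists>C. finite C \<and> \<not> affine_dependent C \<and> P = convex hull C)"

definition full_lattice_polytope :: "nat \<Rightarrow> vect set \<Rightarrow> bool" where
  "full_lattice_polytope d P \<longleftrightarrow> lattice_polytope d P \<and> has_dim P d"

definition delta :: "nat \<Rightarrow> vect set \<Rightarrow> int fps" where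
  "delta d P = (1 - fps_X) ^ (d + 1) *
     Abs_fps (\<lambda>n. if n = 0 then 1 else int (card ((\<lambda>x. real n *\<^sub>R x) ` P \<inter> Zd d)))"

text \<open>
  \<^term>\<open>delta d P\<close> is a polynomial of degree at most \<open>d\<close> when \<open>P\<close> is a \<open>d\<close>-dimensional lattice
  polytope, so the following is the sum of all of its coefficients.
\<close>

definition Vol :: "nat \<Rightarrow> vect set \<Rightarrow> int" where
  "Vol d P = (\<Sum>i\<le>d. fps_nth (delta d P) i)"

definition int_comb :: "vect set \<Rightarrow> vect set" where
  "int_comb X = {\<Sum>x\<in>X. of_int (z x) *\<^sub>R x | z :: vect \<Rightarrow> int. True}"

definition lift1 :: "nat \<Rightarrow> vect set \<Rightarrow> vect set" where
  "lift1 d P = (\<lambda>x. x + evec (d + 1)) ` P"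

definition spanning :: "nat \<Rightarrow> vect set \<Rightarrow> bool" where
  "spanning d P \<longleftrightarrow> int_comb (lift1 d P \<inter> Zd (d + 1)) = Zd (d + 1)"

definition affine_map_on :: "vect set \<Rightarrow> (vect \<Rightarrow> vect) \<Rightarrow> bool" where
  "affine_map_on A f \<longleftrightarrow>
     (\<forall>x\<in>A. \<forall>y\<in>A. \<forall>t. f ((1 - t) *\<^sub>R x + t *\<^sub>R y) = (1 - t) *\<^sub>R f x + t *\<^sub>R f y)"

definition unimod_equiv :: "nat \<Rightarrow> vect set \<Rightarrow> nat \<Rightarrow> vect set \<Rightarrow> bool" where
  "unimod_equiv d P e Q \<longleftrightarrow>
     (\<exists>f. f ` (affine hull P) \<subseteq> affine hull Q \<and> affine_map_on (affine hull P) f \<and>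
          bij_betw f (Zd d \<inter> affine hull P) (Zd e \<inter> affine hull Q) \<and> f ` P = Q)"

definition Pyr :: "nat \<Rightarrow> vect set \<Rightarrow> vect set" where
  "Pyr e Q = convex hull (insert (evec (e + 1)) Q)"

definition lattice_pyramid :: "nat \<Rightarrow> vect set \<Rightarrow> bool" where
  "lattice_pyramid d P \<longleftrightarrow>
     (\<exists>n e Q. has_dim P n \<and> e < n \<and> full_lattice_polytope e Q \<and> unimod_equiv d P (e + 1) (Pyr e Q))"

definition nonspanning_nonsimplex_nonpyramid :: "int \<Rightarrow> nat \<Rightarrow> vect set \<Rightarrow> bool" where
  "nonspanning_nonsimplex_nonpyramid V d P \<longleftrightarrow>
     full_lattice_polytope d P \<and> \<not> is_simplex P \<and> Vol d P = V \<and>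
     \<not> spanning d P \<and> \<not> lattice_pyramid d P"

datatype family = Fam_A1 | Fam_A2 | Fam_A3 | Fam_B

fun fam_dim :: "family \<Rightarrow> nat \<Rightarrow> nat" where
  "fam_dim Fam_A1 k = 2 * k"
| "fam_dim Fam_A2 k = 2 * k + 1"
| "fam_dim Fam_A3 k = 2 * k + 2"
| "fam_dim Fam_B k = 2 * k"

fun fam_delta :: "family \<Rightarrow> nat \<Rightarrow> int fps" where
  "fam_delta Fam_A1 k = 1 + fps_X + fps_X ^ k + fps_X ^ (k + 1)"
| "fam_delta Fam_A2 k = 1 + fps_X + fps_X ^ k + fps_X ^ (k + 1)"
| "fam_delta Fam_A3 k = 1 + fps_X + fps_X ^ k + fps_X ^ (k + 1)"
| "fam_delta Fam_B k = 1 + fps_X + 2 * fps_X ^ k"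

definition base_points :: "nat \<Rightarrow> vect set" where
  "base_points d = insert 0 (evec ` {1..d - 1})"

text \<open>\<^term>\<open>fam_vertices F d\<close> is used only with \<^prop>\<open>d = fam_dim F k\<close> and \<^prop>\<open>k \<ge> 2\<close>, so the
  natural number subtractions do not truncate.\<close>

fun fam_vertices :: "family \<Rightarrow> nat \<Rightarrow> vect set" where
  "fam_vertices Fam_A1 d = base_points d \<union>
     {(\<Sum>j = 1..d - 2. evec j) + 2 *\<^sub>R evec d,
      evec 1 - evec (d - 1)}"
| "fam_vertices Fam_A2 d = base_points d \<union>
     {(\<Sum>j = 1..d - 3. evec j) + 2 *\<^sub>R evec d,
      evec (d - 2) + evec (d - 1)}"
| "fam_vertices Fam_A3 d = base_points d \<union>
     {(\<Sum>j = 1..d - 4. evec j) + 2 *\<^sub>R evec d,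
      - evec (d - 3) + evec (d - 2) + evec (d - 1)}"
| "fam_vertices Fam_B d = base_points d \<union>
     {(\<Sum>j = 1..d - 2. evec j) + 2 *\<^sub>R evec d,
      - evec 1 + evec (d - 1)}"

definition fam_polytope :: "family \<Rightarrow> nat \<Rightarrow> vect set" where
  "fam_polytope F k = convex hull (fam_vertices F (fam_dim F k))"

end

theory Submission
  imports Defs
begin

text \<open>
  Lift \<open>P\<close> to height 1 and let \<open>X\<close> be the set of lattice points of the lifted polytope. A regular
  triangulation of the cone over \<open>X\<close>, made half-open by pushing every point towards a generic
  interior point, shows that \<open>\<delta>\<close> is the sum of the height generating functions of the lattice points
  in half-open boxes; hence \<open>Vol\<close> is the sum over the cells of their indices in \<open>\<int>\<^sup>d\<^sup>+\<^sup>1\<close>. If \<open>P\<close> is neither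
  spanning nor a simplex, there are at least two cells and every index is at least 2, so \<open>Vol \<le> 4\<close>
  forces exactly two cells of index 2. Any simplex \<open>B \<subseteq> X\<close> and any further point \<open>x \<in> X\<close> can be made
  part of such a triangulation, and this forces \<open>X = B \<union> {x}\<close> with a single relation
  \<open>x + a = b + c\<close>, \<open>a, b, c \<in> B\<close>. So \<open>P\<close> is determined by the set \<open>S \<subseteq> B\<close> for which half the sum of \<open>S\<close>
  generates \<open>\<int>\<^sup>d\<^sup>+\<^sup>1\<close> over \<open>\<int>B\<close>. A point of \<open>B - {a, b, c}\<close> outside \<open>S\<close> would be the apex of a lattice
  pyramid, and the symmetries of the square \<open>a, b, x, c\<close> reduce \<open>S \<inter> {a, b, c}\<close> to four cases, which
  are the four families.
\<close>

section \<open>Regular triangulations and half-open decompositions\<close>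

text \<open>\<open>Vol\<close> is defined as a sum of coefficients of \<open>delta\<close>, so an
  index can enter only as a number of lattice points in a half-open box; half-openness lets the
  cells add up without inclusion-exclusion. A lower bound for these numbers suffices: a box meets
  every coset of the lattice of its cell, and for nonspanning \<open>P\<close> that lattice is
  proper, since it lies in the one generated by \<open>X\<close>. Once the bound is attained, index
  2 has two consequences. A point of \<open>X\<close> outside the lattice of a cell would generate
  everything together with that lattice, so all coefficients of \<open>X\<close> over all cells are
  integers, which makes the single relation rigid. And the vectors outside the lattice form one
  coset, which is what \<open>S\<close> records. Afterwards polytopes are handled through labelled
  bases (\<open>frame\<close>): membership in the integer lattice then depends only on coefficients
  and \<open>S\<close>, so equal labels give an equivalence, and the symmetries of the parallelogram
  act on \<open>S\<close> by parity. Inequivalence follows by carrying a frame across an equivalence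
  and reading off the dimension and \<open>delta\<close>.\<close>

definition poscone :: "'a::real_vector set \<Rightarrow> 'a set" where
  "poscone X = {\<Sum>x\<in>X. \<mu> x *\<^sub>R x | \<mu>. \<forall>x\<in>X. 0 \<le> \<mu> x}"

text \<open>The facet opposite \<open>p i\<close> is removed for every \<open>i\<close> in
  \<open>N\<close>. Generators form a family so that both bases (with \<open>p\<close> the identity)
  and labelled frames fit.\<close>

definition half_open_cone :: "'i set \<Rightarrow> ('i \<Rightarrow> 'a::real_vector) \<Rightarrow> 'i set \<Rightarrow> 'a set" where
  "half_open_cone I p N = {\<Sum>i\<in>I. r i *\<^sub>R p i | r. \<forall>i\<in>I. 0 \<le> r i \<and> (i \<in> N \<longrightarrow> 0 < r i)}"

definition bases :: "'a::real_vector set \<Rightarrow> 'a set set" where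
  "bases X = {B. B \<subseteq> X \<and> independent B \<and> X \<subseteq> span B}"

text \<open>For independent \<open>B\<close> and \<open>y\<close> in its span, this is the linear
  functional with the values of \<open>c\<close> on \<open>B\<close>, that is, the hyperplane
  through the lifted points of a cell.\<close>

definition interpolate :: "'a::real_vector set \<Rightarrow> ('a \<Rightarrow> real) \<Rightarrow> 'a \<Rightarrow> real" where
  "interpolate B c y = (\<Sum>b\<in>B. representation B y b * c b)"

text \<open>
  The cells of the regular triangulation that is induced by lifting each \<open>x \<in> X\<close> to height \<open>c x\<close>:
  the bases for which every other point lies strictly above the interpolating hyperplane.
\<close>

definition triangulation :: "'a::real_vector set \<Rightarrow> ('a \<Rightarrow> real) \<Rightarrow> 'a set set" where
  "triangulation X c = {B \<in> bases X. \<forall>x\<in>X - B. interpolate B c x < c x}"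

text \<open>Strict signs at 0 persist on a right neighbourhood of 0, and finitely many such
  neighbourhoods intersect. Indices with \<open>a i = 0\<close> are left free, to be decided by a
  generic direction \<open>g\<close>.\<close>

lemma small_perturbation:
  fixes a g :: "'i \<Rightarrow> real"
  assumes "finite I"
  obtains e where "e > 0"
    "\<And>i. i \<in> I \<Longrightarrow> a i > 0 \<Longrightarrow> a i + e * g i > 0"
    "\<And>i. i \<in> I \<Longrightarrow> a i < 0 \<Longrightarrow> a i + e * g i < 0"
proof -
  have lim: "((\<lambda>e. a i + e * g i) \<longlongrightarrow> a i) (at_right 0)" for i
    by (auto intro!: tendsto_eq_intros)
  have "\<forall>\<^sub>F e in at_right 0. (a i > 0 \<longrightarrow> a i + e * g i > 0) \<and> (a i < 0 \<longrightarrow> a i + e * g i < 0)" for i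
    using order_tendstoD[OF lim[of i]]
    by (cases "a i > 0"; cases "a i < 0") (auto elim: eventually_mono)
  then have "\<forall>\<^sub>F e in at_right 0. \<forall>i\<in>I. (a i > 0 \<longrightarrow> a i + e * g i > 0) \<and> (a i < 0 \<longrightarrow> a i + e * g i < 0)"
    by (intro eventually_ball_finite assms) auto
  then have "\<forall>\<^sub>F e::real in at_right 0. (\<forall>i\<in>I. (a i > 0 \<longrightarrow> a i + e * g i > 0) \<and> (a i < 0 \<longrightarrow> a i + e * g i < 0)) \<and> e > 0"
    using eventually_at_right_less by (rule eventually_conj)
  then obtain e :: real where "\<forall>i\<in>I. (a i > 0 \<longrightarrow> a i + e * g i > 0) \<and> (a i < 0 \<longrightarrow> a i + e * g i < 0)" "e > 0"
    using eventually_happens[where net = "at_right (0::real)"] by auto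
  with that[of e] show ?thesis by blast
qed

text \<open>Finitely many hyperplanes do not cover the positive orthant. In the induction step one
  weight with \<open>f x0 \<noteq> 0\<close> is raised by an amount that repairs \<open>f\<close> if
  it vanished and is too small to spoil the functionals that were already nonzero.\<close>

lemma generic_weights:
  fixes A :: "('a \<Rightarrow> real) set"
  assumes "finite X" "finite A" "\<And>a. a \<in> A \<Longrightarrow> \<exists>x\<in>X. a x \<noteq> 0"
  shows "\<exists>g. (\<forall>x. 0 < g x) \<and> (\<forall>a\<in>A. (\<Sum>x\<in>X. a x * g x) \<noteq> 0)"
  using assms(2,3)
proof (induction A rule: finite_induct)
  case empty
  show ?case by (rule exI[of _ "\<lambda>_. 1"]) simp
next
  case (insert f A)
  then obtain g where g: "\<forall>x. 0 < g x" "\<forall>a\<in>A. (\<Sum>x\<in>X. a x * g x) \<noteq> 0" by auto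
  obtain x0 where x0: "x0 \<in> X" "f x0 \<noteq> 0" using insert.prems by auto
  define \<phi> where "\<phi> a = (\<Sum>x\<in>X. a x * g x)" for a
  obtain e where e: "e > 0"
    "\<And>a. a \<in> insert f A \<Longrightarrow> \<phi> a > 0 \<Longrightarrow> \<phi> a + e * a x0 > 0"
    "\<And>a. a \<in> insert f A \<Longrightarrow> \<phi> a < 0 \<Longrightarrow> \<phi> a + e * a x0 < 0"
    using small_perturbation[of "insert f A" \<phi> "\<lambda>a. a x0"] insert.hyps by auto
  let ?g = "\<lambda>x. g x + (if x = x0 then e else 0)"
  have eq: "(\<Sum>x\<in>X. a x * ?g x) = \<phi> a + e * a x0" for a
    unfolding distrib_left sum.distrib \<phi>_def using assms(1) x0 by (simp add: if_distrib mult.commute cong: if_cong)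
  show ?case
  proof (intro exI[of _ ?g] conjI ballI allI)
    show "0 < ?g x" for x using g(1) e(1) by (simp add: add_pos_pos)
    show "(\<Sum>x\<in>X. a x * ?g x) \<noteq> 0" if "a \<in> insert f A" for a
    proof (cases "\<phi> a = 0")
      case True
      then have "a = f" using that g(2) by (auto simp: \<phi>_def)
      then show ?thesis using True x0 e(1) by (simp only: eq) simp
    next
      case False
      then show ?thesis using e(2,3)[OF that] by (simp only: eq) linarith
    qed
  qed
qed

lemma representation_lincomb:
  assumes "independent B" "finite B" "b \<in> B"
  shows "representation B (\<Sum>b\<in>B. f b *\<^sub>R b) b = f b"
proof -
  have "representation B (\<Sum>b\<in>B. f b *\<^sub>R b) b = (\<Sum>b'\<in>B. representation B (f b' *\<^sub>R b') b)"
    by (subst real_vector.representation_sum) (use assms in \<open>auto intro: span_scale span_base\<close>)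
  also have "\<dots> = (\<Sum>b'\<in>B. f b' * (if b = b' then 1 else 0))"
    using assms by (intro sum.cong) (auto simp: real_vector.representation_scale span_base real_vector.representation_basis)
  also have "\<dots> = f b" using assms by (simp add: if_distrib cong: if_cong)
  finally show ?thesis .
qed

lemma lincomb_representation:
  assumes "independent B" "finite B" "y \<in> span B"
  shows "(\<Sum>b\<in>B. representation B y b *\<^sub>R b) = y"
  using assms by (intro real_vector.sum_representation_eq) auto

lemma half_open_cone_iff:
  assumes "independent B" "finite B"
  shows "y \<in> half_open_cone B (\<lambda>b. b) N \<longleftrightarrow>
    y \<in> span B \<and> (\<forall>b\<in>B. 0 \<le> representation B y b \<and> (b \<in> N \<longrightarrow> 0 < representation B y b))"
proof
  assume "y \<in> half_open_cone B (\<lambda>b. b) N"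
  then show "y \<in> span B \<and> (\<forall>b\<in>B. 0 \<le> representation B y b \<and> (b \<in> N \<longrightarrow> 0 < representation B y b))"
    by (auto simp: half_open_cone_def representation_lincomb assms intro: span_sum span_scale span_base)
next
  assume "y \<in> span B \<and> (\<forall>b\<in>B. 0 \<le> representation B y b \<and> (b \<in> N \<longrightarrow> 0 < representation B y b))"
  then show "y \<in> half_open_cone B (\<lambda>b. b) N"
    unfolding half_open_cone_def using lincomb_representation[OF assms, of y]
    by (intro CollectI exI[of _ "representation B y"]) auto
qed

lemma basesD:
  assumes "B \<in> bases X" "finite X"
  shows "B \<subseteq> X" "independent B" "X \<subseteq> span B" "finite B"
  using assms by (auto simp: bases_def intro: finite_subset)

lemma representation_sum_scale:
  assumes "B \<in> bases X" "finite X"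
  shows "representation B (\<Sum>x\<in>X. \<mu> x *\<^sub>R x) b = (\<Sum>x\<in>X. \<mu> x * representation B x b)"
proof -
  have "representation B (\<Sum>x\<in>X. \<mu> x *\<^sub>R x) b = (\<Sum>x\<in>X. representation B (\<mu> x *\<^sub>R x) b)"
    using basesD[OF assms] by (subst real_vector.representation_sum) (auto intro: span_scale)
  also have "\<dots> = (\<Sum>x\<in>X. \<mu> x * representation B x b)"
    using basesD[OF assms] by (intro sum.cong) (auto simp: real_vector.representation_scale subsetD)
  finally show ?thesis .
qed

lemma interpolate_sum:
  assumes "B \<in> bases X" "finite X"
  shows "interpolate B c (\<Sum>x\<in>X. \<mu> x *\<^sub>R x) = (\<Sum>x\<in>X. \<mu> x * interpolate B c x)"
proof -
  have "interpolate B c (\<Sum>x\<in>X. \<mu> x *\<^sub>R x) = (\<Sum>b\<in>B. \<Sum>x\<in>X. \<mu> x * (representation B x b * c b))"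
    unfolding interpolate_def representation_sum_scale[OF assms] by (simp add: sum_distrib_right mult.assoc)
  also have "\<dots> = (\<Sum>x\<in>X. \<Sum>b\<in>B. \<mu> x * (representation B x b * c b))" by (rule sum.swap)
  finally show ?thesis by (simp add: interpolate_def sum_distrib_left)
qed

lemma interpolate_base:
  assumes "B \<in> bases X" "finite X" "b \<in> B"
  shows "interpolate B c b = c b"
proof -
  note BD = basesD[OF assms(1,2)]
  have "interpolate B c b = (\<Sum>b'\<in>B. if b' = b then c b' else 0)"
    unfolding interpolate_def real_vector.representation_basis[OF BD(2) assms(3)] by (intro sum.cong) auto
  then show ?thesis using BD(4) assms(3) by simp
qed

lemma poscone_span: "poscone X \<subseteq> span X"
  by (auto simp: poscone_def intro: span_sum span_scale span_base)

lemma bases_span: "B \<in> bases X \<Longrightarrow> span B = span X"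
  unfolding bases_def by (simp add: span_eq subset_trans[OF _ span_superset])

text \<open>Caratheodory's theorem for cones, keeping track of the cost.\<close>

lemma conic_reduction:
  fixes h :: "'a::real_vector \<Rightarrow> real"
  assumes "finite X" "linear h" "\<And>x. x \<in> X \<Longrightarrow> h x = 1" "\<And>x. x \<in> X \<Longrightarrow> 0 \<le> \<mu> x"
  shows "\<exists>B\<in>bases X. (\<forall>b\<in>B. 0 \<le> representation B (\<Sum>x\<in>X. \<mu> x *\<^sub>R x) b) \<and>
           interpolate B c (\<Sum>x\<in>X. \<mu> x *\<^sub>R x) \<le> (\<Sum>x\<in>X. \<mu> x * c x)"
  using assms(4)
proof (induction "card {x\<in>X. \<mu> x \<noteq> 0}" arbitrary: \<mu> rule: less_induct)
  case (less \<mu>)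
  define S where "S = {x\<in>X. \<mu> x \<noteq> 0}"
  have SX: "S \<subseteq> X" and finS: "finite S" using assms(1) by (auto simp: S_def)
  show ?case
  proof (cases "independent S")
    case True
    obtain B where B: "S \<subseteq> B" "B \<subseteq> X" "independent B" "X \<subseteq> span B"
      using maximal_independent_subset_extend[OF SX True] by blast
    have finB: "finite B" using B assms(1) finite_subset by blast
    have "(\<Sum>x\<in>X. \<mu> x *\<^sub>R x) = (\<Sum>x\<in>B. \<mu> x *\<^sub>R x)"
      using B assms(1) by (intro sum.mono_neutral_right) (auto simp: S_def)
    then have rep: "representation B (\<Sum>x\<in>X. \<mu> x *\<^sub>R x) b = \<mu> b" if "b \<in> B" for b
      using representation_lincomb[OF B(3) finB that, of \<mu>] by simp
    have "interpolate B c (\<Sum>x\<in>X. \<mu> x *\<^sub>R x) = (\<Sum>x\<in>B. \<mu> x * c x)"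
      by (simp add: interpolate_def rep)
    also have "\<dots> = (\<Sum>x\<in>X. \<mu> x * c x)"
      using B assms(1) by (intro sum.mono_neutral_left) (auto simp: S_def)
    finally show ?thesis
      using B rep less.prems by (intro bexI[of _ B]) (auto simp: bases_def)
  next
    case False
    then obtain r0 v where r0: "(\<Sum>x\<in>S. r0 x *\<^sub>R x) = 0" "v \<in> S" "r0 v \<noteq> 0"
      using real_vector.dependent_finite[OF finS] by auto
    \<comment> \<open>The sign orients the relation so that moving along it cannot raise the
      cost.\<close>
    define sg :: real where "sg = (if (\<Sum>x\<in>S. r0 x * c x) \<le> 0 then 1 else -1)"
    define r where "r x = (if x \<in> S then sg * r0 x else 0)" for x
    have sgne: "sg \<noteq> 0" by (simp add: sg_def)
    have r1: "(\<Sum>x\<in>S. r x *\<^sub>R x) = 0"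
    proof -
      have "(\<Sum>x\<in>S. r x *\<^sub>R x) = sg *\<^sub>R (\<Sum>x\<in>S. r0 x *\<^sub>R x)"
        by (simp add: r_def scaleR_sum_right)
      then show ?thesis using r0 by simp
    qed
    have rc: "(\<Sum>x\<in>S. r x * c x) \<le> 0"
    proof -
      have "(\<Sum>x\<in>S. r x * c x) = sg * (\<Sum>x\<in>S. r0 x * c x)"
        by (simp add: r_def sum_distrib_left mult.assoc)
      then show ?thesis by (simp add: sg_def)
    qed
    \<comment> \<open>All points have height 1, so the coefficients of a relation sum to 0. A
      nontrivial relation thus has a negative coefficient, and the step along it is bounded.\<close>
    have "h (\<Sum>x\<in>S. r x *\<^sub>R x) = (\<Sum>x\<in>S. r x)"
      using assms(3) SX by (auto simp: linear_sum[OF assms(2)] linear_scale[OF assms(2)] intro!: sum.cong)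
    then have rs: "(\<Sum>x\<in>S. r x) = 0" using r1 linear_0[OF assms(2)] by simp
    have rv: "r v \<noteq> 0" using r0 sgne by (simp add: r_def)
    have "\<exists>x\<in>S. r x < 0"
    proof (rule ccontr)
      assume "\<not> ?thesis"
      then have "\<forall>x\<in>S. 0 \<le> r x" by auto
      then have "\<forall>x\<in>S. r x = 0" using rs finS by (simp add: sum_nonneg_eq_0_iff)
      then show False using rv r0(2) by auto
    qed
    define T where "T = {x\<in>S. r x < 0}"
    have T: "finite T" "T \<noteq> {}" using finS \<open>\<exists>x\<in>S. r x < 0\<close> by (auto simp: T_def)
    \<comment> \<open>Ratio test: the longest step that keeps all coefficients nonnegative. At the
      minimiser \<open>x1\<close> the coefficient becomes 0, so the support shrinks.\<close>
    define t where "t = Min ((\<lambda>x. \<mu> x / - r x) ` T)"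
    have "t \<in> (\<lambda>x. \<mu> x / - r x) ` T"
      unfolding t_def by (rule Min_in) (use T in simp_all)
    then obtain x1 where x1: "x1 \<in> T" "t = \<mu> x1 / - r x1" by blast
    have tmin: "t \<le> \<mu> x / - r x" if "x \<in> T" for x
      unfolding t_def by (rule Min_le) (use T that in simp_all)
    have t0: "0 \<le> t" using x1 less.prems SX by (auto simp: T_def intro!: divide_nonneg_neg)
    define \<mu>' where "\<mu>' x = \<mu> x + t * r x" for x
    have rX: "(\<Sum>x\<in>X. r x *\<^sub>R x) = 0" "(\<Sum>x\<in>X. r x * c x) \<le> 0"
    proof -
      have "(\<Sum>x\<in>X. r x *\<^sub>R x) = (\<Sum>x\<in>S. r x *\<^sub>R x)"
        using SX assms(1) by (intro sum.mono_neutral_right) (auto simp: r_def)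
      then show "(\<Sum>x\<in>X. r x *\<^sub>R x) = 0" using r1 by simp
      have "(\<Sum>x\<in>X. r x * c x) = (\<Sum>x\<in>S. r x * c x)"
        using SX assms(1) by (intro sum.mono_neutral_right) (auto simp: r_def)
      then show "(\<Sum>x\<in>X. r x * c x) \<le> 0" using rc by simp
    qed
    have pos: "0 \<le> \<mu>' x" if "x \<in> X" for x
    proof (cases "x \<in> T")
      case True
      then show ?thesis using tmin[OF True] by (auto simp: \<mu>'_def T_def field_simps)
    next
      case False
      then have "0 \<le> r x" by (auto simp: T_def r_def)
      then show ?thesis using less.prems[OF that] t0 by (simp add: \<mu>'_def)
    qed
    have sum': "(\<Sum>x\<in>X. \<mu>' x *\<^sub>R x) = (\<Sum>x\<in>X. \<mu> x *\<^sub>R x)"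
    proof -
      have "(\<Sum>x\<in>X. \<mu>' x *\<^sub>R x) = (\<Sum>x\<in>X. \<mu> x *\<^sub>R x) + t *\<^sub>R (\<Sum>x\<in>X. r x *\<^sub>R x)"
        by (simp add: \<mu>'_def scaleR_left_distrib sum.distrib scaleR_sum_right)
      then show ?thesis using rX by simp
    qed
    have cost': "(\<Sum>x\<in>X. \<mu>' x * c x) \<le> (\<Sum>x\<in>X. \<mu> x * c x)"
    proof -
      have "(\<Sum>x\<in>X. \<mu>' x * c x) = (\<Sum>x\<in>X. \<mu> x * c x) + t * (\<Sum>x\<in>X. r x * c x)"
        by (simp add: \<mu>'_def distrib_right sum.distrib sum_distrib_left mult.assoc)
      then show ?thesis using rX t0 by (simp add: mult_nonneg_nonpos)
    qed
    have "{x\<in>X. \<mu>' x \<noteq> 0} \<subseteq> S - {x1}"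
    proof -
      have "\<mu>' x1 = 0" using x1 by (auto simp: \<mu>'_def T_def)
      moreover have "\<mu>' x = 0" if "x \<in> X - S" for x using that by (auto simp: \<mu>'_def S_def r_def)
      ultimately show ?thesis by auto
    qed
    moreover have "x1 \<in> S" using x1(1) by (simp add: T_def)
    ultimately have "{x\<in>X. \<mu>' x \<noteq> 0} \<subset> S" by blast
    then have "card {x\<in>X. \<mu>' x \<noteq> 0} < card S" by (rule psubset_card_mono[OF finS])
    then have "\<exists>B\<in>bases X. (\<forall>b\<in>B. 0 \<le> representation B (\<Sum>x\<in>X. \<mu>' x *\<^sub>R x) b) \<and>
           interpolate B c (\<Sum>x\<in>X. \<mu>' x *\<^sub>R x) \<le> (\<Sum>x\<in>X. \<mu>' x * c x)"
      using less.hyps[of \<mu>'] pos by (auto simp: S_def)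
    then show ?thesis using cost' unfolding sum' by (meson order_trans)
  qed
qed

text \<open>
  A feasible basis of minimal cost is a cell, because otherwise a pivot step as in the simplex
  algorithm would lower the cost.
\<close>

lemma triangulation_cell_exists:
  fixes h :: "'a::real_vector \<Rightarrow> real"
  assumes "finite X" "linear h" "\<And>x. x \<in> X \<Longrightarrow> h x = 1"
    and c: "\<And>B x. B \<in> bases X \<Longrightarrow> x \<in> X - B \<Longrightarrow> interpolate B c x \<noteq> c x"
    and y: "y \<in> poscone X" "\<And>B b. B \<in> bases X \<Longrightarrow> b \<in> B \<Longrightarrow> representation B y b \<noteq> 0"
  shows "\<exists>B\<in>triangulation X c. \<forall>b\<in>B. 0 < representation B y b"
proof -
  define F where "F = {B \<in> bases X. \<forall>b\<in>B. 0 \<le> representation B y b}"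
  obtain \<mu> where \<mu>: "y = (\<Sum>x\<in>X. \<mu> x *\<^sub>R x)" "\<And>x. x \<in> X \<Longrightarrow> 0 \<le> \<mu> x"
    using y(1) by (auto simp: poscone_def)
  have fin: "finite F" using assms(1) by (auto simp: F_def bases_def)
  have "F \<noteq> {}" using conic_reduction[OF assms(1-3), of \<mu> c] \<mu> by (auto simp: F_def)
  then obtain B where B: "B \<in> F" and Bmin: "\<And>B'. B' \<in> F \<Longrightarrow> interpolate B c y \<le> interpolate B' c y"
    using arg_min_if_finite(1)[OF fin, of "\<lambda>B. interpolate B c y"]
      arg_min_least[OF fin, of _ "\<lambda>B. interpolate B c y"] by blast
  have BX: "B \<in> bases X" using B by (simp add: F_def)
  note BD = basesD[OF BX assms(1)]
  have pos: "0 < representation B y b" if "b \<in> B" for b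
    using B y(2)[OF BX that] that by (force simp: F_def)
  have yspan: "y \<in> span B" using poscone_span y(1) bases_span[OF BX] by blast
  have "interpolate B c j < c j" if j: "j \<in> X - B" for j
  proof (rule ccontr)
    assume "\<not> ?thesis"
    then have gt: "interpolate B c j > c j" using c[OF BX j] by auto
    \<comment> \<open>Pivot: moving weight \<open>e\<close> onto \<open>j\<close> keeps the basis
      coefficients positive for small \<open>e\<close>, because genericity of \<open>y\<close> makes
      them strictly positive, and it lowers the cost by
      \<open>e * (interpolate B c j - c j)\<close>.\<close>
    obtain e where e: "e > 0" "\<And>b. b \<in> B \<Longrightarrow> representation B y b + e * - representation B j b > 0"
      using small_perturbation[OF BD(4), of "representation B y" "\<lambda>b. - representation B j b"] pos by metis
    define \<nu> where "\<nu> x = (if x = j then e else if x \<in> B then representation B y x - e * representation B j x else 0)" for x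
    have ins: "insert j B \<subseteq> X" "j \<notin> B" using j BD by auto
    have nu0: "\<nu> x = 0" if "x \<in> X - insert j B" for x using that by (simp add: \<nu>_def)
    have nuj: "\<nu> j = e" by (simp add: \<nu>_def)
    have nuB: "(\<Sum>b\<in>B. \<nu> b *\<^sub>R b) = y - e *\<^sub>R j"
    proof -
      have "(\<Sum>b\<in>B. \<nu> b *\<^sub>R b) = (\<Sum>b\<in>B. representation B y b *\<^sub>R b - e *\<^sub>R (representation B j b *\<^sub>R b))"
        using ins by (intro sum.cong) (auto simp: \<nu>_def scaleR_left_diff_distrib)
      also have "\<dots> = y - e *\<^sub>R j"
        using lincomb_representation[OF BD(2,4) yspan] lincomb_representation[OF BD(2,4), of j] j BD(3)
        by (simp add: sum_subtractf scaleR_sum_right[symmetric] subsetD del: scaleR_scaleR)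
      finally show ?thesis .
    qed
    have nuc: "(\<Sum>b\<in>B. \<nu> b * c b) = interpolate B c y - e * interpolate B c j"
    proof -
      have "(\<Sum>b\<in>B. \<nu> b * c b) = (\<Sum>b\<in>B. representation B y b * c b - e * (representation B j b * c b))"
        using ins by (intro sum.cong) (auto simp: \<nu>_def algebra_simps)
      then show ?thesis by (simp add: interpolate_def sum_subtractf sum_distrib_left)
    qed
    have ysum: "(\<Sum>x\<in>X. \<nu> x *\<^sub>R x) = y"
    proof -
      have "(\<Sum>x\<in>X. \<nu> x *\<^sub>R x) = (\<Sum>x\<in>insert j B. \<nu> x *\<^sub>R x)"
        using ins assms(1) nu0 by (intro sum.mono_neutral_right) auto
      then show ?thesis using ins BD(4) by (simp add: nuj nuB)
    qed
    have csum: "(\<Sum>x\<in>X. \<nu> x * c x) = interpolate B c y - e * (interpolate B c j - c j)"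
    proof -
      have "(\<Sum>x\<in>X. \<nu> x * c x) = (\<Sum>x\<in>insert j B. \<nu> x * c x)"
        using ins assms(1) nu0 by (intro sum.mono_neutral_right) auto
      then show ?thesis using ins BD(4) by (simp add: nuj nuc algebra_simps)
    qed
    \<comment> \<open>The support of \<open>\<nu>\<close> need not be independent; the reduction
      turns it into a feasible basis without raising the cost, against the minimality of
      \<open>B\<close>.\<close>
    have "0 \<le> \<nu> x" for x using e by (force simp: \<nu>_def)
    then obtain B' where B': "B' \<in> bases X" "\<forall>b\<in>B'. 0 \<le> representation B' y b"
        "interpolate B' c y \<le> interpolate B c y - e * (interpolate B c j - c j)"
      using conic_reduction[OF assms(1-3), of \<nu> c] ysum csum by auto
    then have "interpolate B c y \<le> interpolate B' c y" using Bmin by (auto simp: F_def)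
    moreover have "e * (interpolate B c j - c j) > 0" using e gt by simp
    ultimately show False using B'(3) by linarith
  qed
  then show ?thesis using BX pos by (auto simp: triangulation_def)
qed

text \<open>The functional \<open>interpolate B c\<close> equals \<open>c\<close> on
  \<open>B\<close> and lies strictly below it elsewhere on \<open>X\<close>, so it bounds the cost
  of every nonnegative combination, and equality forces the support into \<open>B\<close>. This is
  weak duality with complementary slackness.\<close>

lemma triangulation_cost_le:
  assumes "finite X" "B \<in> triangulation X c" "\<And>x. x \<in> X \<Longrightarrow> 0 \<le> \<mu> x"
  shows "interpolate B c (\<Sum>x\<in>X. \<mu> x *\<^sub>R x) \<le> (\<Sum>x\<in>X. \<mu> x * c x)"
    and "interpolate B c (\<Sum>x\<in>X. \<mu> x *\<^sub>R x) = (\<Sum>x\<in>X. \<mu> x * c x) \<Longrightarrow> x \<in> X - B \<Longrightarrow> \<mu> x = 0"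
proof -
  have BX: "B \<in> bases X" using assms by (simp add: triangulation_def)
  have le: "\<mu> x * interpolate B c x \<le> \<mu> x * c x" if "x \<in> X" for x
    using interpolate_base[OF BX assms(1), of x c] assms that
    by (cases "x \<in> B") (auto simp: triangulation_def intro!: mult_left_mono intro: less_imp_le)
  show "interpolate B c (\<Sum>x\<in>X. \<mu> x *\<^sub>R x) \<le> (\<Sum>x\<in>X. \<mu> x * c x)"
    unfolding interpolate_sum[OF BX assms(1)] by (rule sum_mono) (rule le)
  assume eq: "interpolate B c (\<Sum>x\<in>X. \<mu> x *\<^sub>R x) = (\<Sum>x\<in>X. \<mu> x * c x)" and x: "x \<in> X - B"
  have "\<mu> x * interpolate B c x = \<mu> x * c x"
    using sum_mono_inv[OF eq[unfolded interpolate_sum[OF BX assms(1)]], of x] le x assms(1) by auto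
  moreover have "interpolate B c x < c x" using assms(2) x by (auto simp: triangulation_def)
  ultimately show "\<mu> x = 0" by simp
qed

text \<open>Each cell yields a cheapest representation of \<open>y\<close>, so the two costs agree;
  complementary slackness in both directions then gives mutual inclusion.\<close>

lemma triangulation_cell_unique:
  assumes "finite X" "B \<in> triangulation X c" "B' \<in> triangulation X c" "y \<in> span X"
    and "\<And>b. b \<in> B \<Longrightarrow> 0 < representation B y b" "\<And>b. b \<in> B' \<Longrightarrow> 0 < representation B' y b"
  shows "B = B'"
proof -
  have *: "interpolate B c y \<le> interpolate B' c y \<and> (interpolate B c y = interpolate B' c y \<longrightarrow> B' \<subseteq> B)"
    if B: "B \<in> triangulation X c" "B' \<in> triangulation X c" "\<And>b. b \<in> B' \<Longrightarrow> 0 < representation B' y b" for B B'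
  proof -
    have B'X: "B' \<in> bases X" using that by (simp add: triangulation_def)
    note BD = basesD[OF B'X assms(1)]
    define \<mu> where "\<mu> x = (if x \<in> B' then representation B' y x else 0)" for x
    have pos: "0 \<le> \<mu> x" for x using B(3) by (force simp: \<mu>_def)
    have "(\<Sum>x\<in>X. \<mu> x *\<^sub>R x) = (\<Sum>x\<in>B'. representation B' y x *\<^sub>R x)"
      using BD assms(1) by (intro sum.mono_neutral_cong_right) (auto simp: \<mu>_def)
    then have y: "(\<Sum>x\<in>X. \<mu> x *\<^sub>R x) = y"
      using lincomb_representation[OF BD(2,4)] bases_span[OF B'X] assms(4) by simp
    have c: "(\<Sum>x\<in>X. \<mu> x * c x) = interpolate B' c y"
      unfolding interpolate_def using BD assms(1) by (intro sum.mono_neutral_cong_right) (auto simp: \<mu>_def)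
    have "B' \<subseteq> B" if eq: "interpolate B c y = interpolate B' c y"
    proof
      fix x assume x: "x \<in> B'"
      show "x \<in> B"
      proof (rule ccontr)
        assume "x \<notin> B"
        then have "\<mu> x = 0" using triangulation_cost_le(2)[OF assms(1) B(1), of \<mu> x] pos y c eq x BD by auto
        then show False using B(3)[OF x] x by (simp add: \<mu>_def)
      qed
    qed
    then show ?thesis using triangulation_cost_le(1)[OF assms(1) B(1), of \<mu>] pos y c by auto
  qed
  show ?thesis using *[OF assms(2,3,6)] *[OF assms(3,2,5)] by auto
qed

text \<open>
  \<open>y\<close> belongs to the half-open cell of \<open>B\<close> if and only if \<open>y + \<epsilon>q\<close> is an interior point of the cone
  over \<open>B\<close> for all small \<open>\<epsilon> > 0\<close>.
\<close>

lemma half_open_partition: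
  fixes h :: "'a::real_vector \<Rightarrow> real"
  assumes "finite X" "linear h" "\<And>x. x \<in> X \<Longrightarrow> h x = 1"
    and c: "\<And>B x. B \<in> bases X \<Longrightarrow> x \<in> X - B \<Longrightarrow> interpolate B c x \<noteq> c x"
    and q: "q \<in> poscone X" "\<And>B b. B \<in> bases X \<Longrightarrow> b \<in> B \<Longrightarrow> representation B q b \<noteq> 0"
    and y: "y \<in> poscone X"
  shows "\<exists>!B. B \<in> triangulation X c \<and> y \<in> half_open_cone B (\<lambda>b. b) {b. representation B q b < 0}"
proof -
  \<comment> \<open>Indexing by all pairs of a basis and one of its elements makes a single
    \<open>e\<close> serve all bases at once.\<close>
  define I where "I = Sigma (bases X) (\<lambda>B. B)"
  have finI: "finite I" unfolding I_def using assms(1) basesD(4)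
    by (intro finite_SigmaI) (auto simp: bases_def)
  obtain e where e: "e > 0"
    "\<And>i. i \<in> I \<Longrightarrow> representation (fst i) y (snd i) > 0 \<Longrightarrow> representation (fst i) y (snd i) + e * representation (fst i) q (snd i) > 0"
    "\<And>i. i \<in> I \<Longrightarrow> representation (fst i) y (snd i) < 0 \<Longrightarrow> representation (fst i) y (snd i) + e * representation (fst i) q (snd i) < 0"
    using small_perturbation[OF finI, of "\<lambda>i. representation (fst i) y (snd i)" "\<lambda>i. representation (fst i) q (snd i)"] by blast
  define y' where "y' = y + e *\<^sub>R q"
  have y'cone: "y' \<in> poscone X"
  proof -
    obtain \<mu> \<nu> where *: "y = (\<Sum>x\<in>X. \<mu> x *\<^sub>R x)" "q = (\<Sum>x\<in>X. \<nu> x *\<^sub>R x)" "\<forall>x\<in>X. 0 \<le> \<mu> x" "\<forall>x\<in>X. 0 \<le> \<nu> x"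
      using q(1) y by (auto simp: poscone_def)
    have "y' = (\<Sum>x\<in>X. (\<mu> x + e * \<nu> x) *\<^sub>R x)"
      by (simp add: y'_def * scaleR_left_distrib sum.distrib scaleR_sum_right)
    then show ?thesis unfolding poscone_def using * e(1)
      by (intro CollectI exI[of _ "\<lambda>x. \<mu> x + e * \<nu> x"]) auto
  qed
  have rep: "representation B y' b = representation B y b + e * representation B q b" if "B \<in> bases X" for B b
  proof -
    have "y \<in> span B" "q \<in> span B" using bases_span[OF that] poscone_span q(1) y by blast+
    then show ?thesis using basesD(2)[OF that assms(1)]
      by (simp add: y'_def real_vector.representation_add real_vector.representation_scale span_scale)
  qed
  have ne: "representation B y' b \<noteq> 0" if "B \<in> bases X" "b \<in> B" for B b
    using e(2,3)[of "(B,b)"] that q(2)[OF that] rep[OF that(1)] e(1)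
    by (cases "representation B y b" "0::real" rule: linorder_cases) (auto simp: I_def)
  have iff: "y \<in> half_open_cone B (\<lambda>b. b) {b. representation B q b < 0} \<longleftrightarrow> (\<forall>b\<in>B. 0 < representation B y' b)"
    if "B \<in> bases X" for B
  proof -
    have "(0 \<le> representation B y b \<and> (representation B q b < 0 \<longrightarrow> 0 < representation B y b)) \<longleftrightarrow> 0 < representation B y' b"
      if "b \<in> B" for b
      using e(2,3)[of "(B,b)"] that \<open>B \<in> bases X\<close> q(2)[OF \<open>B \<in> bases X\<close> that] rep[OF \<open>B \<in> bases X\<close>] e(1)
      by (cases "representation B y b" "0::real" rule: linorder_cases) (auto simp: I_def zero_less_mult_iff)
    then show ?thesis
      using half_open_cone_iff[OF basesD(2,4)[OF that assms(1)]] bases_span[OF that] poscone_span[of X] y by auto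
  qed
  have tb: "B \<in> bases X" if "B \<in> triangulation X c" for B using that by (simp add: triangulation_def)
  obtain B where B: "B \<in> triangulation X c" "\<forall>b\<in>B. 0 < representation B y' b"
    using triangulation_cell_exists[OF assms(1-3) c y'cone ne] by blast
  show ?thesis
  proof (rule ex1I[of _ B])
    show "B \<in> triangulation X c \<and> y \<in> half_open_cone B (\<lambda>b. b) {b. representation B q b < 0}" using B iff tb by auto
    show "B' = B" if "B' \<in> triangulation X c \<and> y \<in> half_open_cone B' (\<lambda>b. b) {b. representation B' q b < 0}" for B'
      proof -
      have "y' \<in> span X" using y'cone poscone_span by blast
      moreover have "\<forall>b\<in>B'. 0 < representation B' y' b" using that iff[OF tb] by blast
      ultimately show ?thesis using triangulation_cell_unique[OF assms(1) _ B(1), of B' y'] that B(2) by blast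
    qed
  qed
qed

text \<open>The coefficient at \<open>b\<close> over \<open>B\<close> is a functional with value 1
  at the point \<open>b\<close> of \<open>X\<close>, so generic positive weights make all these
  finitely many functionals nonzero.\<close>

lemma generic_cone_point:
  assumes "finite X"
  shows "\<exists>q\<in>poscone X. \<forall>B\<in>bases X. \<forall>b\<in>B. representation B q b \<noteq> 0"
proof -
  define A where "A = (\<lambda>(B,b). \<lambda>x. representation B x b) ` (Sigma (bases X) (\<lambda>B. B))"
  have "finite A" unfolding A_def using assms basesD(4)
    by (intro finite_imageI finite_SigmaI) (auto simp: bases_def)
  moreover have "\<exists>x\<in>X. a x \<noteq> 0" if "a \<in> A" for a
  proof -
    obtain B b where "B \<in> bases X" "b \<in> B" "a = (\<lambda>x. representation B x b)" using \<open>a \<in> A\<close> by (auto simp: A_def)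
    then show ?thesis using basesD[OF _ assms] by (intro bexI[of _ b]) (auto simp: real_vector.representation_basis)
  qed
  ultimately obtain g where g: "\<forall>x. 0 < g x" "\<forall>a\<in>A. (\<Sum>x\<in>X. a x * g x) \<noteq> 0"
    using generic_weights[OF assms] by blast
  show ?thesis
  proof (intro bexI[of _ "\<Sum>x\<in>X. g x *\<^sub>R x"] ballI)
    show "(\<Sum>x\<in>X. g x *\<^sub>R x) \<in> poscone X" using g(1) by (auto simp: poscone_def intro: less_imp_le)
    fix B b assume B: "B \<in> bases X" "b \<in> B"
    then have "(\<Sum>x\<in>X. representation B x b * g x) \<noteq> 0" using g(2) by (auto simp: A_def)
    then show "representation B (\<Sum>x\<in>X. g x *\<^sub>R x) b \<noteq> 0"
      by (simp add: representation_sum_scale[OF B(1) assms] mult.commute)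
  qed
qed

text \<open>Makes a cost generic without losing prescribed cells: strict inequalities valid for
  \<open>c0\<close> survive a small perturbation, and ties are broken by its generic part.\<close>

lemma generic_cost:
  assumes "finite X"
  obtains c where
    "\<And>B x. B \<in> bases X \<Longrightarrow> x \<in> X - B \<Longrightarrow> interpolate B c x \<noteq> c x"
    "\<And>B x. B \<in> bases X \<Longrightarrow> x \<in> X - B \<Longrightarrow> interpolate B c0 x < c0 x \<Longrightarrow> interpolate B c x < c x"
proof -
  define I where "I = Sigma (bases X) (\<lambda>B. X - B)"
  have finI: "finite I" unfolding I_def using assms by (intro finite_SigmaI) (auto simp: bases_def)
  \<comment> \<open>\<open>D i\<close> is the distance of the lifted point above the hyperplane,
    linear in the cost. Its coefficient vector \<open>f i\<close> is nonzero because it is 1 at the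
    point \<open>snd i\<close> itself.\<close>
  define D where "D i c = c (snd i) - interpolate (fst i) c (snd i)" for i :: "'a set \<times> 'a" and c
  define f where "f i = (\<lambda>y. (if y = snd i then 1 else 0) - (if y \<in> fst i then representation (fst i) (snd i) y else 0))" for i :: "'a set \<times> 'a"
  have Df: "D i c = (\<Sum>x\<in>X. f i x * c x)" if "i \<in> I" for i c
  proof -
    have "(\<Sum>x\<in>X. f i x * c x) = (\<Sum>x\<in>X. (if x = snd i then c x else 0)) - (\<Sum>x\<in>X. (if x \<in> fst i then representation (fst i) (snd i) x * c x else 0))"
      unfolding sum_subtractf[symmetric] by (intro sum.cong) (auto simp: f_def algebra_simps)
    also have "(\<Sum>x\<in>X. (if x \<in> fst i then representation (fst i) (snd i) x * c x else 0)) = (\<Sum>x\<in>fst i. representation (fst i) (snd i) x * c x)"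
      using that assms by (intro sum.mono_neutral_cong_right) (auto simp: I_def bases_def)
    also have "(\<Sum>x\<in>X. (if x = snd i then c x else 0)) = c (snd i)"
      using that assms by (auto simp: I_def)
    finally show ?thesis by (simp add: D_def interpolate_def)
  qed
  have "\<exists>x\<in>X. a x \<noteq> 0" if "a \<in> f ` I" for a
    using that by (auto simp: I_def f_def)
  then obtain g where g: "\<forall>x. 0 < g x" "\<forall>a\<in>f ` I. (\<Sum>x\<in>X. a x * g x) \<noteq> 0"
    using generic_weights[OF assms finite_imageI[OF finI]] by blast
  obtain e where e: "e > 0" "\<And>i. i \<in> I \<Longrightarrow> D i c0 > 0 \<Longrightarrow> D i c0 + e * D i g > 0"
    "\<And>i. i \<in> I \<Longrightarrow> D i c0 < 0 \<Longrightarrow> D i c0 + e * D i g < 0"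
    using small_perturbation[OF finI, of "\<lambda>i. D i c0" "\<lambda>i. D i g"] by blast
  have Dc: "D i (\<lambda>x. c0 x + e * g x) = D i c0 + e * D i g" if "i \<in> I" for i
    unfolding Df[OF that] by (simp add: distrib_left sum.distrib sum_distrib_left mult.left_commute)
  show ?thesis
  proof (rule that[of "\<lambda>x. c0 x + e * g x"])
    fix B x assume B: "B \<in> bases X" "x \<in> X - B"
    then have i: "(B, x) \<in> I" by (simp add: I_def)
    have "D (B, x) g \<noteq> 0" using g(2) i by (simp add: Df)
    then have "D (B, x) (\<lambda>x. c0 x + e * g x) \<noteq> 0"
      unfolding Dc[OF i] using e(2,3)[OF i] e(1) by (cases "D (B,x) c0" "0::real" rule: linorder_cases) auto
    then show "interpolate B (\<lambda>x. c0 x + e * g x) x \<noteq> c0 x + e * g x" by (simp add: D_def)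
    assume "interpolate B c0 x < c0 x"
    then have "D (B, x) (\<lambda>x. c0 x + e * g x) > 0" unfolding Dc[OF i] using e(2)[OF i] by (simp add: D_def)
    then show "interpolate B (\<lambda>x. c0 x + e * g x) x < c0 x + e * g x" by (simp add: D_def)
  qed
qed

section \<open>Generating functions of half-open cones\<close>

definition indep_family :: "'i set \<Rightarrow> ('i \<Rightarrow> 'a::real_vector) \<Rightarrow> bool" where
  "indep_family I p \<longleftrightarrow> finite I \<and> (\<forall>r. (\<Sum>i\<in>I. r i *\<^sub>R p i) = 0 \<longrightarrow> (\<forall>i\<in>I. r i = 0))"

text \<open>The fundamental parallelepiped of the generators. At indices of \<open>N\<close>, where
  the cone misses a facet, the half-open interval is flipped so that nonnegative integral translates
  still tile the cone.\<close>

definition half_open_box :: "'i set \<Rightarrow> ('i \<Rightarrow> 'a::real_vector) \<Rightarrow> 'i set \<Rightarrow> 'a set" where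
  "half_open_box I p N = {\<Sum>i\<in>I. r i *\<^sub>R p i | r. \<forall>i\<in>I. if i \<in> N then 0 < r i \<and> r i \<le> 1 else 0 \<le> r i \<and> r i < 1}"

text \<open>
  Interpolates between the half-open cone (\<open>A = {}\<close>) and the half-open box (\<open>A = I\<close>); enlarging \<open>A\<close>
  by one index multiplies the generating function by \<open>1 - t\<close>.
\<close>

definition partial_box :: "'i set \<Rightarrow> ('i \<Rightarrow> 'a::real_vector) \<Rightarrow> 'i set \<Rightarrow> 'i set \<Rightarrow> 'a set" where
  "partial_box I p N A = {\<Sum>i\<in>I. r i *\<^sub>R p i | r. \<forall>i\<in>I. 0 \<le> r i \<and> (i \<in> N \<longrightarrow> 0 < r i) \<and>
     (i \<in> A \<longrightarrow> (if i \<in> N then r i \<le> 1 else r i < 1))}"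

definition height_series :: "('a \<Rightarrow> real) \<Rightarrow> 'a set \<Rightarrow> int fps" where
  "height_series h S = Abs_fps (\<lambda>n. int (card {z\<in>S. h z = real n}))"

lemma indep_familyD:
  assumes "indep_family I p" "(\<Sum>i\<in>I. r i *\<^sub>R p i) = (\<Sum>i\<in>I. s i *\<^sub>R p i)" "i \<in> I"
  shows "r i = s i"
proof -
  have "(\<Sum>i\<in>I. (r i - s i) *\<^sub>R p i) = 0"
    using assms(2) by (simp add: scaleR_left_diff_distrib sum_subtractf)
  moreover have "(\<Sum>i\<in>I. u i *\<^sub>R p i) = 0 \<longrightarrow> (\<forall>i\<in>I. u i = 0)" for u
    using assms(1) unfolding indep_family_def by blast
  from this[of "\<lambda>i. r i - s i"] calculation have "r i - s i = 0" using assms(3) by simp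
  then show ?thesis by simp
qed

lemma partial_box_empty: "partial_box I p N {} = half_open_cone I p N"
  by (simp add: partial_box_def half_open_cone_def)

lemma partial_box_all:
  fixes I :: "'i set"
  shows "partial_box I p N I = half_open_box I p N"
proof -
  have "(\<forall>i\<in>I. 0 \<le> r i \<and> (i \<in> N \<longrightarrow> 0 < r i) \<and> (i \<in> I \<longrightarrow> (if i \<in> N then r i \<le> 1 else r i < 1))) \<longleftrightarrow>
    (\<forall>i\<in>I. if i \<in> N then 0 < r i \<and> r i \<le> 1 else 0 \<le> r i \<and> r i < 1)" for r :: "'i \<Rightarrow> real"
    by (intro ball_cong refl) (auto intro: order.strict_implies_order)
  then show ?thesis unfolding partial_box_def half_open_box_def by simp
qed

lemma partial_box_subset: "partial_box I p N A \<subseteq> half_open_cone I p N"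
  unfolding partial_box_def half_open_cone_def by blast

lemma sum_fun_upd_scaleR:
  fixes p :: "'i \<Rightarrow> 'a::real_vector"
  assumes "finite I" "b \<in> I"
  shows "(\<Sum>i\<in>I. (r(b := r b + t)) i *\<^sub>R p i) = (\<Sum>i\<in>I. r i *\<^sub>R p i) + t *\<^sub>R p b"
proof -
  have "(\<Sum>i\<in>I. (r(b := r b + t)) i *\<^sub>R p i) = (\<Sum>i\<in>I. r i *\<^sub>R p i + (if i = b then t *\<^sub>R p b else 0))"
    by (intro sum.cong) (auto simp: scaleR_left_distrib)
  also have "\<dots> = (\<Sum>i\<in>I. r i *\<^sub>R p i) + t *\<^sub>R p b"
    using assms by (simp add: sum.distrib)
  finally show ?thesis .
qed

text \<open>A point that meets the bounds for \<open>A\<close> but not the new one at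
  \<open>b\<close> has coefficient at least 1 there (more than 1 if \<open>b \<in> N\<close>), so
  subtracting \<open>p b\<close> does not leave the set. The converse rests on the uniqueness of
  coefficients.\<close>

lemma partial_box_insert:
  assumes ind: "indep_family I p" and b: "b \<in> I" "b \<notin> A"
  shows "partial_box I p N A - partial_box I p N (insert b A) = (\<lambda>z. z + p b) ` partial_box I p N A"
proof -
  have fin: "finite I" using ind by (simp add: indep_family_def)
  show ?thesis
  proof (intro equalityI subsetI)
    fix z assume "z \<in> partial_box I p N A - partial_box I p N (insert b A)"
    then obtain r where r: "z = (\<Sum>i\<in>I. r i *\<^sub>R p i)" and
      rc: "\<forall>i\<in>I. 0 \<le> r i \<and> (i \<in> N \<longrightarrow> 0 < r i) \<and> (i \<in> A \<longrightarrow> (if i \<in> N then r i \<le> 1 else r i < 1))"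
      and n: "z \<notin> partial_box I p N (insert b A)"
      unfolding partial_box_def by auto
    have "\<not> (if b \<in> N then r b \<le> 1 else r b < 1)"
    proof
      assume "if b \<in> N then r b \<le> 1 else r b < 1"
      then have "z \<in> partial_box I p N (insert b A)"
        unfolding partial_box_def using r rc by (intro CollectI exI[of _ r] conjI) auto
      then show False using n by simp
    qed
    then have "(\<Sum>i\<in>I. (r(b := r b + - 1)) i *\<^sub>R p i) \<in> partial_box I p N A"
      unfolding partial_box_def using rc b
      by (intro CollectI exI[of _ "r(b := r b + - 1)"] conjI refl) (auto split: if_splits)
    then show "z \<in> (\<lambda>z. z + p b) ` partial_box I p N A"
      unfolding sum_fun_upd_scaleR[OF fin b(1)] using r by (intro image_eqI[of _ _ "z - p b"]) auto
  next
    fix z assume "z \<in> (\<lambda>z. z + p b) ` partial_box I p N A"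
    then obtain r where r: "z = (\<Sum>i\<in>I. r i *\<^sub>R p i) + 1 *\<^sub>R p b" and
      rc: "\<forall>i\<in>I. 0 \<le> r i \<and> (i \<in> N \<longrightarrow> 0 < r i) \<and> (i \<in> A \<longrightarrow> (if i \<in> N then r i \<le> 1 else r i < 1))"
      unfolding partial_box_def by auto
    have z: "z = (\<Sum>i\<in>I. (r(b := r b + 1)) i *\<^sub>R p i)" using r sum_fun_upd_scaleR[OF fin b(1)] by metis
    have "z \<in> partial_box I p N A"
      unfolding partial_box_def using rc b
      by (intro CollectI exI[of _ "r(b := r b + 1)"] conjI z) (auto intro: add_nonneg_pos)
    moreover have "z \<notin> partial_box I p N (insert b A)"
    proof
      assume "z \<in> partial_box I p N (insert b A)"
      then obtain s where s: "z = (\<Sum>i\<in>I. s i *\<^sub>R p i)" "if b \<in> N then s b \<le> 1 else s b < 1"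
        unfolding partial_box_def using b by blast
      then have "s b = r b + 1" using indep_familyD[OF ind s(1)[symmetric, unfolded z] b(1)] by simp
      then show False using s(2) rc b by (force split: if_splits)
    qed
    ultimately show "z \<in> partial_box I p N A - partial_box I p N (insert b A)" by simp
  qed
qed

lemma half_open_cone_height_nonneg:
  assumes "linear h" "\<And>i. i \<in> I \<Longrightarrow> h (p i) = (1::real)" "z \<in> half_open_cone I p N"
  shows "0 \<le> h z"
proof -
  obtain r where r: "z = (\<Sum>i\<in>I. r i *\<^sub>R p i)" "\<forall>i\<in>I. 0 \<le> r i"
    using assms(3) by (auto simp: half_open_cone_def)
  have "h z = (\<Sum>i\<in>I. r i)"
    by (simp add: r(1) linear_sum[OF assms(1)] linear_scale[OF assms(1)] assms(2))
  then show ?thesis using r(2) by (simp add: sum_nonneg)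
qed

text \<open>The part cut off is a copy of the whole shifted by \<open>p b\<close>, a vector of
  height 1, so its series is the original one times \<open>fps_X\<close>.\<close>

lemma partial_box_series_insert:
  assumes ind: "indep_family I p" and b: "b \<in> I" "b \<notin> A"
    and h: "linear h" "\<And>i. i \<in> I \<Longrightarrow> h (p i) = (1::real)"
    and G: "\<And>z. z + p b \<in> G \<longleftrightarrow> z \<in> G"
    and fin: "\<And>n. finite {z \<in> half_open_cone I p N \<inter> G. h z = real n}"
  shows "(1 - fps_X) * height_series h (partial_box I p N A \<inter> G) =
         height_series h (partial_box I p N (insert b A) \<inter> G)"
proof (rule fps_ext)
  fix n
  define M where "M t = {z \<in> partial_box I p N A \<inter> G. h z = t}" for t
  define M' where "M' = {z \<in> partial_box I p N (insert b A) \<inter> G. h z = real n}"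
  have finM: "finite (M (real n))" for n
    by (rule finite_subset[OF _ fin[of n]]) (use partial_box_subset[of I p N A] in \<open>auto simp: M_def\<close>)
  have sub: "partial_box I p N (insert b A) \<subseteq> partial_box I p N A"
    unfolding partial_box_def by blast
  have h_add: "h (z + p b) = h z + 1" for z using h(2)[OF b(1)] by (simp add: linear_add[OF h(1)])
  have "M (real n) - M' = (\<lambda>z. z + p b) ` M (real n - 1)"
  proof -
    have "M (real n) - M' = {z \<in> partial_box I p N A - partial_box I p N (insert b A). z \<in> G \<and> h z = real n}"
      by (auto simp: M_def M'_def)
    also have "\<dots> = (\<lambda>z. z + p b) ` M (real n - 1)"
      unfolding partial_box_insert[OF ind b] by (auto simp: M_def h_add G)
    finally show ?thesis .
  qed
  moreover have "M' \<subseteq> M (real n)" using sub by (auto simp: M_def M'_def)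
  moreover have "card ((\<lambda>z. z + p b) ` M (real n - 1)) = card (M (real n - 1))"
    by (intro card_image inj_onI) simp
  ultimately have card: "card (M (real n)) = card M' + card (M (real n - 1))"
    using finM[of n] by (metis card_Diff_subset card_mono finite_subset le_add_diff_inverse)
  show "fps_nth ((1 - fps_X) * height_series h (partial_box I p N A \<inter> G)) n =
        fps_nth (height_series h (partial_box I p N (insert b A) \<inter> G)) n"
  proof (cases n)
    case 0
    \<comment> \<open>The shifted copy would come from height -1, where the cone has no
      points.\<close>
    have "M (real n - 1) = {}"
      using 0 half_open_cone_height_nonneg[OF h, where N = N] partial_box_subset[of I p N A] by (fastforce simp: M_def)
    then have "card (M (real n)) = card M'" using card by simp
    then show ?thesis using 0 by (simp add: height_series_def M_def M'_def left_diff_distrib)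
  next
    case (Suc m)
    then show ?thesis using card by (simp add: height_series_def M_def M'_def left_diff_distrib)
  qed
qed

text \<open>The box gives the numerator of the Hilbert series of a simplicial cone, with one factor
  \<open>1 - fps_X\<close> for each generator.\<close>

lemma half_open_cone_series:
  assumes ind: "indep_family I p"
    and h: "linear h" "\<And>i. i \<in> I \<Longrightarrow> h (p i) = (1::real)"
    and G: "\<And>i z. i \<in> I \<Longrightarrow> z + p i \<in> G \<longleftrightarrow> z \<in> G"
    and fin: "\<And>n. finite {z \<in> half_open_cone I p N \<inter> G. h z = real n}"
  shows "(1 - fps_X) ^ card I * height_series h (half_open_cone I p N \<inter> G) =
         height_series h (half_open_box I p N \<inter> G)"
proof -
  have finI: "finite I" using ind by (simp add: indep_family_def)
  have "(1 - fps_X) ^ card A * height_series h (half_open_cone I p N \<inter> G) =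
         height_series h (partial_box I p N A \<inter> G)" if "A \<subseteq> I" for A
    using finite_subset[OF that finI] that
  proof (induction A rule: finite_induct)
    case empty
    then show ?case by (simp add: partial_box_empty)
  next
    case (insert b A)
    then have "(1 - fps_X) * height_series h (partial_box I p N A \<inter> G) =
         height_series h (partial_box I p N (insert b A) \<inter> G)"
      by (intro partial_box_series_insert ind h G fin) auto
    then show ?case using insert by (simp add: mult.assoc)
  qed
  from this[of I] show ?thesis by (simp add: partial_box_all)
qed

section \<open>Integer vectors and the cone over the lifted polytope\<close>

lemma lookup_scaleR [simp]: "Poly_Mapping.lookup (r *\<^sub>R x) i = r * Poly_Mapping.lookup (x::vect) i"
proof -
  have "finite {i. r *\<^sub>R Poly_Mapping.lookup x i \<noteq> 0}"
    by (rule finite_subset[of _ "Poly_Mapping.keys x"]) (auto simp: in_keys_iff)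
  then show ?thesis by (simp add: scaleR_poly_mapping_def Abs_poly_mapping_inverse)
qed

lemma linear_lookup: "linear (\<lambda>x::vect. Poly_Mapping.lookup x i)"
  by (rule linearI) (simp_all add: lookup_add)

lemma lookup_sum_vect [simp]: "Poly_Mapping.lookup (\<Sum>x\<in>A. f x) i = (\<Sum>x\<in>A. Poly_Mapping.lookup (f x :: vect) i)"
  by (rule linear_sum[OF linear_lookup])

lemma lookup_evec [simp]: "Poly_Mapping.lookup (evec j) i = (if i = j then 1 else 0)"
  by (auto simp: evec_def lookup_single when_def)

lemma Rd_iff: "x \<in> Rd d \<longleftrightarrow> (\<forall>i. i \<notin> {1..d} \<longrightarrow> Poly_Mapping.lookup x i = 0)"
  by (auto simp: Rd_def in_keys_iff)

lemma Zd_iff: "x \<in> Zd d \<longleftrightarrow> (\<forall>i. i \<notin> {1..d} \<longrightarrow> Poly_Mapping.lookup x i = 0) \<and> (\<forall>i. Poly_Mapping.lookup x i \<in> \<int>)"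
  by (auto simp: Zd_def Rd_iff)

lemma Zd_add: "x \<in> Zd d \<Longrightarrow> y \<in> Zd d \<Longrightarrow> x + y \<in> Zd d"
  and Zd_diff: "x \<in> Zd d \<Longrightarrow> y \<in> Zd d \<Longrightarrow> x - y \<in> Zd d"
  and Zd_0: "0 \<in> Zd d"
  by (auto simp: Zd_iff lookup_add lookup_minus)

lemma Zd_scale: "x \<in> Zd d \<Longrightarrow> r \<in> \<int> \<Longrightarrow> r *\<^sub>R x \<in> Zd d"
  by (auto simp: Zd_iff)

lemma Zd_sum: "(\<And>i. i \<in> A \<Longrightarrow> f i \<in> Zd d) \<Longrightarrow> (\<Sum>i\<in>A. f i) \<in> Zd d"
  by (induction A rule: infinite_finite_induct) (auto simp: Zd_0 Zd_add)

lemma subspace_Rd: "subspace (Rd d)"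
  by (auto simp: subspace_def Rd_iff lookup_add)

lemma finite_bounded_Zd: "finite {z \<in> Zd m. \<forall>i. \<bar>Poly_Mapping.lookup z i\<bar> \<le> K i}"
proof (rule inj_on_finite)
  have "finite {x::real. x \<in> \<int> \<and> \<bar>x\<bar> \<le> K i}" for i
  proof (rule finite_subset)
    show "{x::real. x \<in> \<int> \<and> \<bar>x\<bar> \<le> K i} \<subseteq> of_int ` {- \<lceil>K i\<rceil>..\<lceil>K i\<rceil>}"
    proof
      fix x :: real assume "x \<in> {x. x \<in> \<int> \<and> \<bar>x\<bar> \<le> K i}"
      then obtain k where k: "x = of_int k" "\<bar>x\<bar> \<le> K i" by (auto elim: Ints_cases)
      then have "k \<in> {- \<lceil>K i\<rceil>..\<lceil>K i\<rceil>}" by (simp add: abs_le_iff) linarith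
      then show "x \<in> of_int ` {- \<lceil>K i\<rceil>..\<lceil>K i\<rceil>}" using k by blast
    qed
  qed simp
  then show "finite (PiE {1..m} (\<lambda>i. {x::real. x \<in> \<int> \<and> \<bar>x\<bar> \<le> K i}))" by (intro finite_PiE) auto
  show "(\<lambda>z. restrict (Poly_Mapping.lookup z) {1..m}) ` {z \<in> Zd m. \<forall>i. \<bar>Poly_Mapping.lookup z i\<bar> \<le> K i}
      \<subseteq> PiE {1..m} (\<lambda>i. {x::real. x \<in> \<int> \<and> \<bar>x\<bar> \<le> K i})"
    by (auto simp: Zd_iff)
  show "inj_on (\<lambda>z. restrict (Poly_Mapping.lookup z) {1..m}) {z \<in> Zd m. \<forall>i. \<bar>Poly_Mapping.lookup z i\<bar> \<le> K i}"
  proof (rule inj_onI)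
    fix x y assume xy: "x \<in> {z \<in> Zd m. \<forall>i. \<bar>Poly_Mapping.lookup z i\<bar> \<le> K i}" "y \<in> {z \<in> Zd m. \<forall>i. \<bar>Poly_Mapping.lookup z i\<bar> \<le> K i}"
      and eq: "restrict (Poly_Mapping.lookup x) {1..m} = restrict (Poly_Mapping.lookup y) {1..m}"
    show "x = y"
    proof (rule poly_mapping_eqI)
      fix i show "Poly_Mapping.lookup x i = Poly_Mapping.lookup y i"
        using xy fun_cong[OF eq, of i] by (cases "i \<in> {1..m}") (auto simp: Zd_iff)
    qed
  qed
qed

abbreviation ht :: "nat \<Rightarrow> vect \<Rightarrow> real" where
  "ht d z \<equiv> Poly_Mapping.lookup z (d + 1)"

lemma poscone_height:
  assumes "\<And>x. x \<in> X \<Longrightarrow> ht d x = 1"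
  shows "ht d (\<Sum>x\<in>X. \<mu> x *\<^sub>R x) = (\<Sum>x\<in>X. \<mu> x)"
  using assms by simp

text \<open>At height \<open>t\<close> the nonnegative coefficients sum to \<open>t\<close>, which
  bounds every coordinate.\<close>

lemma finite_poscone_slice:
  assumes "finite X" "\<And>x. x \<in> X \<Longrightarrow> ht d x = 1"
  shows "finite {z \<in> poscone X \<inter> Zd (d + 1). ht d z = t}"
proof (rule finite_subset[OF _ finite_bounded_Zd])
  show "{z \<in> poscone X \<inter> Zd (d + 1). ht d z = t} \<subseteq>
    {z \<in> Zd (d + 1). \<forall>i. \<bar>Poly_Mapping.lookup z i\<bar> \<le> (\<Sum>x\<in>X. t * \<bar>Poly_Mapping.lookup x i\<bar>)}"
  proof (intro subsetI CollectI conjI allI)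
    fix z i assume z: "z \<in> {z \<in> poscone X \<inter> Zd (d + 1). ht d z = t}"
    then obtain \<mu> where \<mu>: "z = (\<Sum>x\<in>X. \<mu> x *\<^sub>R x)" "\<forall>x\<in>X. 0 \<le> \<mu> x" by (auto simp: poscone_def)
    have t: "(\<Sum>x\<in>X. \<mu> x) = t" using z poscone_height[OF assms(2)] \<mu>(1) by simp
    have le: "\<mu> x \<le> t" if "x \<in> X" for x
      unfolding t[symmetric] using \<mu>(2) that assms(1) by (intro member_le_sum) auto
    have "\<bar>Poly_Mapping.lookup z i\<bar> \<le> (\<Sum>x\<in>X. \<bar>\<mu> x * Poly_Mapping.lookup x i\<bar>)"
      unfolding \<mu>(1) by simp
    also have "\<dots> \<le> (\<Sum>x\<in>X. t * \<bar>Poly_Mapping.lookup x i\<bar>)"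
      using \<mu>(2) le by (intro sum_mono) (simp add: abs_mult mult_right_mono)
    finally show "\<bar>Poly_Mapping.lookup z i\<bar> \<le> (\<Sum>x\<in>X. t * \<bar>Poly_Mapping.lookup x i\<bar>)" .
  qed auto
qed

lemma poscone_0: "0 \<in> poscone X"
  by (auto simp: poscone_def intro!: exI[of _ "\<lambda>_. 0"])

lemma poscone_height_0:
  assumes "finite X" "\<And>x. x \<in> X \<Longrightarrow> ht d x = 1" "z \<in> poscone X" "ht d z = 0"
  shows "z = 0"
proof -
  obtain \<mu> where \<mu>: "z = (\<Sum>x\<in>X. \<mu> x *\<^sub>R x)" "\<forall>x\<in>X. 0 \<le> \<mu> x" using assms(3) by (auto simp: poscone_def)
  have "(\<Sum>x\<in>X. \<mu> x) = 0" using assms(4) poscone_height[OF assms(2)] \<mu>(1) by simp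
  then show ?thesis using \<mu> assms(1) by (simp add: sum_nonneg_eq_0_iff)
qed

lemma poscone_slice_iff:
  assumes "finite X" "\<And>x. x \<in> X \<Longrightarrow> ht d x = 1" "t > 0"
  shows "z \<in> poscone X \<and> ht d z = t \<longleftrightarrow> z \<in> (\<lambda>x. t *\<^sub>R x) ` (convex hull X)"
proof
  assume z: "z \<in> poscone X \<and> ht d z = t"
  then obtain \<mu> where \<mu>: "z = (\<Sum>x\<in>X. \<mu> x *\<^sub>R x)" "\<forall>x\<in>X. 0 \<le> \<mu> x" by (auto simp: poscone_def)
  have s: "(\<Sum>x\<in>X. \<mu> x) = t" using z poscone_height[OF assms(2)] \<mu>(1) by simp
  have "(\<Sum>x\<in>X. (\<mu> x / t) *\<^sub>R x) \<in> convex hull X"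
    unfolding convex_hull_finite[OF assms(1)] using \<mu>(2) s assms(3)
    by (intro CollectI exI[of _ "\<lambda>x. \<mu> x / t"]) (auto simp: sum_divide_distrib[symmetric])
  moreover have "z = t *\<^sub>R (\<Sum>x\<in>X. (\<mu> x / t) *\<^sub>R x)"
    using assms(3) by (simp add: \<mu>(1) scaleR_sum_right)
  ultimately show "z \<in> (\<lambda>x. t *\<^sub>R x) ` (convex hull X)" by blast
next
  assume "z \<in> (\<lambda>x. t *\<^sub>R x) ` (convex hull X)"
  then obtain u where u: "\<forall>x\<in>X. 0 \<le> u x" "sum u X = 1" "z = t *\<^sub>R (\<Sum>x\<in>X. u x *\<^sub>R x)"
    unfolding convex_hull_finite[OF assms(1)] by auto
  have z: "z = (\<Sum>x\<in>X. (t * u x) *\<^sub>R x)" by (simp add: u(3) scaleR_sum_right)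
  then have "ht d z = t" using poscone_height[OF assms(2), of X "\<lambda>x. t * u x"] u(2) by (simp add: sum_distrib_left[symmetric])
  then show "z \<in> poscone X \<and> ht d z = t" using z u(1) assms(3)
    by (auto simp: poscone_def intro!: exI[of _ "\<lambda>x. t * u x"])
qed

text \<open>Dilates of \<open>P\<close> are the horizontal slices of the cone over \<open>X\<close>;
  the conventional constant term 1 counts the apex \<open>0\<close>.\<close>

lemma delta_eq_cone_series:
  assumes "finite X" "\<And>x. x \<in> X \<Longrightarrow> ht d x = 1" "lift1 d P = convex hull X" "P \<subseteq> Rd d"
  shows "delta d P = (1 - fps_X) ^ (d + 1) * height_series (ht d) (poscone X \<inter> Zd (d + 1))"
proof -
  have "(if n = 0 then 1 else int (card ((\<lambda>x. real n *\<^sub>R x) ` P \<inter> Zd d))) =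
     int (card {z \<in> poscone X \<inter> Zd (d + 1). ht d z = real n})" for n
  proof (cases "n = 0")
    case True
    then have "{z \<in> poscone X \<inter> Zd (d + 1). ht d z = real n} = {0}"
      using poscone_height_0[OF assms(1,2)] by (auto simp: poscone_0 Zd_0)
    then show ?thesis using True by simp
  next
    case False
    define e where "e = real n *\<^sub>R evec (d + 1)"
    have "{z \<in> poscone X \<inter> Zd (d + 1). ht d z = real n} = (\<lambda>y. y + e) ` ((\<lambda>x. real n *\<^sub>R x) ` P \<inter> Zd d)"
    proof (intro equalityI subsetI)
      fix z assume "z \<in> {z \<in> poscone X \<inter> Zd (d + 1). ht d z = real n}"
      then have z: "z \<in> (\<lambda>x. real n *\<^sub>R x) ` lift1 d P" "z \<in> Zd (d + 1)"
        using poscone_slice_iff[OF assms(1,2), of "real n"] False assms(3) by auto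
      then obtain y where y: "y \<in> P" "z = real n *\<^sub>R (y + evec (d + 1))" by (auto simp: lift1_def)
      have yR: "Poly_Mapping.lookup y i = 0" if "i \<notin> {1..d}" for i
        using y(1) assms(4) that by (auto simp: Rd_iff)
      have "real n *\<^sub>R y \<in> Zd d"
        unfolding Zd_iff
      proof (intro conjI allI impI)
        fix i
        show "Poly_Mapping.lookup (real n *\<^sub>R y) i = 0" if "i \<notin> {1..d}" using yR that by simp
        have "Poly_Mapping.lookup z i \<in> \<int>" using z(2) by (simp add: Zd_iff)
        then show "Poly_Mapping.lookup (real n *\<^sub>R y) i \<in> \<int>"
          using yR[of i] by (cases "i = d + 1") (auto simp: y(2) lookup_add)
      qed
      then show "z \<in> (\<lambda>y. y + e) ` ((\<lambda>x. real n *\<^sub>R x) ` P \<inter> Zd d)"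
        using y by (intro image_eqI[of _ _ "real n *\<^sub>R y"]) (auto simp: e_def scaleR_right_distrib)
    next
      fix z assume "z \<in> (\<lambda>y. y + e) ` ((\<lambda>x. real n *\<^sub>R x) ` P \<inter> Zd d)"
      then obtain y where y: "y \<in> P" "real n *\<^sub>R y \<in> Zd d" "z = real n *\<^sub>R y + e" by auto
      have "z = real n *\<^sub>R (y + evec (d + 1))" by (simp add: y e_def scaleR_right_distrib)
      then have "z \<in> (\<lambda>x. real n *\<^sub>R x) ` (convex hull X)" using y(1) assms(3) by (auto simp: lift1_def)
      then have "z \<in> poscone X \<and> ht d z = real n" using poscone_slice_iff[OF assms(1,2), of "real n"] False by auto
      moreover have "z \<in> Zd (d + 1)"
      proof -
        have "real n *\<^sub>R y \<in> Zd (d + 1)" "e \<in> Zd (d + 1)" using y(2) unfolding e_def Zd_iff by (fastforce, auto)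
        then show ?thesis unfolding y(3) by (rule Zd_add)
      qed
      ultimately show "z \<in> {z \<in> poscone X \<inter> Zd (d + 1). ht d z = real n}" by simp
    qed
    moreover have "card ((\<lambda>y. y + e) ` ((\<lambda>x. real n *\<^sub>R x) ` P \<inter> Zd d)) = card ((\<lambda>x. real n *\<^sub>R x) ` P \<inter> Zd d)"
      by (intro card_image inj_onI) simp
    ultimately show ?thesis using False by simp
  qed
  then show ?thesis unfolding delta_def height_series_def by simp
qed

lemma height_series_partition:
  assumes "finite K" "\<And>k. k \<in> K \<Longrightarrow> S k \<subseteq> C"
    and "\<And>z. z \<in> C \<Longrightarrow> \<exists>!k. k \<in> K \<and> z \<in> S k"
    and "\<And>n. finite {z \<in> C. h z = real n}"
  shows "height_series h C = (\<Sum>k\<in>K. height_series h (S k))"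
proof (rule fps_ext)
  fix n
  have ex: "\<exists>k\<in>K. z \<in> S k" if "z \<in> C" for z using assms(3)[OF that] by auto
  have un: "k = l" if "k \<in> K" "l \<in> K" "z \<in> S k" "z \<in> S l" for k l z
  proof -
    have "z \<in> C" using assms(2) that by blast
    then show ?thesis using assms(3)[of z] that by auto
  qed
  have "{z \<in> C. h z = real n} = (\<Union>k\<in>K. {z \<in> S k. h z = real n})"
    using assms(2) ex by blast
  moreover have "card (\<Union>k\<in>K. {z \<in> S k. h z = real n}) = (\<Sum>k\<in>K. card {z \<in> S k. h z = real n})"
  proof (rule card_UN_disjoint)
    show "\<forall>k\<in>K. finite {z \<in> S k. h z = real n}"
      using assms(2) by (intro ballI finite_subset[OF _ assms(4)[of n]]) auto
    show "\<forall>i\<in>K. \<forall>j\<in>K. i \<noteq> j \<longrightarrow> {z \<in> S i. h z = real n} \<inter> {z \<in> S j. h z = real n} = {}"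
      using un by blast
  qed (rule assms(1))
  ultimately show "fps_nth (height_series h C) n = fps_nth (\<Sum>k\<in>K. height_series h (S k)) n"
    by (simp add: height_series_def fps_sum_nth)
qed

text \<open>Stated for an arbitrary indexed dissection because it serves both the triangulation of
  an unknown polytope and the explicit two cells of a square frame. Every cell has
  \<open>d + 1\<close> generators, so the prefactor of \<open>delta\<close> cancels all
  denominators.\<close>

lemma delta_cells:
  assumes X: "finite X" "\<And>x. x \<in> X \<Longrightarrow> ht d x = 1" "lift1 d P = convex hull X" "P \<subseteq> Rd d"
    and K: "finite K" "\<And>k. k \<in> K \<Longrightarrow> half_open_cone (I k) (p k) (N k) \<subseteq> poscone X"
      "\<And>z. z \<in> poscone X \<Longrightarrow> \<exists>!k. k \<in> K \<and> z \<in> half_open_cone (I k) (p k) (N k)"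
    and p: "\<And>k. k \<in> K \<Longrightarrow> indep_family (I k) (p k)" "\<And>k. k \<in> K \<Longrightarrow> card (I k) = d + 1"
      "\<And>k i. k \<in> K \<Longrightarrow> i \<in> I k \<Longrightarrow> p k i \<in> Zd (d + 1) \<and> ht d (p k i) = 1"
  shows "delta d P = (\<Sum>k\<in>K. height_series (ht d) (half_open_box (I k) (p k) (N k) \<inter> Zd (d + 1)))"
proof -
  have fin: "finite {z \<in> poscone X \<inter> Zd (d + 1). ht d z = real n}" for n
    by (rule finite_poscone_slice[OF X(1,2)])
  have "height_series (ht d) (poscone X \<inter> Zd (d + 1)) =
      (\<Sum>k\<in>K. height_series (ht d) (half_open_cone (I k) (p k) (N k) \<inter> Zd (d + 1)))"
  proof (rule height_series_partition[OF K(1) _ _ fin])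
    show "half_open_cone (I k) (p k) (N k) \<inter> Zd (d + 1) \<subseteq> poscone X \<inter> Zd (d + 1)" if "k \<in> K" for k
      using K(2)[OF that] by blast
    show "\<exists>!k. k \<in> K \<and> z \<in> half_open_cone (I k) (p k) (N k) \<inter> Zd (d + 1)" if "z \<in> poscone X \<inter> Zd (d + 1)" for z
      using K(3)[of z] that by auto
  qed
  then have "delta d P = (\<Sum>k\<in>K. (1 - fps_X) ^ (d + 1) * height_series (ht d) (half_open_cone (I k) (p k) (N k) \<inter> Zd (d + 1)))"
    by (simp only: delta_eq_cone_series[OF X] sum_distrib_left)
  also have "\<dots> = (\<Sum>k\<in>K. height_series (ht d) (half_open_box (I k) (p k) (N k) \<inter> Zd (d + 1)))"
  proof (rule sum.cong[OF refl])
    fix k assume k: "k \<in> K"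
    have "(1 - fps_X) ^ card (I k) * height_series (ht d) (half_open_cone (I k) (p k) (N k) \<inter> Zd (d + 1)) =
         height_series (ht d) (half_open_box (I k) (p k) (N k) \<inter> Zd (d + 1))"
    proof (rule half_open_cone_series[OF p(1)[OF k] linear_lookup])
      show "ht d (p k i) = 1" if "i \<in> I k" for i using p(3)[OF k that] by simp
      show "z + p k i \<in> Zd (d + 1) \<longleftrightarrow> z \<in> Zd (d + 1)" if "i \<in> I k" for i z
        using Zd_add[of z "d+1" "p k i"] Zd_diff[of "z + p k i" "d+1" "p k i"] p(3)[OF k that] by auto
      show "finite {z \<in> half_open_cone (I k) (p k) (N k) \<inter> Zd (d + 1). ht d z = real n}" for n
        by (rule finite_subset[OF _ fin[of n]]) (use K(2)[OF k] in auto)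
    qed
    then show "(1 - fps_X) ^ (d + 1) * height_series (ht d) (half_open_cone (I k) (p k) (N k) \<inter> Zd (d + 1)) =
      height_series (ht d) (half_open_box (I k) (p k) (N k) \<inter> Zd (d + 1))" by (simp only: p(2)[OF k])
  qed
  finally show ?thesis .
qed

section \<open>Indices of simplices and the volume\<close>

definition int_span :: "'i set \<Rightarrow> ('i \<Rightarrow> 'a::real_vector) \<Rightarrow> 'a set" where
  "int_span I p = {\<Sum>i\<in>I. r i *\<^sub>R p i | r. \<forall>i\<in>I. r i \<in> \<int>}"

lemma int_spanI: "(\<And>i. i \<in> I \<Longrightarrow> r i \<in> \<int>) \<Longrightarrow> (\<Sum>i\<in>I. r i *\<^sub>R p i) \<in> int_span I p"
  unfolding int_span_def by blast

lemma int_span_diff: "a \<in> int_span I p \<Longrightarrow> b \<in> int_span I p \<Longrightarrow> a - b \<in> int_span I p"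
proof -
  assume "a \<in> int_span I p" "b \<in> int_span I p"
  then obtain r s where "a = (\<Sum>i\<in>I. r i *\<^sub>R p i)" "\<forall>i\<in>I. r i \<in> \<int>" "b = (\<Sum>i\<in>I. s i *\<^sub>R p i)" "\<forall>i\<in>I. s i \<in> \<int>"
    by (auto simp: int_span_def)
  then show ?thesis
    using int_spanI[of I "\<lambda>i. r i - s i" p] by (auto simp: scaleR_left_diff_distrib sum_subtractf)
qed

lemma int_span_0: "0 \<in> int_span I p"
  using int_spanI[of I "\<lambda>_. 0" p] by simp

lemma int_span_add: "a \<in> int_span I p \<Longrightarrow> b \<in> int_span I p \<Longrightarrow> a + b \<in> int_span I p"
  using int_span_diff[of a I p "0 - b"] int_span_diff[OF int_span_0, of b I p] by simp

lemma int_span_Zd: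
  assumes "\<And>i. i \<in> I \<Longrightarrow> p i \<in> Zd m"
  shows "int_span I p \<subseteq> Zd m"
  using assms by (auto simp: int_span_def intro!: Zd_sum Zd_scale)

lemma box_representative:
  fixes p :: "'i \<Rightarrow> vect"
  assumes "\<And>i. i \<in> I \<Longrightarrow> p i \<in> Zd m" "z \<in> Zd m" "z = (\<Sum>i\<in>I. r i *\<^sub>R p i)"
  shows "\<exists>u \<in> half_open_box I p N \<inter> Zd m. z - u \<in> int_span I p"
proof -
  \<comment> \<open>Coefficients are rounded so that the remainder falls into \<open>[0,1)\<close>,
    or into \<open>(0,1]\<close> at indices of \<open>N\<close>.\<close>
  define k where "k i = (if i \<in> N then \<lceil>r i\<rceil> - 1 else \<lfloor>r i\<rfloor>)" for i
  define u where "u = (\<Sum>i\<in>I. (r i - of_int (k i)) *\<^sub>R p i)"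
  have zu: "z - u = (\<Sum>i\<in>I. of_int (k i) *\<^sub>R p i)"
    unfolding assms(3) u_def by (simp add: scaleR_left_diff_distrib sum_subtractf)
  have k: "z - u \<in> int_span I p" unfolding zu by (rule int_spanI) simp
  have "u \<in> half_open_box I p N"
    unfolding half_open_box_def u_def
  proof (intro CollectI exI[of _ "\<lambda>i. r i - of_int (k i)"] conjI refl ballI)
    fix i
    show "if i \<in> N then 0 < r i - of_int (k i) \<and> r i - of_int (k i) \<le> 1 else 0 \<le> r i - of_int (k i) \<and> r i - of_int (k i) < 1"
      unfolding k_def by (auto; linarith)
  qed
  moreover have "z - (z - u) \<in> Zd m" using assms(2) k int_span_Zd[of I p m] assms(1) by (blast intro: Zd_diff)
  ultimately show ?thesis using k by auto
qed

text \<open>The box contains a representative of every coset of the lattice generated by the \<open>p i\<close>.\<close>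

lemma card_box_ge_2:
  fixes p :: "'i \<Rightarrow> vect"
  assumes fin: "finite (half_open_box I p N \<inter> Zd m)" and p: "\<And>i. i \<in> I \<Longrightarrow> p i \<in> Zd m"
    and sp: "\<And>z. z \<in> Zd m \<Longrightarrow> \<exists>r. z = (\<Sum>i\<in>I. r i *\<^sub>R p i)"
    and z: "z \<in> Zd m" "z \<notin> int_span I p"
  shows "2 \<le> card (half_open_box I p N \<inter> Zd m)"
    and "card (half_open_box I p N \<inter> Zd m) \<le> 2 \<Longrightarrow> z' \<in> Zd m \<Longrightarrow> z' \<notin> int_span I p \<Longrightarrow> z - z' \<in> int_span I p"
proof -
  let ?S = "half_open_box I p N \<inter> Zd m"
  have rep: "\<exists>u\<in>?S. y - u \<in> int_span I p" if "y \<in> Zd m" for y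
  proof -
    obtain r where r: "y = (\<Sum>i\<in>I. r i *\<^sub>R p i)" using sp[OF \<open>y \<in> Zd m\<close>] by blast
    show ?thesis by (rule box_representative[OF p \<open>y \<in> Zd m\<close> r])
  qed
  \<comment> \<open>\<open>u0\<close> represents the trivial coset, so the representative
    \<open>u\<close> of a vector outside it is a second point. If the box has only two points, all
    outside vectors share \<open>u\<close>.\<close>
  obtain u0 where u0: "u0 \<in> ?S" "0 - u0 \<in> int_span I p" using rep[OF Zd_0] by blast
  obtain u where u: "u \<in> ?S" "z - u \<in> int_span I p" using rep[OF z(1)] by blast
  have *: "y \<in> int_span I p" if "y - u0 \<in> int_span I p" for y
    using int_span_diff[OF that u0(2)] by simp
  have "u \<noteq> u0" using * u z(2) by auto
  then have c2: "card {u0, u} = 2" by simp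
  show "2 \<le> card ?S" using card_mono[OF fin, of "{u0, u}"] u u0 c2 by simp
  assume le: "card ?S \<le> 2" and z': "z' \<in> Zd m" "z' \<notin> int_span I p"
  obtain u' where u': "u' \<in> ?S" "z' - u' \<in> int_span I p" using rep[OF z'(1)] by blast
  have "?S = {u0, u}" using card_seteq[OF fin, of "{u0, u}"] u u0 c2 le by auto
  then have "u' = u" using * u' z' by auto
  then show "z - z' \<in> int_span I p" using int_span_diff[OF u(2), of "z' - u"] u'(2) by simp
qed

section \<open>Linear algebra in the spaces \<open>Rd m\<close>\<close>

lemma independent_evec: "independent (evec ` {1..m})" "inj_on evec A" "span (evec ` {1..m}) = Rd m"
proof -
  show inj: "inj_on evec A" for A
    by (rule inj_onI) (metis lookup_evec zero_neq_one)
  have co: "Poly_Mapping.lookup (\<Sum>j\<in>{1..m}. f j *\<^sub>R evec j) i = (if i \<in> {1..m} then f i else 0)" for f i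
    by (simp add: if_distrib cong: if_cong)
  show "independent (evec ` {1..m})"
  proof -
    have "\<forall>v\<in>evec ` {1..m}. u v = 0" if "(\<Sum>v\<in>evec ` {1..m}. u v *\<^sub>R v) = 0" for u
    proof
      fix v assume "v \<in> evec ` {1..m}"
      then obtain i where i: "i \<in> {1..m}" "v = evec i" by auto
      have "(\<Sum>j\<in>{1..m}. u (evec j) *\<^sub>R evec j) = 0" using that by (simp add: sum.reindex[OF inj])
      then show "u v = 0" using co[of "\<lambda>j. u (evec j)" i] i by simp
    qed
    then show ?thesis using real_vector.dependent_finite[of "evec ` {1..m}"] by auto
  qed
  show "span (evec ` {1..m}) = Rd m"
  proof
    show "span (evec ` {1..m}) \<subseteq> Rd m" by (rule span_minimal) (auto simp: Rd_iff subspace_Rd)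
    show "Rd m \<subseteq> span (evec ` {1..m})"
    proof
      fix x assume "x \<in> Rd m"
      then have "x = (\<Sum>j\<in>{1..m}. Poly_Mapping.lookup x j *\<^sub>R evec j)"
        by (intro poly_mapping_eqI) (simp add: co[of "Poly_Mapping.lookup x"] Rd_iff del: lookup_sum_vect One_nat_def)
      then show "x \<in> span (evec ` {1..m})"
        by (metis (no_types, lifting) image_eqI span_base span_scale span_sum)
    qed
  qed
qed

lemma independent_Rd_bound:
  assumes "independent S" "S \<subseteq> Rd m"
  shows "finite S" "card S \<le> m"
proof -
  have "finite S \<and> card S \<le> card (evec ` {1..m})"
    by (rule real_vector.independent_span_bound) (simp_all add: independent_evec(3) assms del: One_nat_def)
  then show "finite S" "card S \<le> m" by (simp_all add: card_image independent_evec(2))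
qed

lemma independent_Rd_span:
  assumes "independent S" "S \<subseteq> Rd m"
  shows "card S = m \<longleftrightarrow> span S = Rd m"
proof
  assume c: "card S = m"
  have "y \<in> span S" if "y \<in> Rd m" for y
  proof (rule ccontr)
    assume n: "y \<notin> span S"
    then have "independent (insert y S)" using assms(1) by (simp add: independent_insertI)
    moreover have "y \<notin> S" using n span_base by blast
    ultimately show False
      using independent_Rd_bound[of "insert y S" m] independent_Rd_bound[OF assms] that assms(2) c by auto
  qed
  then show "span S = Rd m" using span_minimal[OF assms(2) subspace_Rd] by blast
next
  assume "span S = Rd m"
  then have "evec ` {1..m} \<subseteq> span S" using span_superset[of "evec ` {1..m}"] by (simp only: independent_evec(3))
  then have "card (evec ` {1..m}) \<le> card S"
    using real_vector.independent_span_bound[OF independent_Rd_bound(1)[OF assms] independent_evec(1)] by simp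
  then show "card S = m" using independent_Rd_bound(2)[OF assms] by (simp add: card_image independent_evec(2))
qed

lemma independent_imp_indep_family:
  assumes "independent B" "finite B"
  shows "indep_family B (\<lambda>b. b)"
proof -
  have "\<not> (\<exists>u. (\<exists>v\<in>B. u v \<noteq> 0) \<and> (\<Sum>v\<in>B. u v *\<^sub>R v) = 0)"
    using real_vector.dependent_finite[OF assms(2)] assms(1) by simp
  then show ?thesis unfolding indep_family_def using assms(2) by blast
qed

text \<open>\<open>Vol\<close> adds only the coefficients up to \<open>d\<close>, so the heights
  have to be confined to that range.\<close>

lemma Vol_sum_card:
  assumes "delta d P = (\<Sum>k\<in>K. height_series (ht d) (S k))"
    and "\<And>k. k \<in> K \<Longrightarrow> finite (S k)"
    and "\<And>k z. k \<in> K \<Longrightarrow> z \<in> S k \<Longrightarrow> ht d z \<in> real ` {..d}"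
  shows "Vol d P = (\<Sum>k\<in>K. int (card (S k)))"
proof -
  have "(\<Sum>i\<le>d. int (card {z\<in>S k. ht d z = real i})) = int (card (S k))" if k: "k \<in> K" for k
  proof -
    have "S k = (\<Union>i\<in>{..d}. {z\<in>S k. ht d z = real i})" using assms(3)[OF k] by force
    moreover have "card (\<Union>i\<in>{..d}. {z\<in>S k. ht d z = real i}) = (\<Sum>i\<le>d. card {z\<in>S k. ht d z = real i})"
      using assms(2)[OF k] by (intro card_UN_disjoint) auto
    ultimately show ?thesis by simp
  qed
  moreover have "Vol d P = (\<Sum>k\<in>K. \<Sum>i\<le>d. int (card {z\<in>S k. ht d z = real i}))"
    unfolding Vol_def assms(1) by (subst sum.swap) (simp add: fps_sum_nth height_series_def)
  ultimately show ?thesis by simp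
qed

text \<open>With all indices in \<open>N\<close>, the sum of the generators would be a box point of
  height \<open>d + 1\<close>, which \<open>Vol\<close> does not see. One index outside
  \<open>N\<close> keeps the sum of the coefficients below \<open>d + 1\<close>.\<close>

lemma box_heights:
  assumes "finite I" "card I = d + 1" "\<And>i. i \<in> I \<Longrightarrow> ht d (p i) = 1" "z \<in> half_open_box I p N" "z \<in> Zd (d + 1)"
    and "\<exists>i\<in>I. i \<notin> N"
  shows "ht d z \<in> real ` {..d}"
proof -
  obtain r where r: "z = (\<Sum>i\<in>I. r i *\<^sub>R p i)" "\<forall>i\<in>I. if i \<in> N then 0 < r i \<and> r i \<le> 1 else 0 \<le> r i \<and> r i < 1"
    using assms(4) by (auto simp: half_open_box_def)
  have z: "ht d z = (\<Sum>i\<in>I. r i)" using assms(3) by (simp add: r(1))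
  have b: "0 \<le> r i \<and> r i \<le> 1" if "i \<in> I" for i using r(2) that by (force split: if_splits)
  have "(\<Sum>i\<in>I. r i) < (\<Sum>i\<in>I. 1)"
  proof (rule sum_strict_mono_ex1[OF assms(1)])
    show "\<forall>i\<in>I. r i \<le> 1" using b by blast
    show "\<exists>i\<in>I. r i < 1" using assms(6) r(2) by force
  qed
  then have "(\<Sum>i\<in>I. r i) < real d + 1" using assms(2) by simp
  moreover have "0 \<le> (\<Sum>i\<in>I. r i)" using b by (simp add: sum_nonneg)
  moreover have "ht d z \<in> \<int>" using assms(5) by (simp add: Zd_iff)
  then obtain k where k: "ht d z = of_int k" by (elim Ints_cases)
  ultimately have "nat k \<in> {..d}" "ht d z = real (nat k)" using z by auto
  then show ?thesis by blast
qed

lemma half_open_box_subset_cone: "half_open_box I p N \<subseteq> half_open_cone I p N"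
  unfolding partial_box_all[symmetric] by (rule partial_box_subset)

lemma half_open_cone_subset_poscone:
  assumes "p ` I \<subseteq> X" "finite X" "inj_on p I" "finite I"
  shows "half_open_cone I p N \<subseteq> poscone X"
proof
  fix z assume "z \<in> half_open_cone I p N"
  then obtain r where r: "z = (\<Sum>i\<in>I. r i *\<^sub>R p i)" "\<forall>i\<in>I. 0 \<le> r i" by (auto simp: half_open_cone_def)
  define \<mu> where "\<mu> x = (if x \<in> p ` I then r (the_inv_into I p x) else 0)" for x
  have "z = (\<Sum>x\<in>p ` I. \<mu> x *\<^sub>R x)"
    unfolding r(1) by (simp add: sum.reindex[OF assms(3)] \<mu>_def the_inv_into_f_f[OF assms(3)])
  also have "\<dots> = (\<Sum>x\<in>X. \<mu> x *\<^sub>R x)"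
    using assms by (intro sum.mono_neutral_left) (auto simp: \<mu>_def)
  finally show "z \<in> poscone X" unfolding poscone_def using r(2)
    by (intro CollectI exI[of _ \<mu>]) (auto simp: \<mu>_def the_inv_into_f_f[OF assms(3)])
qed

lemma finite_half_open_box:
  assumes "finite X" "\<And>x. x \<in> X \<Longrightarrow> ht d x = 1" "card I = d + 1" "half_open_box I p N \<subseteq> poscone X"
    and "\<And>i. i \<in> I \<Longrightarrow> ht d (p i) = 1" "\<exists>i\<in>I. i \<notin> N"
  shows "finite (half_open_box I p N \<inter> Zd (d + 1))"
proof (rule finite_subset)
  show "finite (\<Union>t\<in>{..d}. {z \<in> poscone X \<inter> Zd (d + 1). ht d z = real t})"
    using finite_poscone_slice[OF assms(1,2)] by simp
  have "finite I" using assms(3) by (metis card.infinite add_is_0 one_neq_zero)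
  then show "half_open_box I p N \<inter> Zd (d + 1) \<subseteq> (\<Union>t\<in>{..d}. {z \<in> poscone X \<inter> Zd (d + 1). ht d z = real t})"
    using box_heights[OF _ assms(3,5) _ _ assms(6)] assms(4) by fastforce
qed

text \<open>The covering by closed cells is exported as well, because it later locates every point
  of \<open>X\<close> in a cell.\<close>

lemma Vol_triangulation:
  assumes X: "finite X" "X \<subseteq> Zd (d + 1)" "\<And>x. x \<in> X \<Longrightarrow> ht d x = 1" "span X = Rd (d + 1)"
    and P: "lift1 d P = convex hull X" "P \<subseteq> Rd d"
    and c: "\<And>B x. B \<in> bases X \<Longrightarrow> x \<in> X - B \<Longrightarrow> interpolate B c x \<noteq> c x"
  obtains N where "Vol d P = (\<Sum>B\<in>triangulation X c. int (card (half_open_box B (\<lambda>b. b) (N B) \<inter> Zd (d + 1))))"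
    "\<And>B. B \<in> triangulation X c \<Longrightarrow> finite (half_open_box B (\<lambda>b. b) (N B) \<inter> Zd (d + 1))"
    "poscone X \<subseteq> (\<Union>B\<in>triangulation X c. half_open_cone B (\<lambda>b. b) {})"
proof -
  obtain q where q: "q \<in> poscone X" "\<And>B b. B \<in> bases X \<Longrightarrow> b \<in> B \<Longrightarrow> representation B q b \<noteq> 0"
    using generic_cone_point[OF X(1)] by blast
  define N where "N B = {b. representation B q b < 0}" for B
  have tb: "B \<in> bases X" if "B \<in> triangulation X c" for B using that by (simp add: triangulation_def)
  have part: "\<exists>!B. B \<in> triangulation X c \<and> y \<in> half_open_cone B (\<lambda>b. b) (N B)" if "y \<in> poscone X" for y
    unfolding N_def by (rule half_open_partition[OF X(1) linear_lookup _ c q that]) (use X(3) in auto)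
  have card: "card B = d + 1" if "B \<in> triangulation X c" for B
    using independent_Rd_span[of B "d + 1"] basesD[OF tb[OF that] X(1)] bases_span[OF tb[OF that]] X(2,4)
    by (auto simp: Zd_def)
  \<comment> \<open>The coefficients of \<open>q\<close> over a cell sum to its height, which is
    nonnegative on the cone, so they cannot all be negative.\<close>
  have notall: "\<exists>b\<in>B. b \<notin> N B" if B: "B \<in> triangulation X c" for B
  proof (rule ccontr)
    assume "\<not> ?thesis"
    then have neg: "representation B q b < 0" if "b \<in> B" for b using that by (auto simp: N_def)
    note BD = basesD[OF tb[OF B] X(1)]
    have "q \<in> span B" using q(1) poscone_span bases_span[OF tb[OF B]] by blast
    then have "q = (\<Sum>b\<in>B. representation B q b *\<^sub>R b)" using lincomb_representation[OF BD(2,4)] by simp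
    then have "ht d q = ht d (\<Sum>b\<in>B. representation B q b *\<^sub>R b)" by simp
    also have "\<dots> = (\<Sum>b\<in>B. representation B q b)" using BD(1) X(3) by (intro poscone_height) auto
    also have "\<dots> < 0" using sum_strict_mono[of B "representation B q" "\<lambda>_. 0"] neg BD(4) card[OF B] by force
    finally have "ht d q < 0" .
    moreover obtain \<mu> where "q = (\<Sum>x\<in>X. \<mu> x *\<^sub>R x)" "\<forall>x\<in>X. 0 \<le> \<mu> x" using q(1) by (auto simp: poscone_def)
    then have "0 \<le> ht d q" using poscone_height[OF X(3), of X \<mu>] by (simp add: sum_nonneg)
    ultimately show False by simp
  qed
  have sub: "half_open_cone B (\<lambda>b. b) M \<subseteq> poscone X" if "B \<in> triangulation X c" for B M
    by (rule half_open_cone_subset_poscone) (use basesD[OF tb[OF that] X(1)] X(1) in auto)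
  have finbox: "finite (half_open_box B (\<lambda>b. b) (N B) \<inter> Zd (d + 1))" if B: "B \<in> triangulation X c" for B
    by (rule finite_half_open_box[OF X(1,3) card[OF B] order_trans[OF half_open_box_subset_cone sub[OF B]] _ notall[OF B]])
       (use basesD[OF tb[OF B] X(1)] X(3) in auto)
  have delta: "delta d P = (\<Sum>B\<in>triangulation X c. height_series (ht d) (half_open_box B (\<lambda>b. b) (N B) \<inter> Zd (d + 1)))"
  proof (rule delta_cells[OF X(1,3) P])
    show "finite (triangulation X c)" using X(1) by (auto simp: triangulation_def bases_def)
    show "indep_family B (\<lambda>b. b)" if "B \<in> triangulation X c" for B
      using independent_imp_indep_family basesD[OF tb[OF that] X(1)] by blast
    show "b \<in> Zd (d + 1) \<and> ht d b = 1" if "B \<in> triangulation X c" "b \<in> B" for B b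
      using basesD[OF tb[OF that(1)] X(1)] X(2,3) that(2) by blast
  qed (use part sub card in auto)
  have "Vol d P = (\<Sum>B\<in>triangulation X c. int (card (half_open_box B (\<lambda>b. b) (N B) \<inter> Zd (d + 1))))"
  proof (rule Vol_sum_card[OF delta finbox])
    fix B z assume B: "B \<in> triangulation X c" and z: "z \<in> half_open_box B (\<lambda>b. b) (N B) \<inter> Zd (d + 1)"
    show "ht d z \<in> real ` {..d}"
      by (rule box_heights[OF _ card[OF B] _ _ _ notall[OF B]]) (use basesD[OF tb[OF B] X(1)] X(3) z in auto)
  qed
  moreover have "poscone X \<subseteq> (\<Union>B\<in>triangulation X c. half_open_cone B (\<lambda>b. b) {})"
  proof
    fix y assume "y \<in> poscone X"
    then obtain B where "B \<in> triangulation X c" "y \<in> half_open_cone B (\<lambda>b. b) (N B)" using part by blast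
    moreover have "half_open_cone B (\<lambda>b. b) (N B) \<subseteq> half_open_cone B (\<lambda>b. b) {}"
      unfolding half_open_cone_def by blast
    ultimately show "y \<in> (\<Union>B\<in>triangulation X c. half_open_cone B (\<lambda>b. b) {})" by blast
  qed
  ultimately show ?thesis using that finbox by blast
qed

section \<open>Nonspanning polytopes of small volume\<close>

text \<open>The reciprocal coefficient is what matters later: if both coefficients are integers,
  they are 1 or -1, and a negative coefficient stays negative under the exchange.\<close>

lemma exchange_basis:
  assumes "B \<in> bases X" "finite X" "x \<in> X" "x \<notin> B" "b \<in> B" "representation B x b \<noteq> 0"
  shows "insert x (B - {b}) \<in> bases X"
    and "representation (insert x (B - {b})) b x = 1 / representation B x b"
proof -
  note BD = basesD[OF assms(1,2)]
  have indm: "independent (B - {b})" using BD(2) real_vector.independent_mono by blast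
  have xs: "x \<in> span B" using BD(3) assms(3) by blast
  have xn: "x \<notin> span (B - {b})"
  proof
    assume "x \<in> span (B - {b})"
    then have "representation B x = representation (B - {b}) x"
      by (intro real_vector.representation_extend BD(2)) auto
    then show False using assms(6) real_vector.representation_ne_zero[of "B - {b}" x b] by auto
  qed
  let ?B' = "insert x (B - {b})"
  have ind: "independent ?B'" by (rule independent_insertI[OF xn indm])
  have bs: "b \<in> span ?B'" by (rule real_vector.in_span_delete[OF xs xn])
  have "B \<subseteq> span ?B'"
  proof
    fix y assume "y \<in> B"
    then show "y \<in> span ?B'" using bs by (cases "y = b") (auto intro: span_base)
  qed
  then have "span B \<subseteq> span ?B'" by (rule span_minimal) simp
  then show mem: "?B' \<in> bases X" using BD(1,3) assms(3) ind by (auto simp: bases_def)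
  define \<beta> where "\<beta> = representation B x b"
  define f where "f y = (if y = x then 1 / \<beta> else - representation B x y / \<beta>)" for y
  have \<beta>: "\<beta> \<noteq> 0" using assms(6) by (simp add: \<beta>_def)
  have xe: "x = \<beta> *\<^sub>R b + (\<Sum>y\<in>B - {b}. representation B x y *\<^sub>R y)"
    using lincomb_representation[OF BD(2,4) xs] sum.remove[OF BD(4) assms(5), of "\<lambda>y. representation B x y *\<^sub>R y"]
    by (simp add: \<beta>_def)
  have "(\<Sum>y\<in>?B'. f y *\<^sub>R y) = (1 / \<beta>) *\<^sub>R x + (\<Sum>y\<in>B - {b}. f y *\<^sub>R y)"
    using BD(4) assms(4) by (simp add: f_def)
  also have "(\<Sum>y\<in>B - {b}. f y *\<^sub>R y) = (\<Sum>y\<in>B - {b}. (- 1 / \<beta>) *\<^sub>R (representation B x y *\<^sub>R y))"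
    using assms(4) by (intro sum.cong) (auto simp: f_def)
  also have "\<dots> = (- 1 / \<beta>) *\<^sub>R (x - \<beta> *\<^sub>R b)"
    unfolding scaleR_sum_right[symmetric] using xe by (metis add_diff_cancel_left')
  also have "(1 / \<beta>) *\<^sub>R x + (- 1 / \<beta>) *\<^sub>R (x - \<beta> *\<^sub>R b) = b"
    using \<beta> by (simp add: scaleR_diff_right)
  finally have "b = (\<Sum>y\<in>?B'. f y *\<^sub>R y)" by simp
  then have "representation ?B' b x = f x"
    using representation_lincomb[OF ind, of x f] BD(4) by simp
  then show "representation ?B' b x = 1 / representation B x b" by (simp add: f_def \<beta>_def)
qed

section \<open>From a polytope to its lifted lattice points\<close>

lemma lift1_eq: "lift1 d P = (+) (evec (d + 1)) ` P"
  unfolding lift1_def by (intro image_cong) (auto simp: add.commute)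

text \<open>A finite generating set of minimal cardinality contains no redundant point, and a point
  outside the hull of the others is extreme.\<close>

lemma polytope_vertices_hull:
  assumes "polytope P"
  shows "finite (vertices P)" "P = convex hull (vertices P)"
proof -
  let ?Q = "\<lambda>V. finite V \<and> P = convex hull V"
  obtain V0 where "?Q V0" using assms by (auto simp: polytope_def)
  then obtain V where V: "?Q V" and min: "\<And>W. ?Q W \<Longrightarrow> card V \<le> card W"
    using ex_has_least_nat[of ?Q V0 card] by blast
  have "v extreme_point_of P" if v: "v \<in> V" for v
  proof -
    have ins: "insert v (V - {v}) = V" using v by auto
    have "v \<notin> convex hull (V - {v})"
    proof
      assume "v \<in> convex hull (V - {v})"
      then have "convex hull (V - {v}) = convex hull V" using hull_redundant[of v convex "V - {v}"] ins by simp
      then have "card V \<le> card (V - {v})" using V by (intro min) auto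
      then show False using V v card_Diff1_less[of V v] by linarith
    qed
    then have "v extreme_point_of (convex hull (insert v (V - {v})))"
      using V by (intro extreme_point_of_convex_hull_insert) auto
    then show ?thesis using V ins by simp
  qed
  moreover have "vertices P \<subseteq> V" using V extreme_point_of_convex_hull by (auto simp: vertices_def)
  ultimately have "vertices P = V" by (auto simp: vertices_def)
  then show "finite (vertices P)" "P = convex hull (vertices P)" using V by auto
qed

lemma lift1_lattice_points:
  assumes "full_lattice_polytope d P"
  defines "X \<equiv> lift1 d P \<inter> Zd (d + 1)"
  shows "finite X" "\<And>x. x \<in> X \<Longrightarrow> ht d x = 1" "lift1 d P = convex hull X"
    "span X = Rd (d + 1)" "P \<subseteq> Rd d"
proof -
  have P: "polytope P" "P \<subseteq> Rd d" "vertices P \<subseteq> Zd d" "has_dim P d"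
    using assms(1) by (auto simp: full_lattice_polytope_def lattice_polytope_def)
  show "P \<subseteq> Rd d" by fact
  define V where "V = (+) (evec (d + 1)) ` vertices P"
  note PV = polytope_vertices_hull[OF P(1)]
  have finV: "finite V" using PV by (simp add: V_def)
  have hull: "lift1 d P = convex hull V"
    unfolding lift1_eq V_def convex_hull_translation using PV(2) by simp
  have ev: "evec (d + 1) \<in> Zd (d + 1)" by (auto simp: Zd_iff)
  have "Zd d \<subseteq> Zd (d + 1)" by (auto simp: Zd_iff)
  then have VZ: "V \<subseteq> Zd (d + 1)" using P(3) Zd_add[OF ev] by (auto simp: V_def)
  have htP: "ht d x = 1" if "x \<in> lift1 d P" for x
    using that P(2) by (auto simp: lift1_def lookup_add Rd_iff)
  then show "\<And>x. x \<in> X \<Longrightarrow> ht d x = 1" by (auto simp: X_def)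
  have VX: "V \<subseteq> X" using VZ hull hull_subset[of V convex] by (auto simp: X_def)
  have htV: "ht d x = 1" if "x \<in> V" for x using that VX htP by (auto simp: X_def)
  have "X \<subseteq> {z \<in> poscone V \<inter> Zd (d + 1). ht d z = 1}"
    using poscone_slice_iff[OF finV htV, of 1] hull by (auto simp: X_def)
  then show "finite X" using finite_poscone_slice[OF finV htV] finite_subset by blast
  have "convex hull X \<subseteq> lift1 d P" unfolding hull by (rule hull_minimal) (auto simp: X_def hull)
  moreover have "lift1 d P \<subseteq> convex hull X" unfolding hull by (rule hull_mono[OF VX])
  ultimately show hullX: "lift1 d P = convex hull X" by blast
  obtain C where C: "finite C" "\<not> affine_dependent C" "card C = d + 1" "affine hull C = affine hull P"
    using P(4) by (auto simp: has_dim_def)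
  have "affine (Rd d)" by (rule subspace_imp_affine[OF subspace_Rd])
  then have "affine hull P \<subseteq> Rd d" using P(2) by (simp add: hull_minimal)
  then have CR: "C \<subseteq> Rd d" using C(4) hull_subset[of C affine] by blast
  have CR0: "Poly_Mapping.lookup x i = 0" if "x \<in> C" "i \<notin> {1..d}" for x i
    using CR that by (auto simp: Rd_iff subset_iff)
  define C' where "C' = (+) (evec (d + 1)) ` C"
  have C'Rd: "C' \<subseteq> Rd (d + 1)" using CR0 by (auto simp: C'_def Rd_iff lookup_add)
  have C'ht: "ht d x = 1" if "x \<in> C'" for x using that CR0 by (auto simp: C'_def lookup_add)
  have finC': "finite C'" using C(1) by (simp add: C'_def)
  have cardC': "card C' = d + 1" unfolding C'_def using C(3) by (subst card_image) auto
  have naff: "\<not> affine_dependent C'" unfolding C'_def using C(2) affine_dependent_translation_eq by blast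
  \<comment> \<open>At height 1 the coefficients of a linear relation sum to 0, so it is an affine
    relation.\<close>
  have "independent C'"
  proof
    assume "dependent C'"
    then obtain u v where u: "v \<in> C'" "u v \<noteq> 0" "(\<Sum>v\<in>C'. u v *\<^sub>R v) = 0"
      using real_vector.dependent_finite[OF finC'] by blast
    have "ht d (\<Sum>v\<in>C'. u v *\<^sub>R v) = (\<Sum>v\<in>C'. u v)" by (rule poscone_height[OF C'ht])
    then have "sum u C' = 0" using u(3) by simp
    then have "affine_dependent C'" unfolding affine_dependent_explicit_finite[OF finC'] using u by blast
    then show False using naff by simp
  qed
  then have spC': "span C' = Rd (d + 1)" using independent_Rd_span[OF _ C'Rd] cardC' by simp
  have "C' \<subseteq> affine hull (lift1 d P)"
    unfolding lift1_eq affine_hull_translation C'_def using C(4) hull_subset[of C affine] by auto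
  also have "\<dots> \<subseteq> span X" unfolding hullX affine_hull_convex_hull by (rule affine_hull_subset_span)
  finally have "span C' \<subseteq> span X" by (rule span_minimal) simp
  moreover have "X \<subseteq> Rd (d + 1)" by (auto simp: X_def Zd_def)
  then have "span X \<subseteq> Rd (d + 1)" by (rule span_minimal[OF _ subspace_Rd])
  ultimately show "span X = Rd (d + 1)" using spC' by blast
qed

lemma is_simplex_lift:
  assumes "lift1 d P = convex hull B" "independent B" "finite B"
  shows "is_simplex P"
proof -
  define C where "C = (+) (- evec (d + 1)) ` B"
  have "\<not> affine_dependent B" using affine_dependent_imp_dependent assms(2) by blast
  then have "\<not> affine_dependent C" unfolding C_def using affine_dependent_translation_eq by blast
  moreover have "P = (+) (- evec (d + 1)) ` lift1 d P" by (auto simp: lift1_eq image_image)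
  then have "P = convex hull C" unfolding assms(1) C_def convex_hull_translation .
  ultimately show ?thesis using assms(3) unfolding is_simplex_def C_def by blast
qed

lemma int_comb_eq: "int_comb X = int_span X (\<lambda>x. x)"
proof
  show "int_comb X \<subseteq> int_span X (\<lambda>x. x)" unfolding int_comb_def by (auto intro!: int_spanI)
  show "int_span X (\<lambda>x. x) \<subseteq> int_comb X"
  proof
    fix y assume "y \<in> int_span X (\<lambda>x. x)"
    then obtain r where r: "y = (\<Sum>x\<in>X. r x *\<^sub>R x)" "\<forall>x\<in>X. r x \<in> \<int>" by (auto simp: int_span_def)
    have "y = (\<Sum>x\<in>X. of_int \<lfloor>r x\<rfloor> *\<^sub>R x)"
      unfolding r(1) using r(2) by (intro sum.cong) (auto elim: Ints_cases)
    then show "y \<in> int_comb X" unfolding int_comb_def by (intro CollectI exI[of _ "\<lambda>x. \<lfloor>r x\<rfloor>"]) simp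
  qed
qed

lemma int_span_mono:
  assumes "B \<subseteq> X" "finite X"
  shows "int_span B (\<lambda>x. x) \<subseteq> int_span X (\<lambda>x. x)"
proof
  fix y :: 'a assume "y \<in> int_span B (\<lambda>x. x)"
  then obtain r where r: "y = (\<Sum>x\<in>B. r x *\<^sub>R x)" "\<forall>x\<in>B. r x \<in> \<int>" by (auto simp: int_span_def)
  have "y = (\<Sum>x\<in>X. (if x \<in> B then r x else 0) *\<^sub>R x)"
    unfolding r(1) using assms by (intro sum.mono_neutral_cong_left) auto
  also have "\<dots> \<in> int_span X (\<lambda>x. x)" using r(2) by (intro int_spanI) auto
  finally show "y \<in> int_span X (\<lambda>x. x)" .
qed

lemma int_span_base:
  assumes "x \<in> X" "finite X"
  shows "x \<in> int_span X (\<lambda>x. x)"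
proof -
  have "(\<Sum>y\<in>X. (if y = x then 1 else 0) *\<^sub>R y) \<in> int_span X (\<lambda>x. x)" by (rule int_spanI) auto
  also have "(\<Sum>y\<in>X. (if y = x then 1 else 0) *\<^sub>R y) = (\<Sum>y\<in>X. if y = x then x else 0)" by (intro sum.cong) auto
  also have "\<dots> = x" using assms by simp
  finally show ?thesis .
qed

lemma representation_int_span:
  assumes "independent B" "finite B" "y \<in> int_span B (\<lambda>x. x)" "b \<in> B"
  shows "representation B y b \<in> \<int>"
  using assms by (auto simp: int_span_def representation_lincomb)

lemma nonneg_int_sum_eq_1:
  fixes f :: "'a \<Rightarrow> real"
  assumes "finite B" "\<And>b. b \<in> B \<Longrightarrow> f b \<in> \<int>" "\<And>b. b \<in> B \<Longrightarrow> 0 \<le> f b" "sum f B = 1"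
  obtains b where "b \<in> B" "f b = 1" "\<And>a. a \<in> B \<Longrightarrow> a \<noteq> b \<Longrightarrow> f a = 0"
proof -
  have "\<exists>b\<in>B. f b \<noteq> 0" using assms(4) by (metis sum.neutral zero_neq_one)
  then obtain b where b: "b \<in> B" "f b \<noteq> 0" by blast
  have "1 \<le> f b" using assms(2,3)[OF b(1)] b(2) by (auto elim!: Ints_cases)
  moreover have s: "f b + sum f (B - {b}) = 1" using assms(4) sum.remove[OF assms(1) b(1), of f] by simp
  moreover have nn: "0 \<le> sum f (B - {b})" using assms(3) by (intro sum_nonneg) auto
  ultimately have "f b = 1" "sum f (B - {b}) = 0" by auto
  then have "f a = 0" if "a \<in> B" "a \<noteq> b" for a
    using sum_nonneg_eq_0_iff[of "B - {b}" f] assms(1,3) that by auto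
  then show ?thesis using that b \<open>f b = 1\<close> by blast
qed

text \<open>The last two conclusions say that the lattice of \<open>B\<close> has index 2.
  Everything comes from comparing the total weight, at most 4, with the weight of at least 2 that
  each cell carries.\<close>

lemma classification_data:
  assumes P: "full_lattice_polytope d P" "\<not> is_simplex P" "\<not> spanning d P" "Vol d P \<le> 4"
  defines "X \<equiv> lift1 d P \<inter> Zd (d + 1)"
  obtains B b0 b1 b2 where "B \<in> bases X" "b0 \<in> B" "b1 \<in> B" "b2 \<in> B" "b0 \<noteq> b1" "b0 \<noteq> b2" "b1 \<noteq> b2"
    "b1 + b2 - b0 \<notin> B" "X = insert (b1 + b2 - b0) B" "int_span B (\<lambda>b. b) \<noteq> Zd (d + 1)"
    "\<And>z z'. z \<in> Zd (d + 1) - int_span B (\<lambda>b. b) \<Longrightarrow> z' \<in> Zd (d + 1) - int_span B (\<lambda>b. b) \<Longrightarrow> z - z' \<in> int_span B (\<lambda>b. b)"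
proof -
  note X = lift1_lattice_points[OF P(1), folded X_def]
  have XZ: "X \<subseteq> Zd (d + 1)" by (simp add: X_def)
  have XintZ: "int_span X (\<lambda>b. b) \<subseteq> Zd (d + 1)" by (rule int_span_Zd) (use XZ in auto)
  have nonsp: "int_span X (\<lambda>b. b) \<noteq> Zd (d + 1)"
    using P(3) by (simp add: spanning_def int_comb_eq X_def)
  have BintX: "int_span B (\<lambda>b. b) \<subseteq> int_span X (\<lambda>b. b)" if "B \<in> bases X" for B
    by (rule int_span_mono[OF basesD(1)[OF that X(1)] X(1)])
  have ex: "\<exists>z. z \<in> Zd (d + 1) \<and> z \<notin> int_span B (\<lambda>b. b)" if "B \<in> bases X" for B
    using nonsp XintZ BintX[OF that] by blast
  have spanB: "\<exists>r. z = (\<Sum>b\<in>B. r b *\<^sub>R b)" if "B \<in> bases X" "z \<in> Zd (d + 1)" for B z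
  proof -
    have "z \<in> span B" using bases_span[OF that(1)] X(4) that(2) by (simp add: Zd_def)
    then show ?thesis using lincomb_representation basesD[OF that(1) X(1)] by metis
  qed
  obtain B where "B \<subseteq> X" "independent B" "X \<subseteq> span B"
    by (rule real_vector.maximal_independent_subset)
  then have B: "B \<in> bases X" by (simp add: bases_def)
  note BD = basesD[OF B X(1)]
  have xsum: "y = (\<Sum>b\<in>B. representation B y b *\<^sub>R b)" "(\<Sum>b\<in>B. representation B y b) = 1" if "y \<in> X" for y
  proof -
    show *: "y = (\<Sum>b\<in>B. representation B y b *\<^sub>R b)"
      using lincomb_representation[OF BD(2,4)] BD(3) that by auto
    have "ht d (\<Sum>b\<in>B. representation B y b *\<^sub>R b) = (\<Sum>b\<in>B. representation B y b)"
      by (rule poscone_height) (use BD(1) X(2) in auto)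
    then show "(\<Sum>b\<in>B. representation B y b) = 1" using * X(2)[OF that] by simp
  qed
  \<comment> \<open>Otherwise all lattice points would be convex combinations of \<open>B\<close>,
    and \<open>P\<close> would be a simplex.\<close>
  have "\<exists>x\<in>X. \<exists>b\<in>B. representation B x b < 0"
  proof (rule ccontr)
    assume n: "\<not> ?thesis"
    have "X \<subseteq> convex hull B"
    proof
      fix y assume y: "y \<in> X"
      then show "y \<in> convex hull B" unfolding convex_hull_finite[OF BD(4)]
        using xsum[OF y] n by (intro CollectI exI[of _ "representation B y"]) force
    qed
    then have "convex hull X \<subseteq> convex hull B" by (rule hull_minimal) simp
    then have "lift1 d P = convex hull B" using X(3) hull_mono[OF BD(1), of convex] by blast
    then show False using is_simplex_lift[OF _ BD(2,4)] P(2) by blast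
  qed
  then obtain x b0 where x: "x \<in> X" and b0: "b0 \<in> B" "representation B x b0 < 0" by blast
  have xB: "x \<notin> B"
  proof
    assume "x \<in> B"
    then have "representation B x b0 \<ge> 0" using BD(2) by (simp add: real_vector.representation_basis)
    then show False using b0 by simp
  qed
  define E where "E b = insert x (B - {b})" for b
  \<comment> \<open>With these costs, \<open>B\<close> and all \<open>B - {b} \<union> {x}\<close> for which \<open>x\<close> has a negative coefficient at \<open>b\<close>
    are cells, whatever the remaining points are.\<close>
  define K where "K = 1 + (\<Sum>b\<in>B. \<Sum>y\<in>X. \<bar>representation (E b) y x\<bar>)"
  have K: "representation (E b) y x < K" if "b \<in> B" "y \<in> X" for b y
  proof -
    have "\<bar>representation (E b) y x\<bar> \<le> (\<Sum>y\<in>X. \<bar>representation (E b) y x\<bar>)"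
      using X(1) that by (intro member_le_sum) auto
    also have "\<dots> \<le> (\<Sum>b\<in>B. \<Sum>y\<in>X. \<bar>representation (E b) y x\<bar>)"
      using that BD(4) by (intro member_le_sum[of b B "\<lambda>b. \<Sum>y\<in>X. \<bar>representation (E b) y x\<bar>"]) (auto intro: sum_nonneg)
    finally show ?thesis by (simp add: K_def)
  qed
  have "0 \<le> (\<Sum>b\<in>B. \<Sum>y\<in>X. \<bar>representation (E b) y x\<bar>)" by (intro sum_nonneg) auto
  then have K1: "K > 0" by (simp add: K_def)
  define c0 where "c0 y = (if y \<in> B then 0 else if y = x then 1 else K)" for y
  obtain c where c: "\<And>B x. B \<in> bases X \<Longrightarrow> x \<in> X - B \<Longrightarrow> interpolate B c x \<noteq> c x"
    "\<And>B x. B \<in> bases X \<Longrightarrow> x \<in> X - B \<Longrightarrow> interpolate B c0 x < c0 x \<Longrightarrow> interpolate B c x < c x"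
    using generic_cost[OF X(1), of c0] by blast
  have triB: "B \<in> triangulation X c"
  proof -
    have "interpolate B c0 y < c0 y" if "y \<in> X - B" for y
      using that K1 by (simp add: interpolate_def c0_def)
    then show ?thesis using c(2)[OF B] B by (auto simp: triangulation_def)
  qed
  have triE: "E b \<in> triangulation X c" if b: "b \<in> B" "representation B x b < 0" for b
  proof -
    note ex = exchange_basis[OF B X(1) x xB b(1), folded E_def]
    have Eb: "E b \<in> bases X" using ex(1) b(2) by simp
    have finE: "finite (E b)" using BD(4) by (simp add: E_def)
    have int: "interpolate (E b) c0 y = representation (E b) y x" for y
    proof -
      have "interpolate (E b) c0 y = (\<Sum>a\<in>E b. if a = x then representation (E b) y x else 0)"
        unfolding interpolate_def using xB by (intro sum.cong) (auto simp: c0_def E_def)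
      then show ?thesis using finE by (simp add: E_def)
    qed
    \<comment> \<open>Only \<open>x\<close> carries cost among the points of \<open>E b\<close>. At
      \<open>b\<close> the interpolation is the reciprocal of a negative coefficient, hence below
      the cost 0; at the remaining points \<open>K\<close> dominates.\<close>
    have "interpolate (E b) c0 y < c0 y" if y: "y \<in> X - E b" for y
    proof (cases "y = b")
      case True
      have "representation (E b) b x < 0" using ex(2) b(2) by (simp add: divide_neg_pos)
      then show ?thesis using True b(1) by (simp add: int c0_def)
    next
      case False
      then have "y \<notin> B" "y \<noteq> x" using y by (auto simp: E_def)
      then show ?thesis using K[OF b(1), of y] y by (simp add: int c0_def)
    qed
    then show ?thesis using c(2)[OF Eb] Eb by (auto simp: triangulation_def)
  qed
  obtain N where N: "Vol d P = (\<Sum>B\<in>triangulation X c. int (card (half_open_box B (\<lambda>b. b) (N B) \<inter> Zd (d + 1))))"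
    "\<And>B. B \<in> triangulation X c \<Longrightarrow> finite (half_open_box B (\<lambda>b. b) (N B) \<inter> Zd (d + 1))"
    "poscone X \<subseteq> (\<Union>B\<in>triangulation X c. half_open_cone B (\<lambda>b. b) {})"
    by (rule Vol_triangulation[OF X(1) XZ X(2,4,3,5) c(1)]) auto
  define w where "w B = card (half_open_box B (\<lambda>b. b) (N B) \<inter> Zd (d + 1))" for B
  have tb: "B \<in> bases X" if "B \<in> triangulation X c" for B using that by (simp add: triangulation_def)
  have pZ: "b \<in> Zd (d + 1)" if "B \<in> bases X" "b \<in> B" for B b using basesD(1)[OF that(1) X(1)] XZ that(2) by blast
  \<comment> \<open>The lattice of any cell lies in the one generated by \<open>X\<close>, which is
    proper as \<open>P\<close> is nonspanning, so the box meets at least two cosets.\<close>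
  have w2: "2 \<le> w B'" if B': "B' \<in> triangulation X c" for B'
  proof -
    obtain z where "z \<in> Zd (d + 1)" "z \<notin> int_span B' (\<lambda>b. b)" using ex[OF tb[OF B']] by blast
    then show ?thesis unfolding w_def
      by (intro card_box_ge_2(1)[OF N(2)[OF B'] pZ[OF tb[OF B']] spanB[OF tb[OF B']]])
  qed
  have fintri: "finite (triangulation X c)" using X(1) by (auto simp: triangulation_def bases_def)
  have sumw: "(\<Sum>B\<in>triangulation X c. w B) \<le> 4" using N(1) P(4) unfolding w_def of_nat_sum[symmetric] by linarith
  have EB: "E b \<noteq> B" for b using xB by (auto simp: E_def)
  have small: "T \<subseteq> triangulation X c \<Longrightarrow> 2 * card T \<le> 4" for T
  proof -
    assume T: "T \<subseteq> triangulation X c"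
    have "2 * card T = (\<Sum>B\<in>T. 2)" by simp
    also have "\<dots> \<le> (\<Sum>B\<in>T. w B)" using T w2 by (intro sum_mono) auto
    also have "\<dots> \<le> (\<Sum>B\<in>triangulation X c. w B)" using T fintri by (intro sum_mono2) auto
    finally show ?thesis using sumw by linarith
  qed
  have E_ne: "E b \<noteq> E b'" if "b \<in> B" "b' \<in> B" "b \<noteq> b'" for b b'
  proof -
    have "b \<in> E b'" "b \<notin> E b" using that xB by (auto simp: E_def)
    then show ?thesis by blast
  qed
  \<comment> \<open>A second negative coefficient would give a third cell, and a total weight of at
    least 6.\<close>
  have uniq: "b = b0" if b: "b \<in> B" "representation B x b < 0" for b
  proof (rule ccontr)
    assume "b \<noteq> b0"
    then have "card {B, E b, E b0} = 3" using EB E_ne[of b b0] b0 b by (auto simp: card_insert_if)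
    moreover have "2 * card {B, E b, E b0} \<le> 4" using triB triE b b0 by (intro small) auto
    ultimately show False by simp
  qed
  have tri2: "triangulation X c = {B, E b0}"
  proof -
    have "card {B, E b0} = 2" using EB by (metis card_2_iff)
    moreover have sub: "{B, E b0} \<subseteq> triangulation X c" using triB triE b0 by auto
    moreover have "card (triangulation X c) \<le> 2" using small[of "triangulation X c"] by simp
    ultimately show ?thesis using card_seteq[OF fintri sub] by simp
  qed
  have weq: "w B' \<le> 2" if B': "B' \<in> triangulation X c" for B'
  proof -
    have "w B + w (E b0) \<le> 4" using sumw EB[of b0] unfolding tri2 by simp
    then show ?thesis using w2[OF triB] w2[OF triE[OF b0]] B' unfolding tri2 by auto
  qed
  have idx: "z - z' \<in> int_span B' (\<lambda>b. b)"
    if "B' \<in> triangulation X c" "z \<in> Zd (d + 1)" "z \<notin> int_span B' (\<lambda>b. b)" "z' \<in> Zd (d + 1)" "z' \<notin> int_span B' (\<lambda>b. b)" for B' z z'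
    by (rule card_box_ge_2(2)[OF N(2)[OF that(1)] pZ[OF tb[OF that(1)]] spanB[OF tb[OF that(1)]] that(2,3) weq[OF that(1), unfolded w_def] that(4,5)])
  \<comment> \<open>If \<open>y\<close> left the index-2 lattice of a cell, the two together would
    generate all of \<open>Zd (d + 1)\<close> inside the lattice of \<open>X\<close>.\<close>
  have XB: "y \<in> int_span B' (\<lambda>b. b)" if B': "B' \<in> triangulation X c" and y: "y \<in> X" for B' y
  proof (rule ccontr)
    assume ny: "y \<notin> int_span B' (\<lambda>b. b)"
    have "Zd (d + 1) \<subseteq> int_span X (\<lambda>b. b)"
    proof
      fix z assume z: "z \<in> Zd (d + 1)"
      show "z \<in> int_span X (\<lambda>b. b)"
      proof (cases "z \<in> int_span B' (\<lambda>b. b)")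
        case True
        then show ?thesis using BintX[OF tb[OF B']] by blast
      next
        case False
        then have "z - y \<in> int_span X (\<lambda>b. b)" using idx[OF B' z False _ ny] y XZ BintX[OF tb[OF B']] by blast
        then have "z - y + y \<in> int_span X (\<lambda>b. b)" by (rule int_span_add) (rule int_span_base[OF y X(1)])
        then show ?thesis by simp
      qed
    qed
    then show False using nonsp XintZ by blast
  qed
  define \<beta> where "\<beta> = representation B x"
  have \<beta>int: "\<beta> b \<in> \<int>" if "b \<in> B" for b
    unfolding \<beta>_def by (rule representation_int_span[OF BD(2,4) XB[OF triB x] that])
  \<comment> \<open>Integrality over \<open>B\<close> and over \<open>E b0\<close> makes both the
    coefficient and its reciprocal integers; the sign is already known.\<close>
  have \<beta>0: "\<beta> b0 = - 1"
  proof -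
    note ex = exchange_basis[OF B X(1) x xB b0(1), folded E_def]
    have Eb: "E b0 \<in> bases X" using ex(1) b0(2) by simp
    note ED = basesD[OF Eb X(1)]
    have "b0 \<in> X" using b0 BD by blast
    then have "representation (E b0) b0 x \<in> \<int>"
      by (intro representation_int_span[OF ED(2,4) XB[OF triE[OF b0]]]) (simp_all add: E_def)
    then have "1 / \<beta> b0 \<in> \<int>" using ex(2) b0(2) by (simp add: \<beta>_def)
    then obtain m where m: "1 / \<beta> b0 = of_int m" by (elim Ints_cases)
    obtain k where k: "\<beta> b0 = of_int k" using \<beta>int[OF b0(1)] by (elim Ints_cases)
    have k0: "k < 0" using b0(2) k by (simp add: \<beta>_def)
    have "real_of_int (k * m) = 1" using m k k0 by (simp add: field_simps)
    then have "k * m = 1" by linarith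
    then have "k = - 1" using k0 by (metis zmult_eq_1_iff not_one_less_zero)
    then show ?thesis using k by simp
  qed
  have \<beta>nn: "0 \<le> \<beta> b" if "b \<in> B - {b0}" for b using uniq[of b] that by (force simp: \<beta>_def)
  have \<beta>sum: "(\<Sum>b\<in>B - {b0}. \<beta> b) = 2"
    using xsum(2)[OF x] sum.remove[OF BD(4) b0(1), of \<beta>] \<beta>0 by (simp add: \<beta>_def)
  have xeq: "x = (\<Sum>b\<in>B - {b0}. \<beta> b *\<^sub>R b) - b0"
    using xsum(1)[OF x] sum.remove[OF BD(4) b0(1), of "\<lambda>b. \<beta> b *\<^sub>R b"] \<beta>0 by (simp add: \<beta>_def)
  have "\<exists>b\<in>B - {b0}. \<beta> b \<noteq> 0" using \<beta>sum by (metis sum.neutral zero_neq_numeral)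
  then obtain b1 where b1: "b1 \<in> B - {b0}" "\<beta> b1 \<noteq> 0" by blast
  have b1ge: "1 \<le> \<beta> b1" using \<beta>nn[OF b1(1)] \<beta>int[of b1] b1 by (auto elim!: Ints_cases)
  have fin0: "finite (B - {b0})" using BD(4) by simp
  \<comment> \<open>In the cone of a cell, the coefficients of a point of \<open>X\<close> are
    nonnegative integers with sum 1, so the point is a generator of that cell.\<close>
  have XBx: "X = insert x B"
  proof -
    have "y \<in> insert x B" if y: "y \<in> X" for y
    proof -
      have "y = (\<Sum>x\<in>X. (if x = y then 1 else 0) *\<^sub>R x)"
        using X(1) y by (simp add: if_distrib[of "\<lambda>r. r *\<^sub>R _"] cong: if_cong)
      then have "y \<in> poscone X" unfolding poscone_def by (intro CollectI exI[of _ "\<lambda>x. if x = y then 1 else 0"]) auto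
      then obtain B' where B': "B' \<in> triangulation X c" "y \<in> half_open_cone B' (\<lambda>b. b) {}" using N(3) by blast
      note B'D = basesD[OF tb[OF B'(1)] X(1)]
      have nn: "0 \<le> representation B' y b" if "b \<in> B'" for b
        using B'(2) half_open_cone_iff[OF B'D(2,4)] that by blast
      have yB': "y = (\<Sum>b\<in>B'. representation B' y b *\<^sub>R b)"
        using lincomb_representation[OF B'D(2,4)] B'D(3) y by auto
      have "ht d (\<Sum>b\<in>B'. representation B' y b *\<^sub>R b) = (\<Sum>b\<in>B'. representation B' y b)"
        by (rule poscone_height) (use B'D(1) X(2) in auto)
      then have s1: "(\<Sum>b\<in>B'. representation B' y b) = 1" using yB' X(2)[OF y] by simp
      obtain b where b: "b \<in> B'" "representation B' y b = 1" "\<And>a. a \<in> B' \<Longrightarrow> a \<noteq> b \<Longrightarrow> representation B' y a = 0"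
        by (rule nonneg_int_sum_eq_1[OF B'D(4) representation_int_span[OF B'D(2,4) XB[OF B'(1) y]] nn s1]) auto
      have "(\<Sum>a\<in>B'. representation B' y a *\<^sub>R a) = (\<Sum>a\<in>B'. if a = b then b else 0)"
        using b by (intro sum.cong) auto
      then have "y = b" using yB' b(1) B'D(4) by simp
      then show ?thesis using b(1) B'(1) unfolding tri2 by (auto simp: E_def)
    qed
    then show ?thesis using x BD(1) by blast
  qed
  \<comment> \<open>The coefficients off \<open>b0\<close> are nonnegative integers with sum 2. A
    single 2 would make \<open>b1\<close> the midpoint of \<open>x\<close> and \<open>b0\<close>,
    and \<open>P\<close> the simplex on \<open>E b1\<close>; so they are 1 and 1.\<close>
  have "\<beta> b1 < 2"
  proof (rule ccontr)
    assume "\<not> \<beta> b1 < 2"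
    moreover have s: "\<beta> b1 + (\<Sum>b\<in>B - {b0} - {b1}. \<beta> b) = 2" using \<beta>sum sum.remove[OF fin0 b1(1), of \<beta>] by simp
    moreover have nn: "0 \<le> (\<Sum>b\<in>B - {b0} - {b1}. \<beta> b)" using \<beta>nn by (intro sum_nonneg) auto
    ultimately have b12: "\<beta> b1 = 2" "(\<Sum>b\<in>B - {b0} - {b1}. \<beta> b) = 0" by auto
    have z: "\<forall>b\<in>B - {b0} - {b1}. \<beta> b = 0"
      using sum_nonneg_eq_0_iff[of "B - {b0} - {b1}" \<beta>] BD(4) \<beta>nn b12(2) by auto
    have "x = 2 *\<^sub>R b1 - b0"
      using xeq sum.remove[OF fin0 b1(1), of "\<lambda>b. \<beta> b *\<^sub>R b"] z b12(1) by simp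
    then have b1eq: "b1 = (1/2) *\<^sub>R x + (1/2) *\<^sub>R b0" by (simp add: scaleR_diff_right)
    have E1: "E b1 \<in> bases X" using exchange_basis(1)[OF B X(1) x xB, of b1] b1 by (simp add: E_def \<beta>_def)
    note ED = basesD[OF E1 X(1)]
    have "b0 \<in> convex hull (E b1)" "x \<in> convex hull (E b1)"
      using b1 b0 by (auto intro!: hull_inc simp: E_def)
    then have "(1/2) *\<^sub>R x + (1/2) *\<^sub>R b0 \<in> convex hull (E b1)"
      by (intro convexD[OF convex_convex_hull]) auto
    then have "b1 \<in> convex hull (E b1)" using b1eq by simp
    then have "X \<subseteq> convex hull (E b1)"
      unfolding XBx using hull_subset[of "E b1" convex] by (auto simp: E_def)
    then have "convex hull X \<subseteq> convex hull (E b1)" by (rule hull_minimal) simp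
    then have "lift1 d P = convex hull (E b1)" using X(3) hull_mono[OF ED(1), of convex] by blast
    then show False using is_simplex_lift[OF _ ED(2,4)] P(2) by blast
  qed
  then have b11: "\<beta> b1 = 1" using b1ge \<beta>int[of b1] b1 by (auto elim!: Ints_cases)
  have s1: "(\<Sum>b\<in>B - {b0} - {b1}. \<beta> b) = 1" using \<beta>sum sum.remove[OF fin0 b1(1), of \<beta>] b11 by simp
  obtain b2 where b2: "b2 \<in> B - {b0} - {b1}" "\<beta> b2 = 1" "\<And>a. a \<in> B - {b0} - {b1} \<Longrightarrow> a \<noteq> b2 \<Longrightarrow> \<beta> a = 0"
    by (rule nonneg_int_sum_eq_1[OF _ _ _ s1]) (use BD(4) \<beta>int \<beta>nn in auto)
  have "(\<Sum>b\<in>B - {b0} - {b1}. \<beta> b *\<^sub>R b) = (\<Sum>b\<in>B - {b0} - {b1}. if b = b2 then b2 else 0)"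
    using b2 by (intro sum.cong) auto
  also have "\<dots> = b2" using b2(1) BD(4) by simp
  finally have "x = b1 + b2 - b0"
    using xeq sum.remove[OF fin0 b1(1), of "\<lambda>b. \<beta> b *\<^sub>R b"] b11 by simp
  then show ?thesis
    using that[OF B b0(1), of b1 b2] b1 b2 xB XBx idx[OF triB] ex[OF B] by auto
qed

section \<open>Frames of the integer lattice\<close>

definition half_indicator :: "'i set \<Rightarrow> 'i \<Rightarrow> real" where
  "half_indicator S i = (if i \<in> S then 1 / 2 else 0)"

text \<open>
  \<open>\<int>\<^sup>d\<^sup>+\<^sup>1\<close> is generated by the basis \<open>p\<close> of height-one vectors and half the sum of the \<open>p i\<close>, \<open>i \<in> S\<close>;
  for \<open>S \<noteq> {}\<close>, the vectors \<open>p i\<close> generate a sublattice of index 2.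
\<close>

definition frame :: "nat \<Rightarrow> 'i set \<Rightarrow> ('i \<Rightarrow> vect) \<Rightarrow> 'i set \<Rightarrow> bool" where
  "frame d I p S \<longleftrightarrow> indep_family I p \<and> card I = d + 1 \<and> S \<subseteq> I \<and>
     (\<forall>i\<in>I. p i \<in> Zd (d + 1) \<and> ht d (p i) = 1) \<and>
     Zd (d + 1) = {\<Sum>i\<in>I. r i *\<^sub>R p i | r. (\<forall>i\<in>I. r i \<in> \<int>) \<or> (\<forall>i\<in>I. r i - half_indicator S i \<in> \<int>)}"

text \<open>
  The lifted polytope is an iterated pyramid over the parallelogram with vertices \<open>p a\<close>, \<open>p b\<close>,
  \<open>p b + p c - p a\<close>, \<open>p c\<close> in this cyclic order.
\<close>

definition square_frame :: "nat \<Rightarrow> 'i set \<Rightarrow> ('i \<Rightarrow> vect) \<Rightarrow> 'i set \<Rightarrow> 'i \<Rightarrow> 'i \<Rightarrow> 'i \<Rightarrow> vect set \<Rightarrow> bool" where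
  "square_frame d I p S a b c P \<longleftrightarrow> frame d I p S \<and> P \<subseteq> Rd d \<and> {a, b, c} \<subseteq> I \<and> a \<noteq> b \<and> a \<noteq> c \<and> b \<noteq> c \<and>
     lift1 d P = convex hull (insert (p b + p c - p a) (p ` I))"

lemma frameD:
  assumes "frame d I p S"
  shows "indep_family I p" "finite I" "card I = d + 1" "S \<subseteq> I" "finite S"
    "\<And>i. i \<in> I \<Longrightarrow> p i \<in> Zd (d + 1)" "\<And>i. i \<in> I \<Longrightarrow> ht d (p i) = 1"
  using assms unfolding frame_def indep_family_def by (auto intro: finite_subset)

lemma frame_Zd_iff:
  assumes "frame d I p S"
  shows "(\<Sum>i\<in>I. r i *\<^sub>R p i) \<in> Zd (d + 1) \<longleftrightarrow> (\<forall>i\<in>I. r i \<in> \<int>) \<or> (\<forall>i\<in>I. r i - half_indicator S i \<in> \<int>)"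
proof
  assume "(\<Sum>i\<in>I. r i *\<^sub>R p i) \<in> Zd (d + 1)"
  then obtain s where s: "(\<Sum>i\<in>I. r i *\<^sub>R p i) = (\<Sum>i\<in>I. s i *\<^sub>R p i)"
    "(\<forall>i\<in>I. s i \<in> \<int>) \<or> (\<forall>i\<in>I. s i - half_indicator S i \<in> \<int>)"
    using assms unfolding frame_def by auto
  have "r i = s i" if "i \<in> I" for i by (rule indep_familyD[OF frameD(1)[OF assms] s(1) that])
  then show "(\<forall>i\<in>I. r i \<in> \<int>) \<or> (\<forall>i\<in>I. r i - half_indicator S i \<in> \<int>)" using s(2) by simp
next
  assume "(\<forall>i\<in>I. r i \<in> \<int>) \<or> (\<forall>i\<in>I. r i - half_indicator S i \<in> \<int>)"
  then show "(\<Sum>i\<in>I. r i *\<^sub>R p i) \<in> Zd (d + 1)" using assms unfolding frame_def by auto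
qed

lemma indep_family_image:
  assumes "indep_family I p"
  shows "inj_on p I" "independent (p ` I)"
proof -
  have fin: "finite I" using assms by (simp add: indep_family_def)
  show inj: "inj_on p I"
  proof (rule inj_onI)
    fix i j assume ij: "i \<in> I" "j \<in> I" "p i = p j"
    have "(\<Sum>k\<in>I. (if k = m then 1 else 0) *\<^sub>R p k) = p m" if "m \<in> I" for m
    proof -
      have "(\<Sum>k\<in>I. (if k = m then 1 else 0) *\<^sub>R p k) = (\<Sum>k\<in>I. if k = m then p m else 0)"
        by (intro sum.cong) auto
      then show ?thesis using fin that by simp
    qed
    then have "(\<Sum>k\<in>I. (if k = i then 1 else 0) *\<^sub>R p k) = (\<Sum>k\<in>I. (if k = j then 1 else 0) *\<^sub>R p k)"
      using ij by simp
    from indep_familyD[OF assms this ij(1)] show "i = j" by (auto split: if_splits)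
  qed
  show "independent (p ` I)"
  proof
    assume "dependent (p ` I)"
    then obtain u v where u: "v \<in> p ` I" "u v \<noteq> 0" "(\<Sum>v\<in>p ` I. u v *\<^sub>R v) = 0"
      using real_vector.dependent_finite[OF finite_imageI[OF fin]] by blast
    then have "(\<Sum>i\<in>I. u (p i) *\<^sub>R p i) = (\<Sum>i\<in>I. 0 *\<^sub>R p i)" by (simp add: sum.reindex[OF inj])
    then have "u (p i) = 0" if "i \<in> I" for i
      using indep_familyD[OF assms _ that, of "\<lambda>i. u (p i)" "\<lambda>_. 0"] by simp
    then show False using u by auto
  qed
qed

lemma frame_span:
  assumes "frame d I p S"
  shows "span (p ` I) = Rd (d + 1)"
proof -
  note fr = frameD[OF assms]
  have "p ` I \<subseteq> Rd (d + 1)" using fr(6) by (auto simp: Zd_def)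
  then show ?thesis
    using independent_Rd_span[of "p ` I" "d + 1"] indep_family_image[OF fr(1)] fr(3) by (simp add: card_image)
qed

lemma frame_coeffs:
  assumes "frame d I p S" "y \<in> Rd (d + 1)"
  obtains r where "y = (\<Sum>i\<in>I. r i *\<^sub>R p i)"
proof -
  note fr = frameD[OF assms(1)]
  have "y \<in> span (p ` I)" using frame_span[OF assms(1)] assms(2) by simp
  then obtain u where "y = (\<Sum>v\<in>p ` I. u v *\<^sub>R v)"
    using real_vector.span_finite[OF finite_imageI[OF fr(2)], of p] by auto
  then have "y = (\<Sum>i\<in>I. u (p i) *\<^sub>R p i)" by (simp add: sum.reindex[OF indep_family_image(1)[OF fr(1)]])
  then show ?thesis using that[of "\<lambda>i. u (p i)"] by simp
qed

lemma frame_height: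
  assumes "frame d I p S"
  shows "ht d (\<Sum>i\<in>I. r i *\<^sub>R p i) = (\<Sum>i\<in>I. r i)"
  using frameD(7)[OF assms] by simp

lemma sum_half_indicator:
  assumes "finite I" "S \<subseteq> I"
  shows "(\<Sum>i\<in>I. half_indicator S i) = real (card S) / 2"
proof -
  have "(\<Sum>i\<in>I. half_indicator S i) = (\<Sum>i\<in>S. 1 / 2)"
    unfolding half_indicator_def using assms by (intro sum.mono_neutral_cong_right) auto
  then show ?thesis by simp
qed

text \<open>The half-sum of \<open>S\<close> is a lattice point of height
  \<open>card S / 2\<close>.\<close>

lemma frame_card_even:
  assumes "frame d I p S"
  shows "even (card S)"
proof -
  note fr = frameD[OF assms]
  have "(\<Sum>i\<in>I. half_indicator S i *\<^sub>R p i) \<in> Zd (d + 1)" by (subst frame_Zd_iff[OF assms]) simp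
  then have "ht d (\<Sum>i\<in>I. half_indicator S i *\<^sub>R p i) \<in> \<int>" by (simp add: Zd_iff)
  then have "real (card S) / 2 \<in> \<int>"
    by (simp only: frame_height[OF assms] sum_half_indicator[OF fr(2,4)])
  then obtain k where "real (card S) / 2 = of_int k" by (elim Ints_cases)
  then have "int (card S) = 2 * k" by linarith
  then show ?thesis by presburger
qed

lemma frame_reindex:
  assumes "frame d I p S" "bij_betw \<pi> J I"
  shows "frame d J (p \<circ> \<pi>) {j\<in>J. \<pi> j \<in> S}"
proof -
  note fr = frameD[OF assms(1)]
  have inj: "inj_on \<pi> J" and im: "\<pi> ` J = I" using assms(2) by (auto simp: bij_betw_def)
  have finJ: "finite J" using bij_betw_finite[OF assms(2)] fr(2) by simp
  have re: "(\<Sum>i\<in>I. f i) = (\<Sum>j\<in>J. f (\<pi> j))" for f :: "'a \<Rightarrow> vect"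
    using sum.reindex[OF inj, of f] im by simp
  have sum: "(\<Sum>j\<in>J. r j *\<^sub>R (p \<circ> \<pi>) j) = (\<Sum>i\<in>I. r (the_inv_into J \<pi> i) *\<^sub>R p i)" for r
    unfolding re by (intro sum.cong) (auto simp: the_inv_into_f_f[OF inj])
  have all: "(\<forall>j\<in>J. Q j) \<longleftrightarrow> (\<forall>i\<in>I. Q (the_inv_into J \<pi> i))" for Q
    using im by (auto simp: the_inv_into_f_f[OF inj])
  have Zall: "Zd (d + 1) = {\<Sum>j\<in>J. r j *\<^sub>R (p \<circ> \<pi>) j | r. (\<forall>i\<in>J. r i \<in> \<int>) \<or> (\<forall>i\<in>J. r i - half_indicator {j\<in>J. \<pi> j \<in> S} i \<in> \<int>)}"
    (is "_ = ?R")
  proof (intro equalityI subsetI)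
    fix z assume "z \<in> Zd (d + 1)"
    then obtain s where s: "z = (\<Sum>i\<in>I. s i *\<^sub>R p i)" "(\<forall>i\<in>I. s i \<in> \<int>) \<or> (\<forall>i\<in>I. s i - half_indicator S i \<in> \<int>)"
      using assms(1) unfolding frame_def by auto
    have "z = (\<Sum>j\<in>J. s (\<pi> j) *\<^sub>R (p \<circ> \<pi>) j)" unfolding s(1) re by simp
    moreover have "(\<forall>i\<in>J. s (\<pi> i) \<in> \<int>) \<or> (\<forall>i\<in>J. s (\<pi> i) - half_indicator {j\<in>J. \<pi> j \<in> S} i \<in> \<int>)"
    proof -
      have "half_indicator {j\<in>J. \<pi> j \<in> S} i = half_indicator S (\<pi> i)" if "i \<in> J" for i
        using that by (simp add: half_indicator_def)
      moreover have "\<pi> i \<in> I" if "i \<in> J" for i using that im by blast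
      ultimately show ?thesis using s(2) by (simp, blast)
    qed
    ultimately show "z \<in> ?R" by (intro CollectI exI[of _ "\<lambda>j. s (\<pi> j)"] conjI)
  next
    fix z assume "z \<in> ?R"
    then obtain r where r: "z = (\<Sum>j\<in>J. r j *\<^sub>R (p \<circ> \<pi>) j)"
      "(\<forall>i\<in>J. r i \<in> \<int>) \<or> (\<forall>i\<in>J. r i - half_indicator {j\<in>J. \<pi> j \<in> S} i \<in> \<int>)" by auto
    have "(\<forall>i\<in>I. r (the_inv_into J \<pi> i) \<in> \<int>) \<or> (\<forall>i\<in>I. r (the_inv_into J \<pi> i) - half_indicator S i \<in> \<int>)"
      using r(2) unfolding im[symmetric] by (auto simp: the_inv_into_f_f[OF inj] half_indicator_def split: if_splits)
    then show "z \<in> Zd (d + 1)" unfolding r(1) sum frame_Zd_iff[OF assms(1)] .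
  qed
  have ind: "indep_family J (p \<circ> \<pi>)"
    unfolding indep_family_def
  proof (intro conjI allI impI ballI)
    fix r j assume 0: "(\<Sum>j\<in>J. r j *\<^sub>R (p \<circ> \<pi>) j) = 0" and j: "j \<in> J"
    have "(\<Sum>i\<in>I. r (the_inv_into J \<pi> i) *\<^sub>R p i) = (\<Sum>i\<in>I. 0 *\<^sub>R p i)" using 0 unfolding sum by simp
    from indep_familyD[OF fr(1) this, of "\<pi> j"] show "r j = 0"
      using j im by (auto simp: the_inv_into_f_f[OF inj])
  qed (rule finJ)
  have "card J = d + 1" using bij_betw_same_card[OF assms(2)] fr(3) by simp
  moreover have "\<forall>j\<in>J. (p \<circ> \<pi>) j \<in> Zd (d + 1) \<and> ht d ((p \<circ> \<pi>) j) = 1" using fr(6,7) im by auto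
  ultimately show ?thesis using ind Zall unfolding frame_def by blast
qed

text \<open>A coefficient 1 or -1 at \<open>i\<close> makes the exchange invertible over the
  integers. If \<open>i \<in> S\<close>, rewriting the half-sum of \<open>S\<close> changes the
  coefficient at another \<open>j\<close> by half of \<open>\<beta> j\<close> up to sign, so
  membership of \<open>j\<close> flips exactly for odd \<open>\<beta> j\<close>.\<close>

lemma frame_exchange:
  fixes \<beta> :: "'i \<Rightarrow> int"
  assumes fr0: "frame d I p S" and i: "i \<in> I" "\<bar>\<beta> i\<bar> = 1" and x: "x = (\<Sum>j\<in>I. of_int (\<beta> j) *\<^sub>R p j)" "ht d x = 1"
  shows "frame d I (p(i := x)) {j\<in>I. if j \<noteq> i \<and> odd (\<beta> j) \<and> i \<in> S then j \<notin> S else j \<in> S}"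
    (is "frame d I ?p ?S")
proof -
  note fr = frameD[OF fr0]
  have bi: "\<beta> i * \<beta> i = 1" using i(2) by (auto simp: abs_if split: if_splits)
  \<comment> \<open>\<open>f\<close> passes from coefficients over \<open>p\<close> to coefficients
    over \<open>p(i := x)\<close>, and \<open>g\<close> goes back.\<close>
  define f where "f r j = (if j = i then of_int (\<beta> i) * r i else r j - of_int (\<beta> j * \<beta> i) * r i)" for r :: "'i \<Rightarrow> real" and j
  define g where "g r j = (if j = i then of_int (\<beta> i) * r i else r j + of_int (\<beta> j) * r i)" for r :: "'i \<Rightarrow> real" and j
  have bi': "of_int (\<beta> i) * (of_int (\<beta> i) * t) = t" for t :: real
    using bi by (metis mult.assoc mult_1 of_int_1 of_int_mult)
  have fg: "f (g r) = r" and gf: "g (f r) = r" for r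
    unfolding f_def g_def using bi' by (auto simp: fun_eq_iff mult.assoc)
  have sumg: "(\<Sum>j\<in>I. r j *\<^sub>R ?p j) = (\<Sum>j\<in>I. g r j *\<^sub>R p j)" for r
  proof -
    have xi: "x = of_int (\<beta> i) *\<^sub>R p i + (\<Sum>j\<in>I - {i}. of_int (\<beta> j) *\<^sub>R p j)"
      using x(1) sum.remove[OF fr(2) i(1)] by simp
    have "(\<Sum>j\<in>I. r j *\<^sub>R ?p j) = r i *\<^sub>R x + (\<Sum>j\<in>I - {i}. r j *\<^sub>R p j)"
      using sum.remove[OF fr(2) i(1), of "\<lambda>j. r j *\<^sub>R ?p j"] by simp
    also have "\<dots> = (of_int (\<beta> i) * r i) *\<^sub>R p i + (\<Sum>j\<in>I - {i}. (r j + of_int (\<beta> j) * r i) *\<^sub>R p j)"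
      unfolding xi by (simp add: scaleR_right_distrib scaleR_left_distrib sum.distrib scaleR_sum_right mult.commute)
    also have "\<dots> = (\<Sum>j\<in>I. g r j *\<^sub>R p j)"
      using sum.remove[OF fr(2) i(1), of "\<lambda>j. g r j *\<^sub>R p j"] by (simp add: g_def)
    finally show ?thesis .
  qed
  have sumf: "(\<Sum>j\<in>I. r j *\<^sub>R p j) = (\<Sum>j\<in>I. f r j *\<^sub>R ?p j)" for r
    unfolding sumg gf ..
  have hf: "\<forall>j\<in>I. f r j - half_indicator ?S j \<in> \<int>" if h: "\<forall>j\<in>I. r j - half_indicator S j \<in> \<int>" for r
  proof
    fix j assume j: "j \<in> I"
    obtain m where m: "r i = half_indicator S i + of_int m"
      using h i(1) by (metis Ints_cases add_diff_cancel_left' diff_add_cancel add.commute)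
    obtain n where n: "r j = half_indicator S j + of_int n"
      using h j by (metis Ints_cases add_diff_cancel_left' diff_add_cancel add.commute)
    show "f r j - half_indicator ?S j \<in> \<int>"
    proof (cases "j = i")
      case True
      have "\<beta> i = 1 \<or> \<beta> i = -1" using i(2) by linarith
      then have "f r j - half_indicator ?S j = of_int (if i \<in> S \<and> \<beta> i = -1 then - m - 1 else \<beta> i * m)"
        using True i(1) m by (auto simp: f_def half_indicator_def)
      then show ?thesis by (metis Ints_of_int)
    next
      case False
      show ?thesis
      proof (cases "i \<in> S")
        case True
        define t where "t = \<beta> j * \<beta> i"
        have odd: "odd t \<longleftrightarrow> odd (\<beta> j)" using i(2) unfolding t_def by (auto simp: abs_if split: if_splits)
        have fr: "f r j = half_indicator S j + of_int n - of_int t * (1 / 2 + of_int m)"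
          using False m n True by (simp add: f_def t_def half_indicator_def)
        show ?thesis
        proof (cases "odd t")
          case t: True
          then obtain u where u: "t = 2 * u + 1" by (elim oddE)
          have "f r j - half_indicator ?S j = of_int (if j \<in> S then n - u - t * m else n - u - 1 - t * m)"
            unfolding fr using False True j t odd u by (auto simp: half_indicator_def field_simps)
          then show ?thesis by (metis Ints_of_int)
        next
          case t: False
          then obtain u where u: "t = 2 * u" by auto
          have "f r j - half_indicator ?S j = of_int (n - u - t * m)"
            unfolding fr using False True j t odd u by (auto simp: half_indicator_def field_simps)
          then show ?thesis by (metis Ints_of_int)
        qed
      next
        case False
        then have "f r j - half_indicator ?S j = of_int (n - \<beta> j * \<beta> i * m)"
          using \<open>j \<noteq> i\<close> j m n by (auto simp: f_def half_indicator_def)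
        then show ?thesis by (metis Ints_of_int)
      qed
    qed
  qed
  \<comment> \<open>This direction reduces to the previous one: \<open>r\<close> differs by integers
    from the transformed half-sum \<open>f r0\<close>, and the linear map \<open>g\<close> preserves
    integrality.\<close>
  have hg: "\<forall>j\<in>I. g r j - half_indicator S j \<in> \<int>" if h: "\<forall>j\<in>I. r j - half_indicator ?S j \<in> \<int>" for r
  proof
    define r0 where "r0 j = half_indicator S j" for j
    have h0: "\<forall>j\<in>I. f r0 j - half_indicator ?S j \<in> \<int>" by (rule hf) (simp add: r0_def)
    have d: "r j - f r0 j \<in> \<int>" if "j \<in> I" for j
      using Ints_diff[OF h[rule_format, OF that] h0[rule_format, OF that]] by simp
    fix j assume j: "j \<in> I"
    have "g r j - g (f r0) j = g (\<lambda>j. r j - f r0 j) j" by (simp add: g_def algebra_simps)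
    also have "\<dots> \<in> \<int>" using d[OF j] d[OF i(1)] by (auto simp: g_def)
    finally show "g r j - half_indicator S j \<in> \<int>" by (simp add: gf r0_def)
  qed
  have If: "\<forall>j\<in>I. f r j \<in> \<int>" if "\<forall>j\<in>I. r j \<in> \<int>" for r using that i(1) by (auto simp: f_def)
  have Ig: "\<forall>j\<in>I. g r j \<in> \<int>" if "\<forall>j\<in>I. r j \<in> \<int>" for r using that i(1) by (auto simp: g_def)
  have Zall: "Zd (d + 1) = {\<Sum>j\<in>I. r j *\<^sub>R ?p j | r. (\<forall>j\<in>I. r j \<in> \<int>) \<or> (\<forall>j\<in>I. r j - half_indicator ?S j \<in> \<int>)}"
    (is "_ = ?R")
  proof (intro equalityI subsetI)
    fix z assume "z \<in> Zd (d + 1)"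
    then obtain s where s: "z = (\<Sum>i\<in>I. s i *\<^sub>R p i)" "(\<forall>i\<in>I. s i \<in> \<int>) \<or> (\<forall>i\<in>I. s i - half_indicator S i \<in> \<int>)"
      using fr0 unfolding frame_def by auto
    have "z = (\<Sum>j\<in>I. f s j *\<^sub>R ?p j)" unfolding s(1) by (rule sumf)
    moreover have "(\<forall>j\<in>I. f s j \<in> \<int>) \<or> (\<forall>j\<in>I. f s j - half_indicator ?S j \<in> \<int>)"
      using s(2) If[of s] hf[of s] by argo
    ultimately show "z \<in> ?R" by (intro CollectI exI[of _ "f s"] conjI)
  next
    fix z assume "z \<in> ?R"
    then obtain r where r: "z = (\<Sum>j\<in>I. r j *\<^sub>R ?p j)"
      "(\<forall>j\<in>I. r j \<in> \<int>) \<or> (\<forall>j\<in>I. r j - half_indicator ?S j \<in> \<int>)" by blast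
    then have "(\<forall>j\<in>I. g r j \<in> \<int>) \<or> (\<forall>j\<in>I. g r j - half_indicator S j \<in> \<int>)"
      using Ig[of r] hg[of r] by argo
    then show "z \<in> Zd (d + 1)" unfolding r(1) sumg frame_Zd_iff[OF fr0] .
  qed
  have ind: "indep_family I ?p"
    unfolding indep_family_def
  proof (intro conjI allI impI)
    fix r assume "(\<Sum>j\<in>I. r j *\<^sub>R ?p j) = 0"
    then have "(\<Sum>j\<in>I. g r j *\<^sub>R p j) = (\<Sum>j\<in>I. 0 *\<^sub>R p j)" unfolding sumg by simp
    then have g0: "g r j = 0" if "j \<in> I" for j using indep_familyD[OF fr(1) _ that, of "g r" "\<lambda>_. 0"] by simp
    have "r j = f (g r) j" for j by (simp add: fg)
    then show "\<forall>j\<in>I. r j = 0" using g0 i(1) by (simp add: f_def)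
  qed (rule fr(2))
  have "x \<in> Zd (d + 1)" unfolding x(1) using fr(6) by (intro Zd_sum Zd_scale) auto
  then have "\<forall>j\<in>I. ?p j \<in> Zd (d + 1) \<and> ht d (?p j) = 1" using fr(6,7) x(2) by auto
  then show ?thesis using ind Zall fr(3) unfolding frame_def by blast
qed

section \<open>The parallelogram and its symmetries\<close>

lemma square_coeffs:
  assumes "finite I" "{a, b, c} \<subseteq> I" "a \<noteq> b" "a \<noteq> c" "b \<noteq> c"
  shows "p b + p c - p a = (\<Sum>j\<in>I. of_int (if j = a then -1 else if j = b \<or> j = c then 1 else 0) *\<^sub>R (p j :: vect))"
proof -
  have "(\<Sum>j\<in>I. of_int (if j = a then -1 else if j = b \<or> j = c then 1 else 0) *\<^sub>R p j) =
    (\<Sum>j\<in>I. (if j = b then p b else 0) + (if j = c then p c else 0) - (if j = a then p a else 0))"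
    using assms(3-5) by (intro sum.cong) auto
  also have "\<dots> = p b + p c - p a" using assms(1,2) by (simp add: sum.distrib sum_subtractf)
  finally show ?thesis by simp
qed

lemma square_frameD:
  assumes "square_frame d I p S a b c P"
  shows "frame d I p S" "P \<subseteq> Rd d" "a \<in> I" "b \<in> I" "c \<in> I" "a \<noteq> b" "a \<noteq> c" "b \<noteq> c"
    "lift1 d P = convex hull (insert (p b + p c - p a) (p ` I))"
  using assms by (auto simp: square_frame_def)

text \<open>The opposite vertex has the odd coefficients -1, 1, 1 at \<open>a\<close>,
  \<open>b\<close>, \<open>c\<close> and 0 elsewhere. Exchanging it for \<open>p a\<close> therefore
  flips \<open>b\<close> and \<open>c\<close> if \<open>a \<in> S\<close>, while the exchange at
  some \<open>c \<notin> S\<close> leaves \<open>S\<close> alone.\<close>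

lemma square_frame_exchange:
  assumes "square_frame d I p S a b c P"
  shows "frame d I (p(a := p b + p c - p a)) (if a \<in> S then (S - {b, c}) \<union> ({b, c} - S) else S)"
    and "c \<notin> S \<Longrightarrow> frame d I (p(c := p b + p c - p a)) S"
proof -
  note sq = square_frameD[OF assms]
  note fr = frameD[OF sq(1)]
  let ?\<beta> = "\<lambda>j. if j = a then -1 else if j = b \<or> j = c then 1 else 0 :: int"
  have x: "p b + p c - p a = (\<Sum>j\<in>I. of_int (?\<beta> j) *\<^sub>R p j)"
    by (rule square_coeffs) (use fr(2) sq in auto)
  have hx: "ht d (p b + p c - p a) = 1" using fr(7) sq(3-5) by (simp add: lookup_add lookup_minus)
  have "frame d I (p(a := p b + p c - p a)) {j\<in>I. if j \<noteq> a \<and> odd (?\<beta> j) \<and> a \<in> S then j \<notin> S else j \<in> S}"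
    by (rule frame_exchange[OF sq(1,3) _ x hx]) simp
  also have "{j\<in>I. if j \<noteq> a \<and> odd (?\<beta> j) \<and> a \<in> S then j \<notin> S else j \<in> S} = (if a \<in> S then (S - {b, c}) \<union> ({b, c} - S) else S)"
    using fr(4) sq(3-8) by auto
  finally show "frame d I (p(a := p b + p c - p a)) (if a \<in> S then (S - {b, c}) \<union> ({b, c} - S) else S)" .
  assume c: "c \<notin> S"
  have "frame d I (p(c := p b + p c - p a)) {j\<in>I. if j \<noteq> c \<and> odd (?\<beta> j) \<and> c \<in> S then j \<notin> S else j \<in> S}"
    by (rule frame_exchange[OF sq(1,5) _ x hx]) (use sq in simp)
  also have "{j\<in>I. if j \<noteq> c \<and> odd (?\<beta> j) \<and> c \<in> S then j \<notin> S else j \<in> S} = S" using c fr(4) by auto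
  finally show "frame d I (p(c := p b + p c - p a)) S" .
qed

lemma square_frame_opposite:
  assumes "square_frame d I p S a b c P"
  shows "square_frame d I (p(a := p b + p c - p a)) (if a \<in> S then (S - {b, c}) \<union> ({b, c} - S) else S) a b c P"
proof -
  note sq = square_frameD[OF assms]
  have "p ` I = insert (p a) (p ` (I - {a}))" "(p(a := p b + p c - p a)) ` I = insert (p b + p c - p a) (p ` (I - {a}))"
    using sq(3) by auto
  then show ?thesis
    unfolding square_frame_def using square_frame_exchange(1)[OF assms] sq by (auto simp: insert_commute)
qed

text \<open>Seen from \<open>b\<close>, the opposite vertex computed in the new frame is the old
  \<open>p c\<close>, so the vertex set is unchanged.\<close>

lemma square_frame_rotate:
  assumes "square_frame d I p S a b c P" "c \<notin> S"
  shows "square_frame d I (p(c := p b + p c - p a)) S b a c P"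
proof -
  note sq = square_frameD[OF assms(1)]
  have "p ` I = insert (p c) (p ` (I - {c}))" "(p(c := p b + p c - p a)) ` I = insert (p b + p c - p a) (p ` (I - {c}))"
    using sq(5) by auto
  then show ?thesis
    unfolding square_frame_def using square_frame_exchange(2)[OF assms] sq by (auto simp: insert_commute)
qed

lemma square_frame_swap: "square_frame d I p S a b c P \<Longrightarrow> square_frame d I p S a c b P"
  unfolding square_frame_def by (auto simp: add.commute)

lemma square_frame_reindex:
  assumes "square_frame d I p S (\<pi> a) (\<pi> b) (\<pi> c) P" "bij_betw \<pi> J I" "{a, b, c} \<subseteq> J"
  shows "square_frame d J (p \<circ> \<pi>) {j\<in>J. \<pi> j \<in> S} a b c P"
proof -
  note sq = square_frameD[OF assms(1)]
  have "(p \<circ> \<pi>) ` J = p ` I" using assms(2) by (auto simp: bij_betw_def)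
  then show ?thesis unfolding square_frame_def using frame_reindex[OF sq(1) assms(2)] sq assms(3) by auto
qed

section \<open>Polytopes over a unit square\<close>

lemma affine_hull_image_linear:
  assumes "linear f"
  shows "f ` (affine hull S) = affine hull (f ` S)"
proof
  have "affine {x. f x \<in> affine hull (f ` S)}"
    unfolding affine_def[of "{x. f x \<in> affine hull (f ` S)}"]
    by (auto simp: linear_add[OF assms] linear_scale[OF assms] intro: mem_affine[OF affine_affine_hull])
  moreover have "S \<subseteq> {x. f x \<in> affine hull (f ` S)}" by (auto intro: hull_inc)
  ultimately have "affine hull S \<subseteq> {x. f x \<in> affine hull (f ` S)}" by (simp add: hull_minimal)
  then show "f ` (affine hull S) \<subseteq> affine hull (f ` S)" by blast
  have "u *\<^sub>R f x + v *\<^sub>R f y \<in> f ` (affine hull S)" if "x \<in> affine hull S" "y \<in> affine hull S" "u + v = 1" for x y u v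
  proof (rule image_eqI[of _ _ "u *\<^sub>R x + v *\<^sub>R y"])
    show "u *\<^sub>R f x + v *\<^sub>R f y = f (u *\<^sub>R x + v *\<^sub>R y)"
      by (simp add: linear_add[OF assms] linear_scale[OF assms])
  qed (rule mem_affine[OF affine_affine_hull that])
  then have "affine (f ` (affine hull S))" unfolding affine_def[of "f ` (affine hull S)"] by blast
  moreover have "f ` S \<subseteq> f ` (affine hull S)" by (intro image_mono hull_subset)
  ultimately show "affine hull (f ` S) \<subseteq> f ` (affine hull S)" by (simp add: hull_minimal)
qed

text \<open>The linear map sending \<open>p i\<close> to \<open>p' i\<close> respects heights, and
  by \<open>frame_Zd_iff\<close> it respects the lattice, since membership depends on the
  coefficients and \<open>S\<close> alone. Conjugation with the lift by \<open>evec (d + 1)\<close>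
  gives the affine map.\<close>

lemma square_frame_equiv:
  assumes "square_frame d I p S a b c P" "square_frame d I p' S a b c P'"
  shows "unimod_equiv d P d P'"
proof -
  note sq = square_frameD[OF assms(1)] and sq' = square_frameD[OF assms(2)]
  note fr = frameD[OF sq(1)] and fr' = frameD[OF sq'(1)]
  note im = indep_family_image[OF fr(1)]
  let ?e = "evec (d + 1)"
  obtain f where f: "linear f" "\<forall>v\<in>p ` I. f v = (p' \<circ> the_inv_into I p) v"
    using linear_independent_extend[OF im(2), of "p' \<circ> the_inv_into I p"] by blast
  have fp: "f (p i) = p' i" if "i \<in> I" for i using f(2) that by (simp add: the_inv_into_f_f[OF im(1)])
  have fsum: "f (\<Sum>i\<in>I. r i *\<^sub>R p i) = (\<Sum>i\<in>I. r i *\<^sub>R p' i)" for r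
    by (simp add: linear_sum[OF f(1)] linear_scale[OF f(1)] fp)
  have fZ: "f z \<in> Zd (d + 1) \<longleftrightarrow> z \<in> Zd (d + 1)" and fht: "ht d (f z) = ht d z" if zR: "z \<in> Rd (d + 1)" for z
  proof -
    obtain r where r: "z = (\<Sum>i\<in>I. r i *\<^sub>R p i)" using frame_coeffs[OF sq(1) zR] .
    show "f z \<in> Zd (d + 1) \<longleftrightarrow> z \<in> Zd (d + 1)"
      unfolding r fsum frame_Zd_iff[OF sq(1)] frame_Zd_iff[OF sq'(1)] ..
    show "ht d (f z) = ht d z" unfolding r fsum frame_height[OF sq(1)] frame_height[OF sq'(1)] ..
  qed
  have finj: "y = z" if yz: "y \<in> Rd (d + 1)" "z \<in> Rd (d + 1)" "f y = f z" for y z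
  proof -
    obtain r where r: "y = (\<Sum>i\<in>I. r i *\<^sub>R p i)" using frame_coeffs[OF sq(1) yz(1)] .
    obtain s where s: "z = (\<Sum>i\<in>I. s i *\<^sub>R p i)" using frame_coeffs[OF sq(1) yz(2)] .
    have "r i = s i" if "i \<in> I" for i
      by (rule indep_familyD[OF fr'(1) _ that]) (use yz(3) in \<open>simp only: r s fsum\<close>)
    then show ?thesis unfolding r s by (intro sum.cong) auto
  qed
  have flift: "f ` lift1 d P = lift1 d P'"
  proof -
    have "f (p b + p c - p a) = p' b + p' c - p' a"
      using sq(3-5) by (simp add: linear_add[OF f(1)] linear_diff[OF f(1)] fp)
    moreover have "f ` p ` I = p' ` I" using fp by (auto simp: image_image)
    ultimately show ?thesis unfolding sq(9) sq'(9) convex_hull_linear_image[OF f(1)] by simp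
  qed
  define g where "g x = f (?e + x) - ?e" for x
  have aff: "f ` (affine hull lift1 d P) = affine hull lift1 d P'"
    unfolding flift[symmetric] by (rule affine_hull_image_linear[OF f(1)])
  have gaff: "g ` (affine hull P) = affine hull P'"
  proof -
    have "(+) ?e ` g ` (affine hull P) = f ` (affine hull lift1 d P)"
      unfolding lift1_eq affine_hull_translation by (simp add: g_def image_image)
    also have "\<dots> = (+) ?e ` (affine hull P')" unfolding aff unfolding lift1_eq affine_hull_translation ..
    finally show ?thesis by (metis translation_invert)
  qed
  have gP: "g ` P = P'"
  proof -
    have "(+) ?e ` g ` P = f ` lift1 d P" unfolding lift1_eq by (simp add: g_def image_image)
    also have "\<dots> = (+) ?e ` P'" unfolding flift unfolding lift1_eq ..
    finally show ?thesis by (metis translation_invert)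
  qed
  have affR: "affine hull Q \<subseteq> Rd d" if "Q \<subseteq> Rd d" for Q
    using that subspace_imp_affine[OF subspace_Rd] by (rule hull_minimal)
  have eR: "?e + x \<in> Rd (d + 1)" if "x \<in> Rd d" for x using that by (auto simp: Rd_iff lookup_add)
  have Ze: "x \<in> Zd d \<longleftrightarrow> ?e + x \<in> Zd (d + 1)" if "x \<in> Rd d" for x
  proof -
    have "Poly_Mapping.lookup (?e + x) i \<in> \<int> \<longleftrightarrow> Poly_Mapping.lookup x i \<in> \<int>" for i
      using that by (auto simp: lookup_add Rd_iff)
    then show ?thesis using that eR[OF that] by (simp add: Zd_def)
  qed
  have bij: "bij_betw g (Zd d \<inter> affine hull P) (Zd d \<inter> affine hull P')"
    unfolding bij_betw_def
  proof
    show "inj_on g (Zd d \<inter> affine hull P)"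
    proof (rule inj_onI)
      fix x y assume "x \<in> Zd d \<inter> affine hull P" "y \<in> Zd d \<inter> affine hull P" "g x = g y"
      then have "x \<in> Rd d" "y \<in> Rd d" "f (?e + x) = f (?e + y)" using affR[OF sq(2)] by (auto simp: g_def)
      then have "?e + x = ?e + y" by (intro finj[OF eR eR])
      then show "x = y" by simp
    qed
    have gZ: "g x \<in> Zd d \<longleftrightarrow> x \<in> Zd d" if x: "x \<in> affine hull P" for x
    proof -
      have xR: "x \<in> Rd d" using x affR[OF sq(2)] by blast
      have "g x \<in> affine hull P'" using x gaff by blast
      then have gR: "g x \<in> Rd d" using affR[OF sq'(2)] by blast
      have "g x \<in> Zd d \<longleftrightarrow> ?e + g x \<in> Zd (d + 1)" by (rule Ze[OF gR])
      also have "\<dots> \<longleftrightarrow> x \<in> Zd d" using fZ[OF eR[OF xR]] Ze[OF xR] by (simp add: g_def)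
      finally show ?thesis .
    qed
    show "g ` (Zd d \<inter> affine hull P) = Zd d \<inter> affine hull P'"
    proof (intro equalityI subsetI)
      fix y assume "y \<in> g ` (Zd d \<inter> affine hull P)"
      then obtain x where "x \<in> Zd d" "x \<in> affine hull P" "y = g x" by blast
      then show "y \<in> Zd d \<inter> affine hull P'" using gZ[of x] gaff by blast
    next
      fix y assume y: "y \<in> Zd d \<inter> affine hull P'"
      then obtain x where "x \<in> affine hull P" "y = g x" using gaff by blast
      then show "y \<in> g ` (Zd d \<inter> affine hull P)" using gZ[of x] y by blast
    qed
  qed
  have "affine_map_on (affine hull P) g"
    unfolding affine_map_on_def
  proof (intro ballI allI)
    fix x y and t :: real
    have "?e + ((1 - t) *\<^sub>R x + t *\<^sub>R y) = (1 - t) *\<^sub>R (?e + x) + t *\<^sub>R (?e + y)"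
      by (simp add: algebra_simps)
    then have "f (?e + ((1 - t) *\<^sub>R x + t *\<^sub>R y)) = (1 - t) *\<^sub>R f (?e + x) + t *\<^sub>R f (?e + y)"
      by (simp add: linear_add[OF f(1)] linear_scale[OF f(1)])
    then show "g ((1 - t) *\<^sub>R x + t *\<^sub>R y) = (1 - t) *\<^sub>R g x + t *\<^sub>R g y"
      by (simp add: g_def algebra_simps)
  qed
  then show ?thesis unfolding unimod_equiv_def using gaff gP bij by blast
qed

section \<open>Boxes, \<open>delta\<close> and lattice points of a square frame\<close>

lemma frame_box:
  assumes fr0: "frame d I p S" and N: "N \<subseteq> I"
  shows "half_open_box I p N \<inter> Zd (d + 1) =
    {\<Sum>i\<in>I. (if i \<in> N then 1 else 0) *\<^sub>R p i, \<Sum>i\<in>I. (if i \<in> S then 1/2 else if i \<in> N then 1 else 0) *\<^sub>R p i}"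
    (is "_ = {?u, ?v}")
proof
  show "{?u, ?v} \<subseteq> half_open_box I p N \<inter> Zd (d + 1)"
  proof -
    have "?u \<in> half_open_box I p N"
      unfolding half_open_box_def by (intro CollectI exI[of _ "\<lambda>i. if i \<in> N then 1 else 0"]) auto
    moreover have "?v \<in> half_open_box I p N"
      unfolding half_open_box_def
      by (intro CollectI exI[of _ "\<lambda>i. if i \<in> S then 1/2 else if i \<in> N then 1 else 0"]) auto
    moreover have "?u \<in> Zd (d + 1)" "?v \<in> Zd (d + 1)"
      unfolding frame_Zd_iff[OF fr0] by (auto simp: half_indicator_def)
    ultimately show ?thesis by blast
  qed
  show "half_open_box I p N \<inter> Zd (d + 1) \<subseteq> {?u, ?v}"
  proof
    fix z assume z: "z \<in> half_open_box I p N \<inter> Zd (d + 1)"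
    then obtain r where r: "z = (\<Sum>i\<in>I. r i *\<^sub>R p i)" and
      b: "\<And>i. i \<in> I \<Longrightarrow> if i \<in> N then 0 < r i \<and> r i \<le> 1 else 0 \<le> r i \<and> r i < 1"
      unfolding half_open_box_def by blast
    have int: "r i = (if i \<in> N then 1 else 0)" if "i \<in> I" "r i \<in> \<int>" for i
      using b[OF that(1)] that(2) by (auto elim!: Ints_cases split: if_splits)
    have half: "r i = 1 / 2" if i: "i \<in> I" "r i - 1 / 2 \<in> \<int>" for i
    proof -
      obtain k where k: "r i - 1 / 2 = of_int k" using i(2) by (elim Ints_cases)
      have "0 \<le> r i" "r i \<le> 1" using b[OF i(1)] by (auto split: if_splits)
      then have "k = 0" using k by linarith
      then show ?thesis using k by simp
    qed
    \<comment> \<open>One point per coset: the coefficients are fixed modulo 1, and the half-open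
      intervals leave a single choice for each.\<close>
    have "(\<forall>i\<in>I. r i \<in> \<int>) \<or> (\<forall>i\<in>I. r i - half_indicator S i \<in> \<int>)"
      using z unfolding r frame_Zd_iff[OF fr0, symmetric] by blast
    then show "z \<in> {?u, ?v}"
    proof
      assume "\<forall>i\<in>I. r i \<in> \<int>"
      then have "z = ?u" unfolding r using int by (intro sum.cong) auto
      then show ?thesis by simp
    next
      assume h: "\<forall>i\<in>I. r i - half_indicator S i \<in> \<int>"
      have "r i = (if i \<in> S then 1/2 else if i \<in> N then 1 else 0)" if "i \<in> I" for i
        using h[rule_format, OF that] half[OF that] int[OF that] by (auto simp: half_indicator_def)
      then have "z = ?v" unfolding r by (intro sum.cong) auto
      then show ?thesis by simp
    qed
  qed
qed

lemma height_series_pair: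
  assumes "u \<noteq> v" "h u = real m" "h v = real n"
  shows "height_series h {u, v} = fps_X ^ m + fps_X ^ n"
proof (rule fps_ext)
  fix k
  have "{z \<in> {u, v}. h z = real k} = (if k = m then {u} else {}) \<union> (if k = n then {v} else {})"
    using assms by auto
  moreover have "card ((if k = m then {u} else {}) \<union> (if k = n then {v} else {})) = (if k = m then 1 else 0) + (if k = n then 1 else 0)"
    using assms(1) by auto
  ultimately show "fps_nth (height_series h {u, v}) k = fps_nth (fps_X ^ m + fps_X ^ n) k"
    by (simp add: height_series_def fps_X_power_nth)
qed

lemma frame_box_series:
  assumes fr0: "frame d I p S" and N: "N \<subseteq> I" and S: "S \<noteq> {}"
  shows "height_series (ht d) (half_open_box I p N \<inter> Zd (d + 1)) =
    fps_X ^ card N + fps_X ^ (card S div 2 + card (N - S))"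
  unfolding frame_box[OF fr0 N]
proof (rule height_series_pair)
  note fr = frameD[OF fr0]
  have sub: "(\<Sum>i\<in>I. if i \<in> A then 1 else 0) = real (card A)" if "A \<subseteq> I" for A
    using fr(2) that by (simp add: sum.If_cases Int_absorb1)
  show "(\<Sum>i\<in>I. (if i \<in> N then 1 else 0) *\<^sub>R p i) \<noteq> (\<Sum>i\<in>I. (if i \<in> S then 1/2 else if i \<in> N then 1 else 0) *\<^sub>R p i)"
  proof
    assume eq: "(\<Sum>i\<in>I. (if i \<in> N then 1 else 0) *\<^sub>R p i) = (\<Sum>i\<in>I. (if i \<in> S then 1/2 else if i \<in> N then 1 else 0) *\<^sub>R p i)"
    obtain s where s: "s \<in> S" "s \<in> I" using S fr(4) by blast
    show False using indep_familyD[OF fr(1) eq s(2)] s(1) by (auto split: if_splits)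
  qed
  show "ht d (\<Sum>i\<in>I. (if i \<in> N then 1 else 0) *\<^sub>R p i) = real (card N)"
    unfolding frame_height[OF fr0] by (rule sub[OF N])
  have "(\<Sum>i\<in>I. if i \<in> S then 1/2 else if i \<in> N then 1 else 0) = (\<Sum>i\<in>I. half_indicator S i + (if i \<in> N - S then 1 else 0))"
    by (intro sum.cong) (auto simp: half_indicator_def)
  also have "\<dots> = real (card S) / 2 + real (card (N - S))"
    unfolding sum.distrib sum_half_indicator[OF fr(2,4)] using sub[of "N - S"] N by auto
  also have "\<dots> = real (card S div 2 + card (N - S))"
    using frame_card_even[OF fr0] by (auto elim!: evenE)
  finally show "ht d (\<Sum>i\<in>I. (if i \<in> S then 1/2 else if i \<in> N then 1 else 0) *\<^sub>R p i) = real (card S div 2 + card (N - S))"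
    unfolding frame_height[OF fr0] .
qed

lemma square_exchange_sum:
  fixes p :: "'i \<Rightarrow> vect"
  assumes "finite I" "{a, b, c} \<subseteq> I" "a \<noteq> b" "a \<noteq> c" "b \<noteq> c"
  shows "(\<Sum>j\<in>I. s j *\<^sub>R (p(a := p b + p c - p a)) j) =
    (\<Sum>j\<in>I. (if j = a then - s a else if j = b \<or> j = c then s j + s a else s j) *\<^sub>R p j)"
proof -
  have "(\<Sum>j\<in>I. s j *\<^sub>R (p(a := p b + p c - p a)) j) =
    (\<Sum>j\<in>I. s j *\<^sub>R p j + (if j = a then s a *\<^sub>R (p b + p c - p a) - s a *\<^sub>R p a else 0))"
    by (intro sum.cong) auto
  also have "\<dots> = (\<Sum>j\<in>I. s j *\<^sub>R p j) + (s a *\<^sub>R (p b + p c - p a) - s a *\<^sub>R p a)"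
    using assms(1,2) by (simp add: sum.distrib)
  also have "\<dots> = (\<Sum>j\<in>I. s j *\<^sub>R p j + (if j = b then s a *\<^sub>R p b else 0) + (if j = c then s a *\<^sub>R p c else 0)
      - (if j = a then s a *\<^sub>R p a + s a *\<^sub>R p a else 0))"
    using assms(1,2) by (simp add: sum.distrib sum_subtractf scaleR_right_distrib scaleR_right_diff_distrib)
  also have "\<dots> = (\<Sum>j\<in>I. (if j = a then - s a else if j = b \<or> j = c then s j + s a else s j) *\<^sub>R p j)"
    using assms(3-5) by (intro sum.cong) (auto simp: scaleR_left_distrib)
  finally show ?thesis .
qed

text \<open>The square is cut along the diagonal from \<open>p b\<close> to \<open>p c\<close>. Once
  the opposite vertex is eliminated by the relation, the sign of the coefficient at
  \<open>p a\<close> alone decides the side. The diagonal goes to the first cell, hence the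
  strictness at \<open>a\<close> in the second.\<close>

lemma square_frame_partition:
  assumes "square_frame d I p S a b c P"
  defines "X \<equiv> insert (p b + p c - p a) (p ` I)" and "p' \<equiv> p(a := p b + p c - p a)"
  shows "finite X" "\<And>x. x \<in> X \<Longrightarrow> ht d x = 1" "X \<subseteq> Zd (d + 1)" "p b + p c - p a \<notin> p ` I"
    "half_open_cone I p N \<subseteq> poscone X" "half_open_cone I p' N \<subseteq> poscone X"
    "z \<in> poscone X \<Longrightarrow> z \<in> half_open_cone I p' {a} \<longleftrightarrow> z \<notin> half_open_cone I p {}"
proof -
  note sq = square_frameD[OF assms(1)]
  note fr = frameD[OF sq(1)]
  have abc: "{a, b, c} \<subseteq> I" using sq by simp
  note xc = square_coeffs[OF fr(2) abc sq(6-8), of p]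
  show finX: "finite X" using fr(2) by (simp add: X_def)
  show "ht d x = 1" if "x \<in> X" for x
    using that fr(7) sq(3-5) by (auto simp: X_def lookup_add lookup_minus)
  show "X \<subseteq> Zd (d + 1)" using fr(6) sq(3-5) by (auto simp: X_def intro!: Zd_add Zd_diff)
  show xn: "p b + p c - p a \<notin> p ` I"
  proof
    assume "p b + p c - p a \<in> p ` I"
    then obtain i where i: "i \<in> I" "p b + p c - p a = p i" by auto
    have "(\<Sum>j\<in>I. (if j = i then 1 else 0) *\<^sub>R p j) = (\<Sum>j\<in>I. if j = i then p i else 0)" by (intro sum.cong) auto
    also have "\<dots> = p i" using i(1) fr(2) by simp
    finally have eq: "(\<Sum>j\<in>I. of_int (if j = a then -1 else if j = b \<or> j = c then 1 else 0) *\<^sub>R p j) =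
      (\<Sum>j\<in>I. (if j = i then 1 else 0) *\<^sub>R p j)" using xc i(2) by simp
    show False using indep_familyD[OF fr(1) eq sq(3)] by (auto split: if_splits)
  qed
  have fr': "indep_family I p'" using frameD(1)[OF square_frame_exchange(1)[OF assms(1)]] by (simp add: p'_def)
  show sub: "half_open_cone I p N \<subseteq> poscone X"
    by (rule half_open_cone_subset_poscone[OF _ finX indep_family_image(1)[OF fr(1)] fr(2)]) (auto simp: X_def)
  show sub': "half_open_cone I p' N \<subseteq> poscone X"
    by (rule half_open_cone_subset_poscone[OF _ finX indep_family_image(1)[OF fr'] fr(2)])
       (auto simp: X_def p'_def)
  assume "z \<in> poscone X"
  then obtain m where m: "z = (\<Sum>x\<in>X. m x *\<^sub>R x)" "\<forall>x\<in>X. 0 \<le> m x" by (auto simp: poscone_def)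
  define t where "t = m (p b + p c - p a)"
  define r where "r j = m (p j) + of_int (if j = a then -1 else if j = b \<or> j = c then 1 else 0) * t" for j
  have t0: "0 \<le> t" using m(2) by (simp add: t_def X_def)
  have m0: "0 \<le> m (p j)" if "j \<in> I" for j using m(2) that by (simp add: X_def)
  have z: "z = (\<Sum>j\<in>I. r j *\<^sub>R p j)"
  proof -
    have "z = t *\<^sub>R (p b + p c - p a) + (\<Sum>x\<in>p ` I. m x *\<^sub>R x)"
      unfolding m(1) X_def t_def using xn fr(2) by simp
    also have "(\<Sum>x\<in>p ` I. m x *\<^sub>R x) = (\<Sum>j\<in>I. m (p j) *\<^sub>R p j)"
      by (simp add: sum.reindex[OF indep_family_image(1)[OF fr(1)]])
    finally show ?thesis
      unfolding r_def xc by (simp only: scaleR_sum_right scaleR_left_distrib sum.distrib scaleR_scaleR mult.commute add.commute)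
  qed
  have cone: "z \<in> half_open_cone I p {} \<longleftrightarrow> 0 \<le> r a"
  proof
    assume "z \<in> half_open_cone I p {}"
    then obtain s where s: "z = (\<Sum>j\<in>I. s j *\<^sub>R p j)" "\<forall>j\<in>I. 0 \<le> s j" by (auto simp: half_open_cone_def)
    show "0 \<le> r a" using indep_familyD[OF fr(1) s(1)[unfolded z] sq(3)] s(2) sq(3) by simp
  next
    assume ra: "0 \<le> r a"
    have "0 \<le> r j" if "j \<in> I" for j using ra m0[OF that] t0 by (cases "j = a") (auto simp: r_def)
    then show "z \<in> half_open_cone I p {}" unfolding half_open_cone_def z by (intro CollectI exI[of _ r]) auto
  qed
  have cone': "z \<in> half_open_cone I p' {a} \<longleftrightarrow> r a < 0"
  proof
    assume "z \<in> half_open_cone I p' {a}"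
    then obtain s where s: "z = (\<Sum>j\<in>I. s j *\<^sub>R p' j)" "0 < s a" using sq(3) unfolding half_open_cone_def by blast
    show "r a < 0"
      using indep_familyD[OF fr(1) s(1)[unfolded z p'_def square_exchange_sum[OF fr(2) abc sq(6-8)]] sq(3)] s(2) by simp
  next
    assume ra: "r a < 0"
    define s where "s j = (if j = a then - r a else if j = b \<or> j = c then r j + r a else r j)" for j
    have "(\<Sum>j\<in>I. s j *\<^sub>R p' j) = z"
      unfolding p'_def square_exchange_sum[OF fr(2) abc sq(6-8)] z using sq(6-8) by (intro sum.cong) (auto simp: s_def)
    moreover have "0 \<le> s j \<and> (j \<in> {a} \<longrightarrow> 0 < s j)" if "j \<in> I" for j
      using ra m0[OF that] m0[OF sq(3)] t0 sq(6-8) by (auto simp: s_def r_def)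
    ultimately show "z \<in> half_open_cone I p' {a}" unfolding half_open_cone_def by (intro CollectI exI[of _ s]) auto
  qed
  show "z \<in> half_open_cone I p' {a} \<longleftrightarrow> z \<notin> half_open_cone I p {}" unfolding cone cone' by auto
qed

text \<open>The set \<open>S\<close> after replacing \<open>p a\<close> by the opposite vertex of the parallelogram.\<close>

definition opposite_half :: "'i set \<Rightarrow> 'i \<Rightarrow> 'i \<Rightarrow> 'i \<Rightarrow> 'i set" where
  "opposite_half S a b c = (if a \<in> S then (S - {b, c}) \<union> ({b, c} - S) else S)"

text \<open>The closed cell contributes the origin and the half-sum of \<open>S\<close>. The other
  cell, open at \<open>a\<close>, contributes its generator at \<open>a\<close> and the half-sum of
  the exchanged set, raised by 1 if that set omits \<open>a\<close>.\<close>

lemma square_frame_delta: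
  assumes "square_frame d I p S a b c P" "S \<noteq> {}"
  shows "delta d P = 1 + fps_X + fps_X ^ (card S div 2) +
    fps_X ^ (card (opposite_half S a b c) div 2 + (if a \<in> S then 0 else 1))"
proof -
  note sq = square_frameD[OF assms(1)]
  note part = square_frame_partition[OF assms(1)]
  let ?S' = "opposite_half S a b c"
  let ?p' = "p(a := p b + p c - p a)"
  have fr': "frame d I ?p' ?S'" using square_frame_exchange(1)[OF assms(1)] by (simp add: opposite_half_def)
  have ne': "?S' \<noteq> {}" using assms(2) sq(6-8) by (auto simp: opposite_half_def)
  let ?P = "\<lambda>k. if k then ?p' else p" and ?N = "\<lambda>k. if k then {a} else {}"
  have "delta d P = (\<Sum>k\<in>UNIV. height_series (ht d) (half_open_box I (?P k) (?N k) \<inter> Zd (d + 1)))"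
  proof (rule delta_cells[OF part(1,2) sq(9,2)])
    show "half_open_cone I (?P k) (?N k) \<subseteq> poscone (insert (p b + p c - p a) (p ` I))" for k
      using part(5,6) by simp
    show "\<exists>!k. k \<in> UNIV \<and> z \<in> half_open_cone I (?P k) (?N k)"
      if "z \<in> poscone (insert (p b + p c - p a) (p ` I))" for z
    proof (rule ex1I[of _ "z \<in> half_open_cone I ?p' {a}"])
      show "(z \<in> half_open_cone I ?p' {a}) \<in> UNIV \<and> z \<in> half_open_cone I (?P (z \<in> half_open_cone I ?p' {a})) (?N (z \<in> half_open_cone I ?p' {a}))"
        using part(7)[OF that] by simp
      show "k = (z \<in> half_open_cone I ?p' {a})" if "k \<in> UNIV \<and> z \<in> half_open_cone I (?P k) (?N k)" for k
        using that part(7)[OF \<open>z \<in> poscone _\<close>] by (cases k) auto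
    qed
    show "indep_family I (?P k)" for k using frameD(1)[OF fr'] frameD(1)[OF sq(1)] by simp
    show "finite (UNIV :: bool set)" by (rule finite)
    show "card I = d + 1" using frameD(3)[OF fr'] .
    show "?P k i \<in> Zd (d + 1) \<and> ht d (?P k i) = 1" if "i \<in> I" for k i
      using frameD(6,7)[OF fr' that] frameD(6,7)[OF sq(1) that] by (cases k) auto
  qed
  also have "\<dots> = height_series (ht d) (half_open_box I p {} \<inter> Zd (d + 1)) + height_series (ht d) (half_open_box I ?p' {a} \<inter> Zd (d + 1))"
    by (simp add: UNIV_bool)
  also have "\<dots> = (fps_X ^ card ({}::'a set) + fps_X ^ (card S div 2 + card ({} - S))) + (fps_X ^ card {a} + fps_X ^ (card ?S' div 2 + card ({a} - ?S')))"
    using frame_box_series[OF sq(1) _ assms(2), of "{}"] frame_box_series[OF fr' _ ne', of "{a}"] sq(3) by simp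
  also have "card ({a} - ?S') = (if a \<in> S then 0 else 1)"
    using sq(6-8) by (auto simp: opposite_half_def insert_Diff_if)
  finally show ?thesis by (simp add: algebra_simps)
qed

text \<open>In the half coset nonnegative coefficients are at least 1/2 on \<open>S\<close>, so the
  height is at least 2. Height 1 leaves only integral coefficients, that is, a generator.\<close>

lemma frame_cone_height_1:
  assumes fr0: "frame d I p S" and S: "4 \<le> card S"
    and z: "z \<in> half_open_cone I p N" "z \<in> Zd (d + 1)" "ht d z = 1"
  shows "z \<in> p ` I"
proof -
  note fr = frameD[OF fr0]
  obtain r where r: "z = (\<Sum>i\<in>I. r i *\<^sub>R p i)" and nn: "\<And>i. i \<in> I \<Longrightarrow> 0 \<le> r i"
    using z(1) by (auto simp: half_open_cone_def)
  have s: "(\<Sum>i\<in>I. r i) = 1" using z(3) unfolding r frame_height[OF fr0] .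
  have "(\<forall>i\<in>I. r i \<in> \<int>) \<or> (\<forall>i\<in>I. r i - half_indicator S i \<in> \<int>)"
    using z(2) unfolding r frame_Zd_iff[OF fr0] .
  then show ?thesis
  proof
    assume int: "\<forall>i\<in>I. r i \<in> \<int>"
    obtain b where b: "b \<in> I" "r b = 1" "\<And>a. a \<in> I \<Longrightarrow> a \<noteq> b \<Longrightarrow> r a = 0"
      by (rule nonneg_int_sum_eq_1[OF fr(2) _ nn s]) (use int in auto)
    have "z = (\<Sum>i\<in>I. if i = b then p b else 0)" unfolding r using b by (intro sum.cong) auto
    then show ?thesis using b(1) fr(2) by simp
  next
    assume h: "\<forall>i\<in>I. r i - half_indicator S i \<in> \<int>"
    have ge: "half_indicator S i \<le> r i" if i: "i \<in> I" for i
    proof -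
      obtain k where k: "r i - half_indicator S i = of_int k" using h i by (metis Ints_cases)
      have "0 \<le> r i" by (rule nn[OF i])
      then have "- 1 < real_of_int k" using k by (auto simp: half_indicator_def split: if_splits)
      then have "0 \<le> k" by linarith
      then have "0 \<le> real_of_int k" by simp
      then show ?thesis using k by linarith
    qed
    have "real (card S) / 2 \<le> 1"
      unfolding s[symmetric] sum_half_indicator[OF fr(2,4), symmetric] by (rule sum_mono[OF ge])
    then show ?thesis using S by simp
  qed
qed

text \<open>The two cells see the same lattice through different half sets, so both sizes have to be
  bounded.\<close>

lemma square_frame_lattice_points:
  assumes "square_frame d I p S a b c P" "4 \<le> card S" "4 \<le> card (opposite_half S a b c)"
  shows "lift1 d P \<inter> Zd (d + 1) = insert (p b + p c - p a) (p ` I)"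
proof -
  note sq = square_frameD[OF assms(1)]
  note part = square_frame_partition[OF assms(1)]
  let ?X = "insert (p b + p c - p a) (p ` I)"
  have fr': "frame d I (p(a := p b + p c - p a)) (opposite_half S a b c)"
    using square_frame_exchange(1)[OF assms(1)] by (simp add: opposite_half_def)
  have "z \<in> ?X" if z: "z \<in> convex hull ?X" "z \<in> Zd (d + 1)" for z
  proof -
    have zc: "z \<in> poscone ?X" "ht d z = 1" using poscone_slice_iff[OF part(1,2), of 1 z] z(1) by auto
    then consider "z \<in> half_open_cone I p {}" | "z \<in> half_open_cone I (p(a := p b + p c - p a)) {a}"
      using part(7) by blast
    then show ?thesis
    proof cases
      case 1
      then show ?thesis using frame_cone_height_1[OF sq(1) assms(2) _ z(2) zc(2)] by blast
    next
      case 2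
      then have "z \<in> (p(a := p b + p c - p a)) ` I" using frame_cone_height_1[OF fr' assms(3) _ z(2) zc(2)] by blast
      then show ?thesis by auto
    qed
  qed
  then show ?thesis unfolding sq(9) using part(3) hull_subset[of ?X convex] by blast
qed

section \<open>From a nonspanning polytope to a square frame\<close>

lemma frame_base_int_span:
  assumes "frame d I p S" "i \<in> I"
  shows "p i \<in> int_span I p"
proof -
  have "(\<Sum>j\<in>I. (if j = i then 1 else 0) *\<^sub>R p j) \<in> int_span I p" by (rule int_spanI) auto
  also have "(\<Sum>j\<in>I. (if j = i then 1 else 0) *\<^sub>R p j) = (\<Sum>j\<in>I. if j = i then p i else 0)" by (intro sum.cong) auto
  also have "\<dots> = p i" using assms frameD(2)[OF assms(1)] by simp
  finally show ?thesis .
qed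

lemma half_not_Ints: "(1 / 2 :: real) \<notin> \<int>"
proof
  assume "(1 / 2 :: real) \<in> \<int>"
  then obtain k where "(1 / 2 :: real) = of_int k" by (elim Ints_cases)
  then have "real_of_int (2 * k) = 1" by simp
  then have "2 * k = 1" by linarith
  then show False by presburger
qed

text \<open>\<open>card S\<close> is even and nonzero. If it were 2, the half-sum of
  \<open>S\<close> would be the midpoint of two vertices, a lattice point of the lifted polytope
  missing from the given list.\<close>

lemma square_frame_card_ge_4:
  assumes "square_frame d I p S a b c P" "S \<noteq> {}"
    "lift1 d P \<inter> Zd (d + 1) = insert (p b + p c - p a) (p ` I)"
  shows "4 \<le> card S"
proof -
  note sq = square_frameD[OF assms(1)]
  note fr = frameD[OF sq(1)]
  have "card S \<noteq> 2"
  proof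
    assume "card S = 2"
    then obtain s t where st: "S = {s, t}" "s \<noteq> t" by (auto simp: card_2_iff)
    then have stI: "s \<in> I" "t \<in> I" using fr(4) by auto
    define y where "y = (\<Sum>i\<in>I. half_indicator S i *\<^sub>R p i)"
    have yZ: "y \<in> Zd (d + 1)" unfolding y_def frame_Zd_iff[OF sq(1)] by simp
    have "y = (\<Sum>i\<in>S. (1/2) *\<^sub>R p i)"
      unfolding y_def using fr(2,4) by (intro sum.mono_neutral_cong_right) (auto simp: half_indicator_def)
    then have "y = (1/2) *\<^sub>R p s + (1/2) *\<^sub>R p t" using st by simp
    also have "\<dots> \<in> convex hull (insert (p b + p c - p a) (p ` I))"
      using stI by (intro convexD[OF convex_convex_hull]) (auto intro!: hull_inc)
    finally have "y \<in> lift1 d P" by (simp only: sq(9))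
    then have "y \<in> insert (p b + p c - p a) (p ` I)" using yZ assms(3) by blast
    moreover have "p b + p c - p a \<in> int_span I p"
    proof -
      have "{a, b, c} \<subseteq> I" using sq(3-5) by simp
      then show ?thesis unfolding square_coeffs[OF fr(2) \<open>{a, b, c} \<subseteq> I\<close> sq(6-8), of p]
        by (intro int_spanI) simp
    qed
    ultimately have "y \<in> int_span I p" using frame_base_int_span[OF sq(1)] by blast
    then obtain r where r: "y = (\<Sum>i\<in>I. r i *\<^sub>R p i)" "\<forall>i\<in>I. r i \<in> \<int>" by (auto simp: int_span_def)
    have "half_indicator S s = r s" by (rule indep_familyD[OF fr(1) _ stI(1)]) (simp only: r(1)[symmetric] y_def)
    then have "1 / 2 = r s" using st by (simp add: half_indicator_def)
    then show False using r(2) stI(1) half_not_Ints by metis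
  qed
  moreover have "card S \<noteq> 0" using assms(2) fr(5) by simp
  ultimately show ?thesis using frame_card_even[OF sq(1)] by presburger
qed

text \<open>A vector \<open>w\<close> outside the index-2 lattice of \<open>B\<close> has its double
  inside, so its coefficients are half-integers; \<open>S\<close> consists of the positions where
  they are not integral.\<close>

lemma classification_square_frame:
  assumes P: "full_lattice_polytope d P" "\<not> is_simplex P" "\<not> spanning d P" "Vol d P \<le> 4"
  obtains B S a b c where "square_frame d B (\<lambda>v. v) S a b c P" "S \<noteq> {}"
    "lift1 d P \<inter> Zd (d + 1) = insert (b + c - a) B"
proof -
  define X where "X = lift1 d P \<inter> Zd (d + 1)"
  obtain B a b c where B: "B \<in> bases X" "a \<in> B" "b \<in> B" "c \<in> B" "a \<noteq> b" "a \<noteq> c" "b \<noteq> c"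
    and Xeq: "X = insert (b + c - a) B" and ne: "int_span B (\<lambda>b. b) \<noteq> Zd (d + 1)" and
    idx: "\<And>z z'. z \<in> Zd (d + 1) - int_span B (\<lambda>b. b) \<Longrightarrow> z' \<in> Zd (d + 1) - int_span B (\<lambda>b. b) \<Longrightarrow> z - z' \<in> int_span B (\<lambda>b. b)"
    by (rule classification_data[OF P, folded X_def]) blast
  note X = lift1_lattice_points[OF P(1), folded X_def]
  note BD = basesD[OF B(1) X(1)]
  have XZ: "X \<subseteq> Zd (d + 1)" by (simp add: X_def)
  have BZ: "v \<in> Zd (d + 1)" if "v \<in> B" for v using that BD(1) XZ by blast
  have ind: "indep_family B (\<lambda>v. v)" by (rule independent_imp_indep_family[OF BD(2,4)])
  have card: "card B = d + 1"
    using independent_Rd_span[of B "d + 1"] BD(1,2) XZ bases_span[OF B(1)] X(4) by (auto simp: Zd_def)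
  have isZ: "int_span B (\<lambda>v. v) \<subseteq> Zd (d + 1)" by (rule int_span_Zd[OF BZ])
  then obtain w where w: "w \<in> Zd (d + 1)" "w \<notin> int_span B (\<lambda>v. v)" using ne by blast
  \<comment> \<open>Two outside vectors differ by an inside one; applied to \<open>w + w\<close> and
    \<open>w\<close>, this would put \<open>w\<close> inside.\<close>
  have w2: "w + w \<in> int_span B (\<lambda>v. v)"
  proof (rule ccontr)
    assume "w + w \<notin> int_span B (\<lambda>v. v)"
    then have "w + w - w \<in> int_span B (\<lambda>v. v)" using w Zd_add[OF w(1) w(1)] by (intro idx) blast+
    then show False using w(2) by simp
  qed
  define \<rho> where "\<rho> = representation B w"
  have "w \<in> span B" using bases_span[OF B(1)] X(4) w(1) by (simp add: Zd_def)
  then have wsum: "w = (\<Sum>v\<in>B. \<rho> v *\<^sub>R v)" using lincomb_representation[OF BD(2,4)] by (simp add: \<rho>_def)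
  obtain n where n: "w + w = (\<Sum>v\<in>B. n v *\<^sub>R v)" "\<forall>v\<in>B. n v \<in> \<int>" using w2 by (auto simp: int_span_def)
  have \<rho>2: "2 * \<rho> v \<in> \<int>" if "v \<in> B" for v
  proof -
    have eq: "(\<Sum>v\<in>B. (2 * \<rho> v) *\<^sub>R v) = (\<Sum>v\<in>B. n v *\<^sub>R v)"
    proof -
      have "(\<Sum>v\<in>B. (2 * \<rho> v) *\<^sub>R v) = (\<Sum>v\<in>B. \<rho> v *\<^sub>R v + \<rho> v *\<^sub>R v)"
        by (intro sum.cong) (simp_all add: scaleR_left_distrib[symmetric])
      also have "\<dots> = w + w" unfolding sum.distrib by (simp only: wsum[symmetric])
      finally show ?thesis using n(1) by simp
    qed
    show ?thesis using indep_familyD[OF ind eq that] n(2) that by simp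
  qed
  define S where "S = {v\<in>B. \<rho> v \<notin> \<int>}"
  have \<rho>S: "\<rho> v - half_indicator S v \<in> \<int>" if v: "v \<in> B" for v
  proof (cases "v \<in> S")
    case True
    obtain k where k: "2 * \<rho> v = of_int k" using \<rho>2[OF v] by (elim Ints_cases)
    have "odd k"
    proof
      assume "even k"
      then obtain l where "k = 2 * l" by (elim evenE)
      then have "\<rho> v = of_int l" using k by simp
      then show False using True by (simp add: S_def)
    qed
    then obtain l where "k = 2 * l + 1" by (elim oddE)
    then have "\<rho> v - half_indicator S v = of_int l" using k True by (simp add: half_indicator_def)
    then show ?thesis by simp
  next
    case False
    then show ?thesis using that by (simp add: half_indicator_def S_def)
  qed
  have "Zd (d + 1) = {\<Sum>v\<in>B. r v *\<^sub>R v | r. (\<forall>v\<in>B. r v \<in> \<int>) \<or> (\<forall>v\<in>B. r v - half_indicator S v \<in> \<int>)}" (is "_ = ?R")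
  proof (intro equalityI subsetI)
    fix z assume z: "z \<in> Zd (d + 1)"
    show "z \<in> ?R"
    proof (cases "z \<in> int_span B (\<lambda>v. v)")
      case True
      then show ?thesis unfolding int_span_def by blast
    next
      case False
      then have "z - w \<in> int_span B (\<lambda>v. v)" using z w by (intro idx) auto
      then obtain s where s: "z - w = (\<Sum>v\<in>B. s v *\<^sub>R v)" "\<forall>v\<in>B. s v \<in> \<int>" by (auto simp: int_span_def)
      have "z = (z - w) + w" by simp
      also have "\<dots> = (\<Sum>v\<in>B. (s v + \<rho> v) *\<^sub>R v)"
        unfolding s(1) by (subst wsum) (simp add: scaleR_left_distrib sum.distrib)
      finally have "z = (\<Sum>v\<in>B. (s v + \<rho> v) *\<^sub>R v)" .
      moreover have "s v + \<rho> v - half_indicator S v \<in> \<int>" if "v \<in> B" for v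
        using Ints_add[OF s(2)[rule_format, OF that] \<rho>S[OF that]] by (simp add: algebra_simps)
      ultimately show ?thesis by (intro CollectI exI[of _ "\<lambda>v. s v + \<rho> v"]) auto
    qed
  next
    fix z assume "z \<in> ?R"
    then obtain r where r: "z = (\<Sum>v\<in>B. r v *\<^sub>R v)" "(\<forall>v\<in>B. r v \<in> \<int>) \<or> (\<forall>v\<in>B. r v - half_indicator S v \<in> \<int>)" by blast
    show "z \<in> Zd (d + 1)"
    proof (cases "\<forall>v\<in>B. r v \<in> \<int>")
      case True
      then show ?thesis unfolding r(1) using BZ by (intro Zd_sum Zd_scale) auto
    next
      case False
      then have h: "\<forall>v\<in>B. r v - half_indicator S v \<in> \<int>" using r(2) by blast
      have "r v - \<rho> v \<in> \<int>" if "v \<in> B" for v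
        using Ints_diff[OF h[rule_format, OF that] \<rho>S[OF that]] by simp
      then have "(\<Sum>v\<in>B. (r v - \<rho> v) *\<^sub>R v) \<in> Zd (d + 1)" using BZ by (intro Zd_sum Zd_scale) auto
      moreover have "(\<Sum>v\<in>B. (r v - \<rho> v) *\<^sub>R v) = z - w"
        unfolding r(1) by (subst wsum) (simp add: scaleR_left_diff_distrib sum_subtractf)
      ultimately show ?thesis using Zd_add[OF _ w(1), of "z - w"] by simp
    qed
  qed
  moreover have "\<forall>v\<in>B. v \<in> Zd (d + 1) \<and> ht d v = 1" using BZ X(2) BD(1) by blast
  ultimately have fr0: "frame d B (\<lambda>v. v) S"
    unfolding frame_def using ind card by (auto simp: S_def)
  then have sq: "square_frame d B (\<lambda>v. v) S a b c P"
    unfolding square_frame_def using B X(3,5) Xeq by auto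
  note fr = frameD[OF fr0]
  have "S \<noteq> {}"
  proof
    assume "S = {}"
    then have "\<forall>v\<in>B. \<rho> v \<in> \<int>" by (auto simp: S_def)
    then show False using w(2) wsum int_spanI[of B \<rho> "\<lambda>v. v"] by simp
  qed
  moreover have "lift1 d P \<inter> Zd (d + 1) = insert (b + c - a) B" using Xeq by (simp only: X_def)
  ultimately show ?thesis using that sq by blast
qed

section \<open>Vertices, spanning and pyramids\<close>

text \<open>\<open>affine_map_on\<close> only speaks about lines. Combinations are built around a
  base point \<open>o'\<close>, where the condition on the sum of the coefficients disappears and
  induction applies.\<close>

lemma affine_map_on_sum:
  assumes f: "affine_map_on A f" and A: "affine A" and I: "finite I" "\<And>i. i \<in> I \<Longrightarrow> y i \<in> A" "(\<Sum>i\<in>I. r i) = 1"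
  shows "(\<Sum>i\<in>I. r i *\<^sub>R y i) \<in> A" "f (\<Sum>i\<in>I. r i *\<^sub>R y i) = (\<Sum>i\<in>I. r i *\<^sub>R f (y i))"
proof -
  have "I \<noteq> {}" using I(3) by auto
  then obtain k where "k \<in> I" by blast
  then obtain o' where o: "o' \<in> A" using I(2) by blast
  have comb: "(1 - t) *\<^sub>R u + t *\<^sub>R v \<in> A" if "u \<in> A" "v \<in> A" for u v and t :: real
    using mem_affine[OF A that, of "1 - t" t] by simp
  have fc: "f ((1 - t) *\<^sub>R u + t *\<^sub>R v) = (1 - t) *\<^sub>R f u + t *\<^sub>R f v" if "u \<in> A" "v \<in> A" for u v t
    using f that unfolding affine_map_on_def by blast
  have "o' + (\<Sum>i\<in>J. r i *\<^sub>R (y i - o')) \<in> A \<and>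
      f (o' + (\<Sum>i\<in>J. r i *\<^sub>R (y i - o'))) = f o' + (\<Sum>i\<in>J. r i *\<^sub>R (f (y i) - f o'))" if "J \<subseteq> I" for J
    using finite_subset[OF that I(1)] that
  proof (induction J rule: finite_induct)
    case empty
    then show ?case using o by simp
  next
    case (insert j J)
    define z where "z = o' + (\<Sum>i\<in>J. r i *\<^sub>R (y i - o'))"
    have z: "z \<in> A" "f z = f o' + (\<Sum>i\<in>J. r i *\<^sub>R (f (y i) - f o'))" using insert unfolding z_def by auto
    have yj: "y j \<in> A" using insert I(2) by blast
    \<comment> \<open>Only steps along lines are available:
      \<open>z + r j *\<^sub>R (y j - o')\<close> is the midpoint of \<open>u\<close> and
      \<open>v\<close>, which lie on lines through \<open>o'\<close>.\<close>
    define u where "u = (1 - 2) *\<^sub>R o' + 2 *\<^sub>R z"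
    define v where "v = (1 - 2 * r j) *\<^sub>R o' + (2 * r j) *\<^sub>R y j"
    have uv: "u \<in> A" "v \<in> A" unfolding u_def v_def by (intro comb o z(1) yj)+
    have fuv: "f u = (1 - 2) *\<^sub>R f o' + 2 *\<^sub>R f z" "f v = (1 - 2 * r j) *\<^sub>R f o' + (2 * r j) *\<^sub>R f (y j)"
      unfolding u_def v_def by (intro fc o z(1) yj)+
    have eq: "o' + (\<Sum>i\<in>insert j J. r i *\<^sub>R (y i - o')) = (1 - 1/2) *\<^sub>R u + (1/2) *\<^sub>R v"
    proof -
      have "o' + (\<Sum>i\<in>insert j J. r i *\<^sub>R (y i - o')) = z + r j *\<^sub>R (y j - o')" using insert by (simp add: z_def algebra_simps)
      also have "\<dots> = (1 - 1/2) *\<^sub>R u + (1/2) *\<^sub>R v"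
        by (rule poly_mapping_eqI) (simp add: u_def v_def lookup_add lookup_minus algebra_simps)
      finally show ?thesis .
    qed
    have "f (o' + (\<Sum>i\<in>insert j J. r i *\<^sub>R (y i - o'))) = (1 - 1/2) *\<^sub>R f u + (1/2) *\<^sub>R f v"
      unfolding eq by (rule fc[OF uv])
    also have "\<dots> = f z + r j *\<^sub>R (f (y j) - f o')"
      unfolding fuv by (rule poly_mapping_eqI) (simp add: lookup_add lookup_minus algebra_simps)
    also have "\<dots> = f o' + (\<Sum>i\<in>insert j J. r i *\<^sub>R (f (y i) - f o'))" using insert z(2) by (simp add: algebra_simps)
    finally show ?case using comb[OF uv, of "1/2"] unfolding eq by simp
  qed
  from this[of I] have *: "o' + (\<Sum>i\<in>I. r i *\<^sub>R (y i - o')) \<in> A"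
      "f (o' + (\<Sum>i\<in>I. r i *\<^sub>R (y i - o'))) = f o' + (\<Sum>i\<in>I. r i *\<^sub>R (f (y i) - f o'))" by auto
  have e: "w + (\<Sum>i\<in>I. r i *\<^sub>R (g i - w)) = (\<Sum>i\<in>I. r i *\<^sub>R g i)" for w :: vect and g
    using I(3) by (simp add: scaleR_right_diff_distrib sum_subtractf scaleR_left.sum[symmetric])
  show "(\<Sum>i\<in>I. r i *\<^sub>R y i) \<in> A" "f (\<Sum>i\<in>I. r i *\<^sub>R y i) = (\<Sum>i\<in>I. r i *\<^sub>R f (y i))"
    using * unfolding e by auto
qed

lemma unlift: "P = (+) (- evec (d + 1)) ` lift1 d P"
  by (auto simp: lift1_eq image_image)

lemma translate_lincomb:
  fixes v :: "'i \<Rightarrow> vect"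
  assumes "(\<Sum>i\<in>I. r i) = 1"
  shows "(\<Sum>i\<in>I. r i *\<^sub>R (- e + v i)) = - e + (\<Sum>i\<in>I. r i *\<^sub>R v i)"
  using assms by (simp add: scaleR_right_distrib scaleR_right_diff_distrib sum.distrib sum_subtractf sum_negf scaleR_left.sum[symmetric])

lemma square_frame_unlift:
  assumes "square_frame d I p S a b c P"
  shows "P = convex hull ((+) (- evec (d + 1)) ` insert (p b + p c - p a) (p ` I))"
proof -
  note sq = square_frameD[OF assms]
  have "P = (+) (- evec (d + 1)) ` (convex hull (insert (p b + p c - p a) (p ` I)))"
    using unlift[of P d] sq(9) by simp
  then show ?thesis by (simp only: convex_hull_translation)
qed

lemma Zd_unlift:
  assumes "z \<in> Zd (d + 1)" "ht d z = 1"
  shows "- evec (d + 1) + z \<in> Zd d"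
  using assms by (auto simp: Zd_iff lookup_add lookup_minus)

lemma square_frame_affine_hull:
  assumes "square_frame d I p S a b c P"
  shows "affine hull P = Rd d" "affine hull P = affine hull ((+) (- evec (d + 1)) ` p ` I)"
proof -
  note sq = square_frameD[OF assms]
  note fr = frameD[OF sq(1)]
  let ?e = "evec (d + 1)"
  have x: "p b + p c - p a \<in> affine hull (p ` I)"
  proof -
    have "1 *\<^sub>R p b + 1 *\<^sub>R p c + (-1) *\<^sub>R p a \<in> affine hull (p ` I)"
      using sq(3-5) by (intro mem_affine_3[OF affine_affine_hull]) (auto intro!: hull_inc)
    then show ?thesis by simp
  qed
  have "affine hull P = (+) (- ?e) ` (affine hull (insert (p b + p c - p a) (p ` I)))"
    by (subst square_frame_unlift[OF assms]) (simp only: affine_hull_convex_hull affine_hull_translation)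
  also have "affine hull (insert (p b + p c - p a) (p ` I)) = affine hull (p ` I)"
    by (rule hull_redundant[OF x])
  finally show aff: "affine hull P = affine hull ((+) (- ?e) ` p ` I)" by (simp only: affine_hull_translation)
  have "affine hull P \<subseteq> Rd d"
    using sq(2) subspace_imp_affine[OF subspace_Rd] by (rule hull_minimal)
  moreover have "y \<in> affine hull P" if y: "y \<in> Rd d" for y
  proof -
    have "?e + y \<in> Rd (d + 1)" using y by (auto simp: Rd_iff lookup_add)
    then obtain r where r: "?e + y = (\<Sum>i\<in>I. r i *\<^sub>R p i)" by (rule frame_coeffs[OF sq(1)])
    have "ht d (?e + y) = 1" using y by (simp add: Rd_iff lookup_add)
    then have s: "(\<Sum>i\<in>I. r i) = 1" unfolding r frame_height[OF sq(1)] .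
    have "(\<Sum>i\<in>I. r i *\<^sub>R p i) = (\<Sum>v\<in>p ` I. r (the_inv_into I p v) *\<^sub>R v)"
      by (simp add: sum.reindex[OF indep_family_image(1)[OF fr(1)]] the_inv_into_f_f[OF indep_family_image(1)[OF fr(1)]])
    moreover have "(\<Sum>v\<in>p ` I. r (the_inv_into I p v)) = 1"
      using s by (simp add: sum.reindex[OF indep_family_image(1)[OF fr(1)]] the_inv_into_f_f[OF indep_family_image(1)[OF fr(1)]])
    ultimately have "?e + y \<in> affine hull (p ` I)"
      unfolding affine_hull_finite[OF finite_imageI[OF fr(2)]] using r by auto
    then have "- ?e + (?e + y) \<in> affine hull P" unfolding aff affine_hull_translation by blast
    then show ?thesis by simp
  qed
  ultimately show "affine hull P = Rd d" by blast
qed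

lemma square_frame_full_lattice_polytope:
  assumes "square_frame d I p S a b c P"
  shows "full_lattice_polytope d P" "has_dim P d"
proof -
  note sq = square_frameD[OF assms]
  note fr = frameD[OF sq(1)]
  note part = square_frame_partition[OF assms]
  let ?e = "evec (d + 1)"
  let ?X = "insert (p b + p c - p a) (p ` I)"
  note P = square_frame_unlift[OF assms]
  have "polytope P" unfolding polytope_def using P part(1) by blast
  moreover have "vertices P \<subseteq> (+) (- ?e) ` ?X"
    unfolding vertices_def by (subst P) (rule extreme_points_of_convex_hull)
  moreover have "(+) (- ?e) ` ?X \<subseteq> Zd d"
    using Zd_unlift part(2,3) by blast
  ultimately have lp: "lattice_polytope d P" using sq(2) unfolding lattice_polytope_def by blast
  let ?C = "(+) (- ?e) ` p ` I"
  have "finite ?C" using fr(2) by simp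
  moreover have "\<not> affine_dependent (p ` I)"
    using indep_family_image(2)[OF fr(1)] affine_dependent_imp_dependent by blast
  then have "\<not> affine_dependent ?C" using affine_dependent_translation_eq by blast
  moreover have "card ?C = d + 1"
    using fr(3) by (simp add: card_image indep_family_image(1)[OF fr(1)])
  ultimately show "has_dim P d" unfolding has_dim_def using square_frame_affine_hull(2)[OF assms] by metis
  then show "full_lattice_polytope d P" using lp by (simp add: full_lattice_polytope_def)
qed

lemma extreme_point_functional:
  assumes "finite X" "v \<in> X" "linear \<phi>" "\<phi> v = (1 :: real)" "\<And>y. y \<in> X \<Longrightarrow> y \<noteq> v \<Longrightarrow> \<phi> y \<le> 1 / 2"
  shows "v extreme_point_of (convex hull X)"
proof -
  have "convex {y. \<phi> y \<le> 1 / 2}"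
  proof (rule convexI)
    fix x y and u w :: real assume *: "x \<in> {y. \<phi> y \<le> 1 / 2}" "y \<in> {y. \<phi> y \<le> 1 / 2}" "0 \<le> u" "0 \<le> w" "u + w = 1"
    have "\<phi> (u *\<^sub>R x + w *\<^sub>R y) = u * \<phi> x + w * \<phi> y" by (simp add: linear_add[OF assms(3)] linear_scale[OF assms(3)])
    also have "\<dots> \<le> u * (1 / 2) + w * (1 / 2)" using * by (intro add_mono mult_left_mono) auto
    also have "\<dots> = 1 / 2" using *(5) by (simp add: distrib_right[symmetric])
    finally show "u *\<^sub>R x + w *\<^sub>R y \<in> {y. \<phi> y \<le> 1 / 2}" by simp
  qed
  then have "convex hull (X - {v}) \<subseteq> {y. \<phi> y \<le> 1 / 2}" using assms(5) by (intro hull_minimal) auto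
  then have "v \<notin> convex hull (X - {v})" using assms(4) by auto
  then have "v extreme_point_of (convex hull (insert v (X - {v})))"
    using assms(1) by (intro extreme_point_of_convex_hull_insert) auto
  then show ?thesis using assms(2) by (simp add: insert_absorb)
qed

text \<open>Each listed point is cut off from the others by a linear functional that is 1 there and
  at most 1/2 elsewhere.\<close>

lemma square_frame_vertices:
  assumes "square_frame d I p S a b c P"
  shows "vertices P = (+) (- evec (d + 1)) ` insert (p b + p c - p a) (p ` I)"
proof -
  note sq = square_frameD[OF assms]
  note fr = frameD[OF sq(1)]
  note part = square_frame_partition[OF assms]
  note im = indep_family_image[OF fr(1)]
  let ?X = "insert (p b + p c - p a) (p ` I)"
  have functional: "\<exists>\<phi>::vect \<Rightarrow> real. linear \<phi> \<and> (\<forall>i\<in>I. \<phi> (p i) = g i) \<and> \<phi> (p b + p c - p a) = g b + g c - g a" for g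
  proof -
    obtain \<phi> where \<phi>: "linear \<phi>" "\<forall>v\<in>p ` I. \<phi> v = (g \<circ> the_inv_into I p) v"
      using linear_independent_extend[OF im(2), of "g \<circ> the_inv_into I p"] by blast
    have "\<forall>i\<in>I. \<phi> (p i) = g i" using \<phi>(2) by (simp add: the_inv_into_f_f[OF im(1)])
    then show ?thesis using \<phi>(1) sq(3-5) by (intro exI[of _ \<phi>]) (simp add: linear_add linear_diff)
  qed
  have ext: "v extreme_point_of (convex hull ?X)" if v: "v \<in> ?X" for v
  proof -
    have "\<exists>\<phi>::vect \<Rightarrow> real. linear \<phi> \<and> \<phi> v = 1 \<and> (\<forall>y\<in>?X. y \<noteq> v \<longrightarrow> \<phi> y \<le> 1 / 2)"
    proof (cases "v = p b + p c - p a")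
      case True
      obtain \<phi> :: "vect \<Rightarrow> real" where "linear \<phi>" "\<forall>i\<in>I. \<phi> (p i) = (if i = a then -1 else 0)" "\<phi> (p b + p c - p a) = 1"
        using functional[of "\<lambda>i. if i = a then -1 else 0"] sq(6-8) by auto
      then show ?thesis using True by (intro exI[of _ \<phi>]) auto
    next
      case False
      then obtain i where i: "i \<in> I" "v = p i" using v by auto
      \<comment> \<open>The value 1/2 at \<open>a\<close> brings the opposite vertex down from 1 to
        1/2 when \<open>i\<close> is \<open>b\<close> or \<open>c\<close>.\<close>
      define g where "g j = (if j = i then 1 else if j = a then 1 / 2 else 0 :: real)" for j
      obtain \<phi> :: "vect \<Rightarrow> real" where \<phi>: "linear \<phi>" "\<forall>i\<in>I. \<phi> (p i) = g i" "\<phi> (p b + p c - p a) = g b + g c - g a"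
        using functional[of g] by auto
      have "\<phi> y \<le> 1 / 2" if y: "y \<in> ?X" "y \<noteq> v" for y
      proof (cases "y = p b + p c - p a")
        case True
        then show ?thesis using \<phi>(3) sq(6-8) by (auto simp: g_def)
      next
        case False
        then obtain j where j: "j \<in> I" "y = p j" using y by auto
        then show ?thesis using \<phi>(2) y i by (auto simp: g_def)
      qed
      then show ?thesis using \<phi>(1,2) i by (intro exI[of _ \<phi>]) (auto simp: g_def)
    qed
    then obtain \<phi> :: "vect \<Rightarrow> real" where "linear \<phi>" "\<phi> v = 1" "\<And>y. y \<in> ?X \<Longrightarrow> y \<noteq> v \<Longrightarrow> \<phi> y \<le> 1 / 2" by blast
    then show ?thesis by (rule extreme_point_functional[OF part(1) v])
  qed
  have "{x. x extreme_point_of (convex hull ?X)} = ?X"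
    using ext extreme_points_of_convex_hull[of ?X] by blast
  then show ?thesis
    unfolding vertices_def square_frame_unlift[OF assms] convex_hull_translation extreme_points_of_translation by simp
qed

text \<open>The vertices carry the affine relation of the parallelogram, whereas those of a simplex
  belong to an affinely independent set.\<close>

lemma square_frame_not_simplex:
  assumes "square_frame d I p S a b c P"
  shows "\<not> is_simplex P"
proof
  note sq = square_frameD[OF assms]
  note fr = frameD[OF sq(1)]
  note part = square_frame_partition[OF assms]
  let ?X = "insert (p b + p c - p a) (p ` I)"
  let ?e = "evec (d + 1)"
  assume "is_simplex P"
  then obtain C where C: "finite C" "\<not> affine_dependent C" "P = convex hull C" by (auto simp: is_simplex_def)
  have "vertices P \<subseteq> C" unfolding vertices_def C(3) by (rule extreme_points_of_convex_hull)
  then have "(+) (- ?e) ` ?X \<subseteq> C" by (simp only: square_frame_vertices[OF assms])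
  then have "\<not> affine_dependent ((+) (- ?e) ` ?X)" using C(2) affine_independent_subset by blast
  then have ni: "\<not> affine_dependent ?X" using affine_dependent_translation_eq by blast
  have abc: "{a, b, c} \<subseteq> I" using sq(3-5) by simp
  define m :: "'a \<Rightarrow> real" where "m i = of_int (if i = a then -1 else if i = b \<or> i = c then 1 else 0 :: int)" for i
  define U :: "vect \<Rightarrow> real" where "U v = (if v \<in> p ` I then - m (the_inv_into I p v) else 1)" for v
  have inj: "inj_on p I" using indep_family_image(1)[OF fr(1)] .
  have Up: "U (p i) = - m i" if "i \<in> I" for i using that by (simp add: U_def the_inv_into_f_f[OF inj])
  have "(\<Sum>i\<in>I. m i) = 1"
  proof -
    have "(\<Sum>i\<in>I. m i) = (\<Sum>i\<in>I. (if i = b then 1 else 0) + (if i = c then 1 else 0) - (if i = a then 1 else 0))"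
      using sq(6-8) by (intro sum.cong) (auto simp: m_def)
    then show ?thesis using fr(2) sq(3-5) by (simp add: sum.distrib sum_subtractf)
  qed
  then have "sum U ?X = 0"
    using fr(2) part(4) by (simp add: sum.reindex[OF inj] Up sum_negf) (simp add: U_def)
  moreover have "(\<Sum>v\<in>?X. U v *\<^sub>R v) = 0"
  proof -
    have "(\<Sum>v\<in>?X. U v *\<^sub>R v) = (p b + p c - p a) - (\<Sum>i\<in>I. m i *\<^sub>R p i)"
      using fr(2) part(4) by (simp add: sum.reindex[OF inj] Up sum_negf) (simp add: U_def)
    then show ?thesis unfolding m_def square_coeffs[OF fr(2) abc sq(6-8), of p, symmetric] by simp
  qed
  moreover have "U (p b + p c - p a) \<noteq> 0" using part(4) by (simp add: U_def)
  ultimately have "affine_dependent ?X" unfolding affine_dependent_explicit_finite[OF part(1)] by blast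
  then show False using ni by simp
qed

text \<open>All lattice points of the lift lie in the lattice of the frame, which misses the
  half-sum of \<open>S\<close>.\<close>

lemma square_frame_not_spanning:
  assumes "square_frame d I p S a b c P" "S \<noteq> {}"
    "lift1 d P \<inter> Zd (d + 1) = insert (p b + p c - p a) (p ` I)"
  shows "\<not> spanning d P"
proof
  note sq = square_frameD[OF assms(1)]
  note fr = frameD[OF sq(1)]
  let ?X = "insert (p b + p c - p a) (p ` I)"
  assume "spanning d P"
  then have sp: "int_span ?X (\<lambda>v. v) = Zd (d + 1)" unfolding spanning_def int_comb_eq assms(3) .
  have Xs: "?X \<subseteq> int_span I p"
    using frame_base_int_span[OF sq(1)] sq(3-5) by (auto intro!: int_span_add int_span_diff)
  have scale: "r *\<^sub>R v \<in> int_span I p" if v: "v \<in> int_span I p" "r \<in> \<int>" for v r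
  proof -
    obtain s where "v = (\<Sum>i\<in>I. s i *\<^sub>R p i)" "\<forall>i\<in>I. s i \<in> \<int>" using v(1) by (auto simp: int_span_def)
    then show ?thesis using int_spanI[of I "\<lambda>i. r * s i" p] v(2) by (simp add: scaleR_sum_right)
  qed
  have "(\<Sum>v\<in>Y. r v *\<^sub>R v) \<in> int_span I p" if "finite Y" "Y \<subseteq> ?X" "\<forall>v\<in>Y. r v \<in> \<int>" for Y r
    using that by (induction Y rule: finite_induct) (use Xs in \<open>auto intro!: int_span_add scale int_span_0\<close>)
  then have "int_span ?X (\<lambda>v. v) \<subseteq> int_span I p" using fr(2) unfolding int_span_def[of ?X] by auto
  moreover have "(\<Sum>i\<in>I. half_indicator S i *\<^sub>R p i) \<in> Zd (d + 1)" unfolding frame_Zd_iff[OF sq(1)] by simp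
  ultimately have "(\<Sum>i\<in>I. half_indicator S i *\<^sub>R p i) \<in> int_span I p" using sp by blast
  then obtain r where r: "(\<Sum>i\<in>I. half_indicator S i *\<^sub>R p i) = (\<Sum>i\<in>I. r i *\<^sub>R p i)" "\<forall>i\<in>I. r i \<in> \<int>"
    by (auto simp: int_span_def)
  obtain s where s: "s \<in> S" using assms(2) by blast
  then have sI: "s \<in> I" using fr(4) by blast
  have "half_indicator S s = r s" by (rule indep_familyD[OF fr(1) r(1) sI])
  then have "1 / 2 = r s" using s by (simp add: half_indicator_def)
  then show False using r(2) sI half_not_Ints by metis
qed

section \<open>Excluding lattice pyramids\<close>

lemma Pyr_height:
  assumes "Q \<subseteq> Rd e" "convex Q" "Q \<noteq> {}" "y \<in> Pyr e Q"
  shows "0 \<le> ht e y" "ht e y \<le> 1" "ht e y = 1 \<Longrightarrow> y = evec (e + 1)"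
proof -
  have "y \<in> {x. \<exists>u\<ge>0. \<exists>v\<ge>0. \<exists>b. u + v = 1 \<and> b \<in> convex hull Q \<and> x = u *\<^sub>R evec (e + 1) + v *\<^sub>R b}"
    using assms(4) unfolding Pyr_def convex_hull_insert[OF assms(3)] .
  then obtain u v z where y: "0 \<le> u" "0 \<le> v" "u + v = 1" "z \<in> convex hull Q" "y = u *\<^sub>R evec (e + 1) + v *\<^sub>R z" by blast
  have "z \<in> Q" using y(4) assms(2) by (simp add: hull_same)
  then have "ht e z = 0" using assms(1) by (auto simp: Rd_iff)
  then have h: "ht e y = u" by (simp add: y(5) lookup_add)
  show "0 \<le> ht e y" "ht e y \<le> 1" using h y by auto
  show "y = evec (e + 1)" if "ht e y = 1" using that h y(3,5) by simp
qed

text \<open>The height above the base of a pyramid pulls back to an affine function \<open>g\<close>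
  with integral values at lattice points, 1 at one vertex and 0 at all others. The parallelogram
  relation keeps this apex away from the four corners, so it is some \<open>p i\<close> with
  \<open>i \<in> S\<close>; but then a lattice point built from the half-sum of \<open>S\<close>
  gets the value 1/2.\<close>

lemma square_frame_not_pyramid:
  assumes sqf: "square_frame d I p S a b c P" and S: "I - {a, b, c} \<subseteq> S"
  shows "\<not> lattice_pyramid d P"
proof
  note sq = square_frameD[OF sqf]
  note fr = frameD[OF sq(1)]
  note part = square_frame_partition[OF sqf]
  let ?x = "p b + p c - p a"
  let ?X = "insert ?x (p ` I)"
  let ?e = "evec (d + 1)"
  assume "lattice_pyramid d P"
  then obtain e Q f where Q: "full_lattice_polytope e Q" and
    f: "affine_map_on (affine hull P) f" "bij_betw f (Zd d \<inter> affine hull P) (Zd (e + 1) \<inter> affine hull (Pyr e Q))" "f ` P = Pyr e Q"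
    unfolding lattice_pyramid_def unimod_equiv_def by blast
  have Q': "Q \<subseteq> Rd e" "convex Q" "Q \<noteq> {}"
  proof -
    show "Q \<subseteq> Rd e" using Q by (simp add: full_lattice_polytope_def lattice_polytope_def)
    show "convex Q" using Q by (auto simp: full_lattice_polytope_def lattice_polytope_def polytope_def)
    have "has_dim Q e" using Q by (simp add: full_lattice_polytope_def)
    then obtain C where "card C = e + 1" "affine hull C = affine hull Q" by (auto simp: has_dim_def)
    then show "Q \<noteq> {}" by auto
  qed
  define g where "g y = ht e (f (- ?e + y))" for y
  have affP: "affine hull P = Rd d" by (rule square_frame_affine_hull[OF sqf])
  have XP: "- ?e + v \<in> P" if "v \<in> ?X" for v
    by (subst square_frame_unlift[OF sqf]) (use that in \<open>auto intro!: hull_inc\<close>)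
  have XZ: "- ?e + v \<in> Zd d \<inter> affine hull P" if "v \<in> ?X" for v
    using Zd_unlift[of v d] part(2,3) that hull_inc[OF XP[OF that], of affine] by blast
  have g01: "g v = 0 \<or> g v = 1" "g v = 1 \<Longrightarrow> f (- ?e + v) = evec (e + 1)" if v: "v \<in> ?X" for v
  proof -
    have "f (- ?e + v) \<in> Zd (e + 1)" using f(2) XZ[OF v] by (auto simp: bij_betw_def)
    then have "g v \<in> \<int>" by (simp add: g_def Zd_iff)
    then obtain k where k: "g v = of_int k" by (elim Ints_cases)
    have py: "f (- ?e + v) \<in> Pyr e Q" using f(3) XP[OF v] by blast
    have "0 \<le> g v" "g v \<le> 1" unfolding g_def by (rule Pyr_height[OF Q' py])+
    then have "k = 0 \<or> k = 1" using k by linarith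
    then show "g v = 0 \<or> g v = 1" using k by auto
    show "f (- ?e + v) = evec (e + 1)" if "g v = 1" using Pyr_height(3)[OF Q' py] that by (simp add: g_def)
  qed
  have g1: "v = v'" if "v \<in> ?X" "v' \<in> ?X" "g v = 1" "g v' = 1" for v v'
  proof -
    have "f (- ?e + v) = f (- ?e + v')" using g01(2) that by simp
    then have "- ?e + v = - ?e + v'" using f(2) XZ that(1,2) unfolding bij_betw_def inj_on_def by blast
    then show ?thesis by simp
  qed
  have gsum: "g (\<Sum>i\<in>J. r i *\<^sub>R y i) = (\<Sum>i\<in>J. r i * g (y i))"
    if J: "finite J" "\<And>i. i \<in> J \<Longrightarrow> y i \<in> ?X" "(\<Sum>i\<in>J. r i) = 1" for J :: "'j set" and r y
  proof -
    have A: "- ?e + y i \<in> affine hull P" if "i \<in> J" for i using XZ[OF J(2)[OF that]] by blast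
    have "f (\<Sum>i\<in>J. r i *\<^sub>R (- ?e + y i)) = (\<Sum>i\<in>J. r i *\<^sub>R f (- ?e + y i))"
      by (rule affine_map_on_sum(2)[OF f(1) affine_affine_hull J(1) A J(3)])
    then show ?thesis unfolding translate_lincomb[OF J(3)] by (simp add: g_def)
  qed
  \<comment> \<open>If \<open>g\<close> vanished at all vertices, it would vanish on the lifted
    polytope, yet the apex \<open>evec (e + 1)\<close> is attained.\<close>
  have "\<exists>v\<in>?X. g v = 1"
  proof (rule ccontr)
    assume "\<not> ?thesis"
    then have g0: "g v = 0" if "v \<in> ?X" for v using g01(1) that by blast
    have "evec (e + 1) \<in> Pyr e Q" unfolding Pyr_def by (rule hull_inc) simp
    then obtain y where y: "y \<in> P" "f y = evec (e + 1)" using f(3) by (metis imageE)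
    have "?e + y \<in> lift1 d P" using y(1) by (simp add: lift1_eq)
    then obtain u where u: "sum u ?X = 1" "?e + y = (\<Sum>v\<in>?X. u v *\<^sub>R v)"
      unfolding sq(9) convex_hull_finite[OF part(1)] by auto
    have "g (?e + y) = (\<Sum>v\<in>?X. u v * g v)" unfolding u(2) by (rule gsum[OF part(1) _ u(1)])
    then have "g (?e + y) = 0" using g0 by (simp add: sum.neutral)
    then show False using y(2) by (simp add: g_def)
  qed
  then obtain v where v: "v \<in> ?X" "g v = 1" by blast
  have abc: "{a, b, c} \<subseteq> I" using sq(3-5) by simp
  have gx: "g ?x = g (p b) + g (p c) - g (p a)"
  proof -
    have "(\<Sum>j\<in>I. of_int (if j = a then -1 else if j = b \<or> j = c then 1 else 0) :: real) =
      (\<Sum>i\<in>I. (if i = b then 1 else 0) + (if i = c then 1 else 0) - (if i = a then 1 else 0))"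
      using sq(6-8) by (intro sum.cong) auto
    also have "\<dots> = 1" using fr(2) sq(3-5) by (simp add: sum.distrib sum_subtractf)
    finally have "g ?x = (\<Sum>j\<in>I. of_int (if j = a then -1 else if j = b \<or> j = c then 1 else 0) * g (p j))"
      unfolding square_coeffs[OF fr(2) abc sq(6-8), of p] by (intro gsum fr(2)) auto
    also have "\<dots> = (\<Sum>j\<in>I. (if j = b then g (p b) else 0) + (if j = c then g (p c) else 0) - (if j = a then g (p a) else 0))"
      using sq(6-8) by (intro sum.cong) auto
    also have "\<dots> = g (p b) + g (p c) - g (p a)" using fr(2) sq(3-5) by (simp add: sum.distrib sum_subtractf)
    finally show ?thesis .
  qed
  have inj: "inj_on p I" using indep_family_image(1)[OF fr(1)] .
  have ne: "p a \<noteq> p b" "p a \<noteq> p c" "p b \<noteq> p c" "?x \<noteq> p a" "?x \<noteq> p b" "?x \<noteq> p c"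
    using inj_on_eq_iff[OF inj] sq(3-8) part(4) by auto
  have mem: "p a \<in> ?X" "p b \<in> ?X" "p c \<in> ?X" "?x \<in> ?X" using sq(3-5) by auto
  have g0: "g y = 0" if "y \<in> ?X" "y \<noteq> v" for y
    using g1[OF that(1) v(1) _ v(2)] g01(1)[OF that(1)] that(2) by blast
  have "v \<notin> {?x, p a, p b, p c}"
  proof
    assume "v \<in> {?x, p a, p b, p c}"
    then consider "v = ?x" | "v = p a" | "v = p b" | "v = p c" by blast
    then show False
    proof cases
      case 1
      then show False using gx g0[OF mem(1)] g0[OF mem(2)] g0[OF mem(3)] ne v(2) by simp
    next
      case 2
      then show False using gx g0[OF mem(4)] g0[OF mem(2)] g0[OF mem(3)] ne v(2) by simp
    next
      case 3
      then show False using gx g0[OF mem(4)] g0[OF mem(1)] g0[OF mem(3)] ne v(2) by simp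
    next
      case 4
      then show False using gx g0[OF mem(4)] g0[OF mem(1)] g0[OF mem(2)] ne v(2) by simp
    qed
  qed
  then obtain i where i: "i \<in> I" "v = p i" "i \<notin> {a, b, c}" using v(1) by auto
  then have iS: "i \<in> S" using S by blast
  have gi: "g (p j) = (if j = i then 1 else 0)" if "j \<in> I" for j
  proof (cases "j = i")
    case True
    then show ?thesis using v(2) i(2) by simp
  next
    case False
    then have "p j \<noteq> v" using inj_on_eq_iff[OF inj that i(1)] i(2) by simp
    then show ?thesis using g0[of "p j"] that False by simp
  qed
  \<comment> \<open>The half-sum of \<open>S\<close>, corrected by an integer at \<open>a\<close> to
    reach height 1; the coefficient at \<open>i\<close> stays 1/2 because
    \<open>i \<noteq> a\<close>.\<close>
  define r where "r j = half_indicator S j + (if j = a then 1 - real (card S div 2) else 0)" for j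
  have "(\<Sum>j\<in>I. r j) = real (card S) / 2 + (1 - real (card S div 2))"
    unfolding r_def sum.distrib sum_half_indicator[OF fr(2,4)] using fr(2) sq(3) by simp
  then have rs: "(\<Sum>j\<in>I. r j) = 1" using frame_card_even[OF sq(1)] by (auto elim!: evenE)
  define w where "w = (\<Sum>j\<in>I. r j *\<^sub>R p j)"
  have "w \<in> Zd (d + 1)" unfolding w_def frame_Zd_iff[OF sq(1)] by (auto simp: r_def)
  moreover have "ht d w = 1" unfolding w_def frame_height[OF sq(1)] by (rule rs)
  ultimately have wZ: "- ?e + w \<in> Zd d" by (rule Zd_unlift)
  then have "- ?e + w \<in> Zd d \<inter> affine hull P" unfolding affP by (simp add: Zd_def)
  then have "f (- ?e + w) \<in> Zd (e + 1)" using f(2) by (auto simp: bij_betw_def)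
  then have "g w \<in> \<int>" by (simp add: g_def Zd_iff)
  moreover have "g w = (\<Sum>j\<in>I. r j * g (p j))" unfolding w_def by (rule gsum[OF fr(2) _ rs]) auto
  moreover have "(\<Sum>j\<in>I. r j * g (p j)) = (\<Sum>j\<in>I. if j = i then r i else 0)" by (intro sum.cong) (auto simp: gi)
  moreover have "r i = 1 / 2" using i(3) iS by (simp add: r_def half_indicator_def)
  ultimately show False using i(1) fr(2) half_not_Ints by simp
qed

section \<open>Coordinate models\<close>

text \<open>Index \<open>0\<close> stands for the origin and \<open>s\<close> for the one vertex off
  the unit simplex, whose entry 2 creates the index 2. \<open>s\<close> is separate from the
  dimension so that a model in dimension \<open>d - 1\<close> can be coned with the apex
  \<open>evec d\<close>.\<close>

definition model_point :: "nat \<Rightarrow> nat set \<Rightarrow> nat \<Rightarrow> vect" where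
  "model_point s T j = (if j = 0 then 0 else if j = s then (\<Sum>i\<in>T. evec i) + 2 *\<^sub>R evec s else evec j)"

text \<open>The index 0 is included when needed to make the cardinality even.\<close>

definition model_half :: "nat \<Rightarrow> nat set \<Rightarrow> nat set" where
  "model_half s T = insert s T \<union> (if even (card T) then {0} else {})"

lemma lookup_model_point:
  assumes "finite T" "s \<noteq> 0"
  shows "Poly_Mapping.lookup (model_point s T j) i =
    (if j = s then (if i \<in> T then 1 else 0) + (if i = s then 2 else 0) else if i = j \<and> j \<noteq> 0 then 1 else 0)"
  using assms by (auto simp: model_point_def lookup_add)

lemma lookup_model_sum:
  assumes "s \<in> {1..d}" "T \<subseteq> {1..d} - {s}"
  shows "Poly_Mapping.lookup (\<Sum>j\<le>d. r j *\<^sub>R (evec (d + 1) + model_point s T j)) i =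
    (if i = d + 1 then (\<Sum>j\<le>d. r j) else if i = s then 2 * r s
     else if i \<in> {1..d} then r i + (if i \<in> T then r s else 0) else 0)"
proof -
  have fin: "finite T" using assms(2) finite_subset by blast
  have "Poly_Mapping.lookup (\<Sum>j\<le>d. r j *\<^sub>R (evec (d + 1) + model_point s T j)) i =
    (\<Sum>j\<le>d. (if i = d + 1 then r j else 0) + r j * Poly_Mapping.lookup (model_point s T j) i)"
    unfolding lookup_sum_vect by (intro sum.cong) (auto simp: lookup_add distrib_left)
  also have "\<dots> = (if i = d + 1 then (\<Sum>j\<le>d. r j) else 0) + (\<Sum>j\<le>d. r j * Poly_Mapping.lookup (model_point s T j) i)"
    by (simp add: sum.distrib)
  also have "(\<Sum>j\<le>d. r j * Poly_Mapping.lookup (model_point s T j) i) =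
    (\<Sum>j\<le>d. (if j = s then r s * ((if i \<in> T then 1 else 0) + (if i = s then 2 else 0)) else 0) +
       (if j = i then (if i \<noteq> 0 \<and> i \<noteq> s then r i else 0) else 0))"
    using fin assms by (intro sum.cong) (auto simp: lookup_model_point)
  also have "\<dots> = r s * ((if i \<in> T then 1 else 0) + (if i = s then 2 else 0)) + (if i \<le> d \<and> i \<noteq> 0 \<and> i \<noteq> s then r i else 0)"
    using assms(1) by (auto simp: sum.distrib)
  finally show ?thesis using assms by auto
qed

lemma indep_familyI:
  assumes "finite I" "inj_on p I" "independent (p ` I)"
  shows "indep_family I p"
  unfolding indep_family_def
proof (intro conjI allI impI ballI)
  fix r i assume 0: "(\<Sum>i\<in>I. r i *\<^sub>R p i) = 0" and i: "i \<in> I"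
  have "(\<Sum>v\<in>p ` I. r (the_inv_into I p v) *\<^sub>R v) = 0"
    using 0 by (simp add: sum.reindex[OF assms(2)] the_inv_into_f_f[OF assms(2)])
  moreover have "\<not> (\<exists>u. (\<exists>v\<in>p ` I. u v \<noteq> 0) \<and> (\<Sum>v\<in>p ` I. u v *\<^sub>R v) = 0)"
    using assms(3) unfolding real_vector.dependent_finite[OF finite_imageI[OF assms(1), of p]] .
  then have "\<not> ((\<exists>v\<in>p ` I. r (the_inv_into I p v) \<noteq> 0) \<and> (\<Sum>v\<in>p ` I. r (the_inv_into I p v) *\<^sub>R v) = 0)"
    by (rule contrapos_nn) (rule exI[of _ "\<lambda>v. r (the_inv_into I p v)"])
  ultimately have "r (the_inv_into I p (p i)) = 0" using i by simp
  then show "r i = 0" by (simp add: the_inv_into_f_f[OF assms(2) i])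
qed (rule assms(1))

lemma model_point_Zd:
  assumes "s \<in> {1..d}" "T \<subseteq> {1..d} - {s}" "j \<le> d"
  shows "model_point s T j \<in> Zd d"
proof -
  have fin: "finite T" using assms(2) finite_subset by blast
  show ?thesis unfolding Zd_iff using assms fin by (auto simp: lookup_model_point)
qed

lemma card_model_half:
  assumes "s \<in> {1..d}" "T \<subseteq> {1..d} - {s}"
  shows "even (card (model_half s T))"
proof -
  have fin: "finite T" using assms(2) finite_subset by blast
  have "s \<notin> T" "0 \<notin> T" "s \<noteq> 0" using assms by auto
  then show ?thesis using fin by (auto simp: model_half_def)
qed

text \<open>Coordinate \<open>s\<close> of an integral combination is even, and conversely an
  integer vector with even coordinate \<open>s\<close> can be solved for integral coefficients. The
  half-sum \<open>w\<close> has coordinate 1 there and takes care of the odd ones.\<close>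

lemma model_frame:
  assumes s: "s \<in> {1..d}" and T: "T \<subseteq> {1..d} - {s}"
  shows "frame d {..d} (\<lambda>j. evec (d + 1) + model_point s T j) (model_half s T)"
proof -
  let ?p = "\<lambda>j. evec (d + 1) + model_point s T j" and ?S = "model_half s T"
  note co = lookup_model_sum[OF s T]
  have fin: "finite T" using T finite_subset by blast
  have SI: "?S \<subseteq> {..d}" using s T by (auto simp: model_half_def)
  have pZ: "?p j \<in> Zd (d + 1)" if "j \<le> d" for j
  proof (rule Zd_add)
    show "evec (d + 1) \<in> Zd (d + 1)" by (auto simp: Zd_iff)
    show "model_point s T j \<in> Zd (d + 1)" using model_point_Zd[OF s T that] by (auto simp: Zd_iff)
  qed
  have ph: "ht d (?p j) = 1" if "j \<le> d" for j
    using model_point_Zd[OF s T that] by (simp add: Zd_iff lookup_add)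
  have ind: "indep_family {..d} ?p"
    unfolding indep_family_def
  proof (intro conjI allI impI)
    fix r assume 0: "(\<Sum>j\<in>{..d}. r j *\<^sub>R ?p j) = 0"
    have c: "Poly_Mapping.lookup (\<Sum>j\<in>{..d}. r j *\<^sub>R ?p j) i = 0" for i by (simp only: 0 lookup_zero)
    have rs: "r s = 0" using c[of s, unfolded co] s by auto
    have ri: "r i = 0" if "i \<in> {1..d}" for i
      using c[of i, unfolded co] that rs by (cases "i = s") (auto split: if_splits)
    have "(\<Sum>j\<le>d. r j) = 0" using c[of "d + 1", unfolded co] by simp
    moreover have "(\<Sum>j\<le>d. r j) = r 0"
      using ri by (subst sum.mono_neutral_right[of "{..d}" "{0}"]) auto
    ultimately have "r 0 = 0" by simp
    then show "\<forall>i\<in>{..d}. r i = 0" using ri by (metis One_nat_def Suc_leI atLeastAtMost_iff atMost_iff not_gr_zero)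
  qed simp
  define w where "w = (\<Sum>j\<le>d. half_indicator ?S j *\<^sub>R ?p j)"
  have even: "even (card ?S)" by (rule card_model_half[OF s T])
  have ws: "Poly_Mapping.lookup w s = 1" unfolding w_def co using s by (auto simp: half_indicator_def model_half_def)
  have wZ: "w \<in> Zd (d + 1)"
    unfolding Zd_iff
  proof (intro conjI allI impI)
    fix i
    have "(\<Sum>j\<le>d. half_indicator ?S j) = real (card ?S) / 2" by (rule sum_half_indicator[OF _ SI]) simp
    also have "\<dots> = of_int (int (card ?S div 2))" using even by (auto elim!: evenE)
    finally have int: "(\<Sum>j\<le>d. half_indicator ?S j) \<in> \<int>" by (metis Ints_of_int)
    show "Poly_Mapping.lookup w i \<in> \<int>"
      unfolding w_def co using int by (auto simp: half_indicator_def model_half_def)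
    show "Poly_Mapping.lookup w i = 0" if "i \<notin> {1..d + 1}"
      unfolding w_def co using that s by auto
  qed
  have even_case: "\<exists>r. (\<forall>j\<in>{..d}. r j \<in> \<int>) \<and> z = (\<Sum>j\<le>d. r j *\<^sub>R ?p j)"
    if z: "z \<in> Zd (d + 1)" and m: "Poly_Mapping.lookup z s = 2 * of_int m" for z m
  proof -
    \<comment> \<open>Coordinate \<open>s\<close> gives the coefficient at \<open>s\<close>, the
      others follow after subtracting the tail, and the coefficient at the origin is left to adjust
      the height.\<close>
    define r1 where "r1 j = (if j = s then of_int m else Poly_Mapping.lookup z j - (if j \<in> T then of_int m else 0))" for j
    define r where "r j = (if j = 0 then ht d z - (\<Sum>i\<in>{1..d}. r1 i) else r1 j)" for j
    have r1: "r1 j \<in> \<int>" for j using z by (auto simp: r1_def Zd_iff)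
    have "(\<Sum>j\<le>d. r j) = r 0 + (\<Sum>j\<in>{1..d}. r j)"
      by (simp add: sum.atLeast1_atMost_eq sum.atMost_shift)
    also have "(\<Sum>j\<in>{1..d}. r j) = (\<Sum>j\<in>{1..d}. r1 j)" by (intro sum.cong) (auto simp: r_def)
    finally have rsum: "(\<Sum>j\<le>d. r j) = ht d z" by (simp add: r_def)
    have "z = (\<Sum>j\<le>d. r j *\<^sub>R ?p j)"
    proof (rule poly_mapping_eqI)
      fix i
      show "Poly_Mapping.lookup z i = Poly_Mapping.lookup (\<Sum>j\<le>d. r j *\<^sub>R ?p j) i"
        unfolding co rsum using z m s by (auto simp: r_def r1_def Zd_iff)
    qed
    moreover have "\<forall>j\<in>{..d}. r j \<in> \<int>"
    proof
      fix j
      have "ht d z \<in> \<int>" using z by (simp add: Zd_iff)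
      moreover have "(\<Sum>i\<in>{1..d}. r1 i) \<in> \<int>" using r1 by (intro Ints_sum) auto
      ultimately show "r j \<in> \<int>" using r1 by (simp add: r_def)
    qed
    ultimately show ?thesis by blast
  qed
  have "Zd (d + 1) = {\<Sum>j\<in>{..d}. r j *\<^sub>R ?p j | r. (\<forall>j\<in>{..d}. r j \<in> \<int>) \<or> (\<forall>j\<in>{..d}. r j - half_indicator ?S j \<in> \<int>)}"
    (is "_ = ?R")
  proof (intro equalityI subsetI)
    fix z assume z: "z \<in> Zd (d + 1)"
    then have "Poly_Mapping.lookup z s \<in> \<int>" by (simp add: Zd_iff)
    then obtain k where k: "Poly_Mapping.lookup z s = of_int k" by (elim Ints_cases)
    show "z \<in> ?R"
    proof (cases "even k")
      case True
      then obtain m where "k = 2 * m" by (elim evenE)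
      then obtain r where "\<forall>j\<in>{..d}. r j \<in> \<int>" "z = (\<Sum>j\<le>d. r j *\<^sub>R ?p j)" using even_case[OF z, of m] k by auto
      then show ?thesis by blast
    next
      case False
      then obtain m where m: "k = 2 * m + 1" by (elim oddE)
      have "Poly_Mapping.lookup (z - w) s = 2 * of_int m" using k m ws by (simp add: lookup_minus)
      then obtain r where r: "\<forall>j\<in>{..d}. r j \<in> \<int>" "z - w = (\<Sum>j\<le>d. r j *\<^sub>R ?p j)"
        using even_case[OF Zd_diff[OF z wZ]] by blast
      have "z = (\<Sum>j\<le>d. (r j + half_indicator ?S j) *\<^sub>R ?p j)"
        unfolding scaleR_left_distrib sum.distrib w_def[symmetric] r(2)[symmetric] by simp
      then show ?thesis using r(1) by (intro CollectI exI[of _ "\<lambda>j. r j + half_indicator ?S j"]) auto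
    qed
  next
    fix z assume "z \<in> ?R"
    then obtain r where r: "z = (\<Sum>j\<le>d. r j *\<^sub>R ?p j)"
      "(\<forall>j\<in>{..d}. r j \<in> \<int>) \<or> (\<forall>j\<in>{..d}. r j - half_indicator ?S j \<in> \<int>)" by blast
    have intZ: "(\<Sum>j\<le>d. r j *\<^sub>R ?p j) \<in> Zd (d + 1)" if "\<forall>j\<in>{..d}. r j \<in> \<int>" for r
      using that by (intro Zd_sum Zd_scale pZ) auto
    show "z \<in> Zd (d + 1)"
      using r(2)
    proof
      assume "\<forall>j\<in>{..d}. r j \<in> \<int>"
      then show ?thesis unfolding r(1) by (rule intZ)
    next
      assume "\<forall>j\<in>{..d}. r j - half_indicator ?S j \<in> \<int>"
      then have "(\<Sum>j\<le>d. (r j - half_indicator ?S j) *\<^sub>R ?p j) + w \<in> Zd (d + 1)" by (intro Zd_add wZ intZ)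
      also have "(\<Sum>j\<le>d. (r j - half_indicator ?S j) *\<^sub>R ?p j) + w = z"
        unfolding r(1) w_def sum.distrib[symmetric] scaleR_left_distrib[symmetric] by simp
      finally show ?thesis .
    qed
  qed
  then show ?thesis unfolding frame_def using ind SI pZ ph by auto
qed

lemma model_square_frame:
  assumes s: "s \<in> {1..d}" and T: "T \<subseteq> {1..d} - {s}" and abc: "{a, b, c} \<subseteq> {..d}" "a \<noteq> b" "a \<noteq> c" "b \<noteq> c"
  shows "square_frame d {..d} (\<lambda>j. evec (d + 1) + model_point s T j) (model_half s T) a b c
    (convex hull (insert (model_point s T b + model_point s T c - model_point s T a) (model_point s T ` {..d})))"
    (is "square_frame _ _ ?p _ _ _ _ (convex hull ?V)")
proof -
  have "?V \<subseteq> Rd d"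
    using model_point_Zd[OF s T] abc(1) by (auto simp: Zd_def intro!: subspace_add subspace_diff subspace_Rd)
  then have "convex hull ?V \<subseteq> Rd d" by (rule hull_minimal) (rule subspace_imp_convex[OF subspace_Rd])
  moreover have "lift1 d (convex hull ?V) = convex hull (insert (?p b + ?p c - ?p a) (?p ` {..d}))"
    unfolding lift1_eq convex_hull_translation[symmetric]
    by (intro arg_cong[of _ _ "\<lambda>A. convex hull A"]) (simp add: image_image algebra_simps)
  ultimately show ?thesis unfolding square_frame_def using model_frame[OF s T] abc by blast
qed

lemma bij_betw_extend:
  assumes "finite J" "finite I" "card J = card I" "A \<subseteq> J" "inj_on g A" "g ` A \<subseteq> I"
  obtains \<pi> where "bij_betw \<pi> J I" "\<And>x. x \<in> A \<Longrightarrow> \<pi> x = g x"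
proof -
  have "card (J - A) = card (I - g ` A)"
    using assms by (simp add: card_Diff_subset finite_subset card_image)
  then obtain h where h: "bij_betw h (J - A) (I - g ` A)"
    using finite_same_card_bij[of "J - A" "I - g ` A"] assms(1,2) by blast
  define \<pi> where "\<pi> x = (if x \<in> A then g x else h x)" for x
  have "bij_betw \<pi> A (g ` A)" using assms(5) by (auto simp: bij_betw_def inj_on_def \<pi>_def)
  moreover have "bij_betw \<pi> (J - A) (I - g ` A)"
    by (rule bij_betw_cong[THEN iffD1, OF _ h]) (simp add: \<pi>_def)
  ultimately have "bij_betw \<pi> (A \<union> (J - A)) (g ` A \<union> (I - g ` A))" by (rule bij_betw_combine) blast
  moreover have "A \<union> (J - A) = J" "g ` A \<union> (I - g ` A) = I" using assms(4,6) by auto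
  ultimately show ?thesis using that[of \<pi>] by (simp add: \<pi>_def)
qed

text \<open>As \<open>card S\<close> is at least 4, some element of \<open>S\<close> lies off the
  square. With it placed at index \<open>d - 1\<close> and \<open>t\<close> at index
  \<open>d\<close>, the model vertex of \<open>t\<close> is \<open>evec d\<close> and all other
  vertices lie in dimension \<open>d - 1\<close>, so the model is a pyramid.\<close>

lemma square_frame_pyramid:
  assumes sqf: "square_frame d I p S a b c P" and S: "4 \<le> card S" and t: "t \<in> I" "t \<notin> S" "t \<notin> {a, b, c}"
  shows "lattice_pyramid d P"
proof -
  note sq = square_frameD[OF sqf]
  note fr = frameD[OF sq(1)]
  have "card {a, b, c} = 3" using sq(6-8) by simp
  have "\<not> S \<subseteq> {a, b, c}" using S card_mono[of "{a, b, c}" S] \<open>card {a, b, c} = 3\<close> by auto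
  then obtain s where s: "s \<in> S" "s \<notin> {a, b, c}" by blast
  have sI: "s \<in> I" using s fr(4) by blast
  have st: "s \<noteq> t" using s t by blast
  have "card {a, b, c, s, t} = 5" using sq(6-8) s t st by auto
  moreover have "card {a, b, c, s, t} \<le> card I" using fr(2) sq(3-5) sI t by (intro card_mono) auto
  ultimately have d4: "4 \<le> d" using fr(3) by simp
  define g where "g j = (if j = d then t else s)" for j
  obtain \<pi> where \<pi>: "bij_betw \<pi> {..d} I" "\<And>x. x \<in> {d - 1, d} \<Longrightarrow> \<pi> x = g x"
  proof (rule bij_betw_extend[of "{..d}" I "{d - 1, d}" g])
    show "inj_on g {d - 1, d}" using st d4 by (auto simp: g_def inj_on_def)
  qed (use fr(2,3) sI t in \<open>auto simp: g_def\<close>)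
  have \<pi>d: "\<pi> d = t" "\<pi> (d - 1) = s" using \<pi>(2) d4 by (auto simp: g_def)
  have surj: "\<exists>j\<le>d. \<pi> j = i" if "i \<in> I" for i using \<pi>(1) that unfolding bij_betw_def by (metis atMost_iff imageE)
  obtain a' b' c' where abc': "a' \<le> d" "\<pi> a' = a" "b' \<le> d" "\<pi> b' = b" "c' \<le> d" "\<pi> c' = c"
    using surj sq(3-5) by metis
  have less: "j < d - 1" if "j \<le> d" "\<pi> j \<noteq> t" "\<pi> j \<noteq> s" for j
  proof -
    have "j \<noteq> d" "j \<noteq> d - 1" using that \<pi>d by auto
    then show ?thesis using that(1) by linarith
  qed
  have l: "a' < d - 1" "b' < d - 1" "c' < d - 1" using less abc' s t by auto
  define S' where "S' = {j\<in>{..d}. \<pi> j \<in> S}"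
  have sq': "square_frame d {..d} (p \<circ> \<pi>) S' a' b' c' P"
    unfolding S'_def by (rule square_frame_reindex[OF _ \<pi>(1)]) (use sqf abc' in auto)
  have ne: "a' \<noteq> b'" "a' \<noteq> c'" "b' \<noteq> c'" using abc' sq(6-8) by auto
  define T where "T = S' \<inter> {1..d - 2}"
  have finT: "finite T" by (simp add: T_def)
  have dS: "d \<notin> S'" "d - 1 \<in> S'" using \<pi>d s t by (auto simp: S'_def)
  have S'eq: "S' = insert (d - 1) T \<union> (S' \<inter> {0})"
  proof
    show "insert (d - 1) T \<union> (S' \<inter> {0}) \<subseteq> S'" using dS by (auto simp: T_def)
    show "S' \<subseteq> insert (d - 1) T \<union> (S' \<inter> {0})"
    proof
      fix j assume j: "j \<in> S'"
      then have "j \<le> d" "j \<noteq> d" using dS by (auto simp: S'_def)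
      then have "j = 0 \<or> j = d - 1 \<or> j \<in> {1..d - 2}" by auto
      then show "j \<in> insert (d - 1) T \<union> (S' \<inter> {0})" using j by (auto simp: T_def)
    qed
  qed
  \<comment> \<open>\<open>card S'\<close> is even, so whether it contains 0 is decided by the
    parity of \<open>T\<close>, exactly as in \<open>model_half\<close>.\<close>
  have Th: "S' = model_half (d - 1) T"
  proof -
    have "even (card S')" using frame_card_even square_frameD(1)[OF sq'] by blast
    moreover have "card (insert (d - 1) T \<union> (S' \<inter> {0})) = 1 + card T + card (S' \<inter> {0})"
    proof -
      have "d - 1 \<notin> T" "0 \<notin> insert (d - 1) T" using d4 by (auto simp: T_def)
      then show ?thesis using finT by (subst card_Un_disjoint) auto
    qed
    ultimately have "even (1 + card T + card (S' \<inter> {0}))" using S'eq by simp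
    then have "even (card T) \<longleftrightarrow> 0 \<in> S'" by (cases "0 \<in> S'") auto
    then show ?thesis unfolding model_half_def by (subst S'eq) auto
  qed
  let ?m = "model_point (d - 1) T"
  let ?V = "insert (?m b' + ?m c' - ?m a') (?m ` {..d - 1})"
  define Q where "Q = convex hull ?V"
  have dd: "d = (d - 1) + 1" using d4 by simp
  have "square_frame (d - 1) {..d - 1} (\<lambda>j. evec (d - 1 + 1) + ?m j) (model_half (d - 1) T) a' b' c' Q"
    unfolding Q_def by (rule model_square_frame) (use d4 l ne in \<open>auto simp: T_def\<close>)
  then have Qfull: "full_lattice_polytope (d - 1) Q" by (rule square_frame_full_lattice_polytope)
  have "d \<noteq> d - 1" "d \<noteq> 0" using d4 by auto
  then have "?m d = evec d" by (simp add: model_point_def)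
  moreover have "{..d} = insert d {..d - 1}" using d4 by auto
  ultimately have V: "insert (?m b' + ?m c' - ?m a') (?m ` {..d}) = insert (evec d) ?V"
    by (simp add: insert_commute)
  have "Pyr (d - 1) Q = convex hull (insert (evec d) ?V)"
    unfolding Pyr_def Q_def using dd hull_insert[of convex "evec d" ?V] by simp
  then have PQ: "Pyr (d - 1) Q = convex hull (insert (?m b' + ?m c' - ?m a') (?m ` {..d}))" using V by simp
  have "square_frame d {..d} (\<lambda>j. evec (d + 1) + ?m j) (model_half (d - 1) T) a' b' c' (Pyr (d - 1) Q)"
    unfolding PQ by (rule model_square_frame) (use d4 l ne in \<open>auto simp: T_def\<close>)
  then have "unimod_equiv d P d (Pyr (d - 1) Q)" using square_frame_equiv[OF sq'] Th by simp
  then have "unimod_equiv d P (d - 1 + 1) (Pyr (d - 1) Q)" using dd by simp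
  moreover have "has_dim P d" by (rule square_frame_full_lattice_polytope(2)[OF sqf])
  moreover have "d - 1 < d" using d4 by simp
  ultimately show ?thesis unfolding lattice_pyramid_def using Qfull by blast
qed

section \<open>Frames and lattice points under unimodular equivalence\<close>

lemma lift1_Int_Zd:
  assumes "P \<subseteq> Rd d"
  shows "lift1 d P \<inter> Zd (d + 1) = (+) (evec (d + 1)) ` (P \<inter> Zd d)"
proof (intro equalityI subsetI)
  fix z assume z: "z \<in> lift1 d P \<inter> Zd (d + 1)"
  then obtain y where y: "y \<in> P" "z = evec (d + 1) + y" by (auto simp: lift1_eq)
  then have "ht d z = 1" using assms by (auto simp: Rd_iff lookup_add)
  then have "- evec (d + 1) + z \<in> Zd d" using z by (intro Zd_unlift) auto
  then show "z \<in> (+) (evec (d + 1)) ` (P \<inter> Zd d)" using y by auto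
next
  fix z assume "z \<in> (+) (evec (d + 1)) ` (P \<inter> Zd d)"
  then show "z \<in> lift1 d P \<inter> Zd (d + 1)" by (auto simp: lift1_eq Zd_iff lookup_add)
qed

text \<open>Lattice points map injectively to lattice points. For the families, which have
  \<open>d + 2\<close> of them, this bounds the source dimension by the target dimension.\<close>

lemma unimod_equiv_card_lattice_points:
  assumes "unimod_equiv d P e Q" "P \<subseteq> Rd d" "Q \<subseteq> Rd e" "finite (lift1 e Q \<inter> Zd (e + 1))"
  shows "card (lift1 d P \<inter> Zd (d + 1)) \<le> card (lift1 e Q \<inter> Zd (e + 1))"
proof -
  obtain f where f: "bij_betw f (Zd d \<inter> affine hull P) (Zd e \<inter> affine hull Q)" "f ` P = Q"
    using assms(1) by (auto simp: unimod_equiv_def)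
  have c: "card (lift1 n R \<inter> Zd (n + 1)) = card (R \<inter> Zd n)" if "R \<subseteq> Rd n" for R n
    unfolding lift1_Int_Zd[OF that] by (intro card_image) simp
  have "P \<inter> Zd d \<subseteq> Zd d \<inter> affine hull P" using hull_subset[of P affine] by blast
  then have "inj_on f (P \<inter> Zd d)" "f ` (P \<inter> Zd d) \<subseteq> Q \<inter> Zd e"
  proof -
    assume sub: "P \<inter> Zd d \<subseteq> Zd d \<inter> affine hull P"
    show "inj_on f (P \<inter> Zd d)" using bij_betw_imp_inj_on[OF f(1)] sub by (rule inj_on_subset)
    show "f ` (P \<inter> Zd d) \<subseteq> Q \<inter> Zd e" using bij_betwE[OF f(1)] f(2) sub by blast
  qed
  moreover have "finite (Q \<inter> Zd e)" using assms(4) unfolding lift1_Int_Zd[OF assms(3)] by (simp add: finite_image_iff)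
  ultimately show ?thesis unfolding c[OF assms(2)] c[OF assms(3)] by (rule card_inj_on_le)
qed

text \<open>The equivalence carries the labelled vertices to \<open>q'\<close>. Surjectivity on
  lattice points makes \<open>q'\<close> span the lifted target space, whence
  \<open>e \<le> d\<close>. In equal dimensions lattice points keep their coefficients, so
  \<open>q'\<close> is a frame with the same \<open>S\<close>.\<close>

lemma square_frame_transport:
  assumes sqP: "square_frame d I p S a b c P" and sqQ: "square_frame e J q S' a' b' c' Q"
    and eq: "unimod_equiv d P e Q"
  shows "e \<le> d" and "e = d \<Longrightarrow> \<exists>p'. square_frame d I p' S a b c Q"
proof -
  note sq = square_frameD[OF sqP] and sqq = square_frameD[OF sqQ]
  note fr = frameD[OF sq(1)]
  let ?e = "evec (d + 1)" and ?e' = "evec (e + 1)"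
  have affP: "affine hull P = Rd d" and affQ: "affine hull Q = Rd e"
    using square_frame_affine_hull(1)[OF sqP] square_frame_affine_hull(1)[OF sqQ] .
  obtain f where f: "affine_map_on (Rd d) f" "bij_betw f (Zd d \<inter> Rd d) (Zd e \<inter> Rd e)" "f ` P = Q"
    and fR: "f ` Rd d \<subseteq> Rd e"
    using eq unfolding unimod_equiv_def affP affQ by blast
  have ZR: "Zd n \<inter> Rd n = Zd n" for n by (auto simp: Zd_def)
  note fZ = f(2)[unfolded ZR]
  define q' where "q' i = ?e' + f (- ?e + p i)" for i
  have pu: "- ?e + p i \<in> Zd d" if "i \<in> I" for i using fr(6,7) that by (intro Zd_unlift) auto
  have comb: "?e' + f (- ?e + (\<Sum>i\<in>I. r i *\<^sub>R p i)) = (\<Sum>i\<in>I. r i *\<^sub>R q' i)" if r: "(\<Sum>i\<in>I. r i) = 1" for r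
  proof -
    have "f (\<Sum>i\<in>I. r i *\<^sub>R (- ?e + p i)) = (\<Sum>i\<in>I. r i *\<^sub>R f (- ?e + p i))"
      by (rule affine_map_on_sum(2)[OF f(1) subspace_imp_affine[OF subspace_Rd] fr(2) _ r])
         (use pu in \<open>auto simp: Zd_def\<close>)
    moreover have "(\<Sum>i\<in>I. r i *\<^sub>R q' i) = ?e' + (\<Sum>i\<in>I. r i *\<^sub>R f (- ?e + p i))"
      unfolding q'_def using translate_lincomb[OF r, of "- ?e'"] by simp
    ultimately show ?thesis unfolding translate_lincomb[OF r] by simp
  qed
  have lifte: "?e + y \<in> Zd (d + 1)" "ht d (?e + y) = 1" if "y \<in> Zd d" for y
    using that by (auto simp: Zd_iff lookup_add)
  have onto: "\<exists>r. (\<Sum>i\<in>I. r i) = 1 \<and> (\<Sum>i\<in>I. r i *\<^sub>R p i) \<in> Zd (d + 1) \<and> z = (\<Sum>i\<in>I. r i *\<^sub>R q' i)"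
    if z: "z \<in> Zd (e + 1)" "ht e z = 1" for z
  proof -
    have "- ?e' + z \<in> Zd e" by (rule Zd_unlift[OF z])
    then obtain y where y: "y \<in> Zd d" "f y = - ?e' + z" using fZ unfolding bij_betw_def by (metis imageE)
    have "?e + y \<in> Rd (d + 1)" using lifte(1)[OF y(1)] by (simp add: Zd_def)
    then obtain r where r: "?e + y = (\<Sum>i\<in>I. r i *\<^sub>R p i)" by (rule frame_coeffs[OF sq(1)])
    have r1: "(\<Sum>i\<in>I. r i) = 1" using lifte(2)[OF y(1)] unfolding r frame_height[OF sq(1)] .
    have "(\<Sum>i\<in>I. r i *\<^sub>R q' i) = ?e' + f (- ?e + (?e + y))" using comb[OF r1] r by simp
    then have "z = (\<Sum>i\<in>I. r i *\<^sub>R q' i)" using y(2) by simp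
    then show ?thesis using r1 lifte(1)[OF y(1)] unfolding r by blast
  qed
  have inspan: "z \<in> span (q' ` I)" if z: "z \<in> Zd (e + 1)" "ht e z = 1" for z
  proof -
    obtain r where r: "z = (\<Sum>i\<in>I. r i *\<^sub>R q' i)" using onto[OF z] by blast
    show ?thesis unfolding r by (intro span_sum span_scale span_base) auto
  qed
  \<comment> \<open>Only height 1 is controlled, so unit vectors of height 0 are obtained as
    differences.\<close>
  have ev: "evec i \<in> span (q' ` I)" if i: "i \<in> {1..e + 1}" for i
  proof (cases "i = e + 1")
    case True
    then show ?thesis by (intro inspan) (auto simp: Zd_iff)
  next
    case False
    have "(evec i + ?e') - ?e' \<in> span (q' ` I)"
    proof (rule span_diff)
      show "evec i + ?e' \<in> span (q' ` I)"
        using i False by (intro inspan) (auto simp: Zd_iff lookup_add)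
      show "?e' \<in> span (q' ` I)" by (intro inspan) (auto simp: Zd_iff)
    qed
    then show ?thesis by simp
  qed
  have evs: "evec ` {1..e + 1} \<subseteq> span (q' ` I)" using ev by blast
  have "card (evec ` {1..e + 1}) \<le> card (q' ` I)"
    using real_vector.independent_span_bound[OF finite_imageI[OF fr(2)] independent_evec(1) evs] by simp
  then have "e + 1 \<le> card (q' ` I)" by (simp add: card_image independent_evec(2))
  moreover have "card (q' ` I) \<le> d + 1" using card_image_le[OF fr(2), of q'] fr(3) by simp
  ultimately have cardq: "e + 1 \<le> card (q' ` I)" "card (q' ` I) \<le> d + 1" by auto
  then show "e \<le> d" by simp
  assume ed: "e = d"
  have q'Z: "q' i \<in> Zd (d + 1)" "ht d (q' i) = 1" if "i \<in> I" for i
  proof -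
    have "f (- ?e + p i) \<in> Zd d" using bij_betwE[OF fZ] pu[OF that] unfolding ed by blast
    then show "q' i \<in> Zd (d + 1)" "ht d (q' i) = 1" using lifte ed by (auto simp: q'_def)
  qed
  have cq: "card (q' ` I) = d + 1" using cardq ed by simp
  have inj: "inj_on q' I" using cq fr(2,3) by (simp add: eq_card_imp_inj_on)
  have q'R: "q' ` I \<subseteq> Rd (d + 1)" using q'Z by (auto simp: Zd_def)
  have span: "span (q' ` I) = Rd (d + 1)"
  proof
    show "span (q' ` I) \<subseteq> Rd (d + 1)" by (rule span_minimal[OF q'R subspace_Rd])
    have "span (evec ` {1..d + 1}) \<subseteq> span (q' ` I)" using evs unfolding ed by (rule span_minimal) simp
    then show "Rd (d + 1) \<subseteq> span (q' ` I)" by (simp only: independent_evec(3))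
  qed
  have indq: "independent (q' ` I)"
  proof -
    obtain B where B: "B \<subseteq> q' ` I" "independent B" "q' ` I \<subseteq> span B"
      by (rule real_vector.maximal_independent_subset)
    have "span (q' ` I) \<subseteq> span B" by (rule span_minimal[OF B(3)]) simp
    moreover have "span B \<subseteq> span (q' ` I)" by (rule span_mono[OF B(1)])
    ultimately have "span B = Rd (d + 1)" using span by blast
    then have "card B = d + 1" using independent_Rd_span[OF B(2), of "d + 1"] B(1) q'R by blast
    then have "B = q' ` I" using card_seteq[OF finite_imageI[OF fr(2)] B(1)] cq by simp
    then show ?thesis using B(2) by simp
  qed
  have ind: "indep_family I q'" by (rule indep_familyI[OF fr(2) inj indq])
  have Z1: "(\<Sum>i\<in>I. r i *\<^sub>R q' i) \<in> Zd (d + 1) \<longleftrightarrow> (\<Sum>i\<in>I. r i *\<^sub>R p i) \<in> Zd (d + 1)" if r: "(\<Sum>i\<in>I. r i) = 1" for r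
  proof
    have hq: "ht d (\<Sum>i\<in>I. r i *\<^sub>R q' i) = 1" using q'Z(2) r by simp
    assume "(\<Sum>i\<in>I. r i *\<^sub>R q' i) \<in> Zd (d + 1)"
    then obtain r' where r': "(\<Sum>i\<in>I. r' i *\<^sub>R p i) \<in> Zd (d + 1)" "(\<Sum>i\<in>I. r i *\<^sub>R q' i) = (\<Sum>i\<in>I. r' i *\<^sub>R q' i)"
      using onto[of "\<Sum>i\<in>I. r i *\<^sub>R q' i"] hq unfolding ed by blast
    have "r i = r' i" if "i \<in> I" for i by (rule indep_familyD[OF ind r'(2) that])
    then have "(\<Sum>i\<in>I. r i *\<^sub>R p i) = (\<Sum>i\<in>I. r' i *\<^sub>R p i)" by (intro sum.cong) auto
    then show "(\<Sum>i\<in>I. r i *\<^sub>R p i) \<in> Zd (d + 1)" using r'(1) by simp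
  next
    assume z: "(\<Sum>i\<in>I. r i *\<^sub>R p i) \<in> Zd (d + 1)"
    moreover have "ht d (\<Sum>i\<in>I. r i *\<^sub>R p i) = 1" using r unfolding frame_height[OF sq(1)] .
    ultimately have "- ?e + (\<Sum>i\<in>I. r i *\<^sub>R p i) \<in> Zd d" by (rule Zd_unlift)
    then have "f (- ?e + (\<Sum>i\<in>I. r i *\<^sub>R p i)) \<in> Zd d" using bij_betwE[OF fZ] unfolding ed by blast
    then show "(\<Sum>i\<in>I. r i *\<^sub>R q' i) \<in> Zd (d + 1)" using lifte(1) unfolding comb[OF r, symmetric] ed by blast
  qed
  \<comment> \<open>The correspondence is known at height 1; a vector of integral height is moved
    there by an integral multiple of the generator at \<open>a\<close>, a lattice vector on both
    sides.\<close>
  have Zgen: "(\<Sum>i\<in>I. r i *\<^sub>R q' i) \<in> Zd (d + 1) \<longleftrightarrow> (\<Sum>i\<in>I. r i *\<^sub>R p i) \<in> Zd (d + 1)" for r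
  proof -
    define m where "m = (\<Sum>i\<in>I. r i)"
    have hp: "ht d (\<Sum>i\<in>I. r i *\<^sub>R p i) = m" unfolding m_def by (rule frame_height[OF sq(1)])
    have hq: "ht d (\<Sum>i\<in>I. r i *\<^sub>R q' i) = m" unfolding m_def using q'Z(2) by simp
    show ?thesis
    proof (cases "m \<in> \<int>")
      case False
      then have "(\<Sum>i\<in>I. r i *\<^sub>R p i) \<notin> Zd (d + 1)" "(\<Sum>i\<in>I. r i *\<^sub>R q' i) \<notin> Zd (d + 1)"
        using hp hq by (metis Zd_iff)+
      then show ?thesis by simp
    next
      case True
      define r' where "r' i = r i + (if i = a then 1 - m else 0)" for i
      have s: "(\<Sum>i\<in>I. r' i) = 1" unfolding r'_def sum.distrib using fr(2) sq(3) by (simp add: m_def)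
      have e1: "(\<Sum>i\<in>I. r' i *\<^sub>R v i) = (\<Sum>i\<in>I. r i *\<^sub>R v i) + (1 - m) *\<^sub>R v a" for v :: "'a \<Rightarrow> vect"
      proof -
        have "(\<Sum>i\<in>I. r' i *\<^sub>R v i) = (\<Sum>i\<in>I. r i *\<^sub>R v i + (if i = a then (1 - m) *\<^sub>R v a else 0))"
          by (intro sum.cong) (auto simp: r'_def scaleR_left_distrib)
        then show ?thesis using fr(2) sq(3) by (simp add: sum.distrib)
      qed
      have e2: "z + (1 - m) *\<^sub>R v \<in> Zd (d + 1) \<longleftrightarrow> z \<in> Zd (d + 1)" if "v \<in> Zd (d + 1)" for z v
      proof -
        have "(1 - m) *\<^sub>R v \<in> Zd (d + 1)" using that True by (intro Zd_scale) auto
        then show ?thesis using Zd_add Zd_diff by (metis add_diff_cancel)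
      qed
      show ?thesis using Z1[OF s] unfolding e1 e2[OF fr(6)[OF sq(3)]] e2[OF q'Z(1)[OF sq(3)]] .
    qed
  qed
  have Zall: "Zd (d + 1) = {\<Sum>i\<in>I. r i *\<^sub>R q' i | r. (\<forall>i\<in>I. r i \<in> \<int>) \<or> (\<forall>i\<in>I. r i - half_indicator S i \<in> \<int>)}" (is "_ = ?R")
  proof (intro equalityI subsetI)
    fix z assume z: "z \<in> Zd (d + 1)"
    then have "z \<in> span (q' ` I)" unfolding span by (simp add: Zd_def)
    then obtain u where "z = (\<Sum>v\<in>q' ` I. u v *\<^sub>R v)"
      using real_vector.span_finite[OF finite_imageI[OF fr(2)], of q'] by auto
    then have u: "z = (\<Sum>i\<in>I. u (q' i) *\<^sub>R q' i)" by (simp add: sum.reindex[OF inj])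
    then have "(\<forall>i\<in>I. u (q' i) \<in> \<int>) \<or> (\<forall>i\<in>I. u (q' i) - half_indicator S i \<in> \<int>)"
      using z Zgen[of "\<lambda>i. u (q' i)"] frame_Zd_iff[OF sq(1), of "\<lambda>i. u (q' i)"] by simp
    then show "z \<in> ?R" using u by (intro CollectI exI[of _ "\<lambda>i. u (q' i)"] conjI)
  next
    fix z assume "z \<in> ?R"
    then obtain r where r: "z = (\<Sum>i\<in>I. r i *\<^sub>R q' i)" "(\<forall>i\<in>I. r i \<in> \<int>) \<or> (\<forall>i\<in>I. r i - half_indicator S i \<in> \<int>)" by blast
    show "z \<in> Zd (d + 1)" unfolding r(1) Zgen frame_Zd_iff[OF sq(1)] by (rule r(2))
  qed
  have "frame d I q' S" unfolding frame_def using ind fr(3,4) q'Z Zall by blast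
  moreover have "lift1 d Q = convex hull (insert (q' b + q' c - q' a) (q' ` I))"
  proof -
    note im = indep_family_image[OF fr(1)]
    obtain F where F: "linear F" "\<forall>v\<in>p ` I. F v = (q' \<circ> the_inv_into I p) v"
      using linear_independent_extend[OF im(2), of "q' \<circ> the_inv_into I p"] by blast
    have Fp: "F (p i) = q' i" if "i \<in> I" for i using F(2) that by (simp add: the_inv_into_f_f[OF im(1)])
    have FP: "F (?e + y) = ?e + f y" if y: "y \<in> P" for y
    proof -
      have "?e + y \<in> Rd (d + 1)" "ht d (?e + y) = 1" using y sq(2) by (auto simp: Rd_iff lookup_add)
      then obtain r where r: "?e + y = (\<Sum>i\<in>I. r i *\<^sub>R p i)" using frame_coeffs[OF sq(1)] by blast
      have r1: "(\<Sum>i\<in>I. r i) = 1" using \<open>ht d (?e + y) = 1\<close> unfolding r frame_height[OF sq(1)] .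
      have "F (?e + y) = (\<Sum>i\<in>I. r i *\<^sub>R q' i)"
        unfolding r by (simp add: linear_sum[OF F(1)] linear_scale[OF F(1)] Fp)
      also have "\<dots> = ?e + f (- ?e + (?e + y))" using comb[OF r1] r ed by simp
      finally show ?thesis by simp
    qed
    have "lift1 d Q = F ` lift1 d P"
      unfolding lift1_eq f(3)[symmetric] image_image using FP by (intro image_cong) auto
    also have "\<dots> = convex hull (F ` insert (p b + p c - p a) (p ` I))"
      unfolding sq(9) by (rule convex_hull_linear_image[OF F(1)])
    also have "F ` insert (p b + p c - p a) (p ` I) = insert (q' b + q' c - q' a) (q' ` I)"
      using sq(3-5) Fp by (simp add: linear_add[OF F(1)] linear_diff[OF F(1)] image_image)
    finally show ?thesis .
  qed
  ultimately have "square_frame d I q' S a b c Q" unfolding square_frame_def using sq sqq(2) ed by blast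
  then show "\<exists>p'. square_frame d I p' S a b c Q" by blast
qed

section \<open>The four families\<close>

text \<open>In the family \<open>F\<close>, the set \<open>S\<close> of the frame consists of all indices except these.\<close>

fun excluded :: "family \<Rightarrow> 'i \<Rightarrow> 'i \<Rightarrow> 'i \<Rightarrow> 'i set" where
  "excluded Fam_A1 a b c = {a}"
| "excluded Fam_A2 a b c = {b, c}"
| "excluded Fam_A3 a b c = {a, b, c}"
| "excluded Fam_B a b c = {b}"

text \<open>The indices \<open>(a, b, c)\<close>, with 0 for the origin, for which the last listed
  vertex of the family is \<open>m b + m c - m a\<close> in terms of the model points
  \<open>m\<close>.\<close>

fun fam_square :: "family \<Rightarrow> nat \<Rightarrow> nat \<times> nat \<times> nat" where
  "fam_square Fam_A1 d = (d - 1, 1, 0)"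
| "fam_square Fam_A2 d = (0, d - 2, d - 1)"
| "fam_square Fam_A3 d = (d - 3, d - 2, d - 1)"
| "fam_square Fam_B d = (1, d - 1, 0)"

text \<open>In dimension \<open>fam_dim F k\<close> this set has the even size
  \<open>2 * k - 2\<close>, so \<open>model_half\<close> adds the index 0 and leaves out precisely
  the \<open>excluded\<close> indices.\<close>

fun fam_tail :: "family \<Rightarrow> nat \<Rightarrow> nat set" where
  "fam_tail Fam_A1 d = {1..d - 2}"
| "fam_tail Fam_A2 d = {1..d - 3}"
| "fam_tail Fam_A3 d = {1..d - 4}"
| "fam_tail Fam_B d = {1..d - 2}"

lemma excluded_subset: "excluded F a b c \<subseteq> {a, b, c}"
  by (cases F) auto

lemma image_excluded: "g ` excluded F a b c = excluded F (g a) (g b) (g c)"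
  by (cases F) auto

text \<open>Evenness of \<open>card S\<close> provides \<open>k\<close>, and the number of excluded
  indices then gives the dimension. Passing to the opposite vertex enlarges \<open>S\<close> to all
  of \<open>I\<close> for \<open>Fam_A2\<close>, trades \<open>c\<close> for \<open>b\<close> in
  \<open>Fam_B\<close>, and changes nothing in the other two, where \<open>a\<close> is excluded; so
  the last exponent is \<open>k\<close> for \<open>Fam_B\<close> and \<open>k + 1\<close>
  otherwise.\<close>

lemma square_frame_fam_delta:
  assumes "square_frame d I p (I - excluded F a b c) a b c P" "4 \<le> card (I - excluded F a b c)"
  obtains k where "k \<ge> 2" "d = fam_dim F k" "delta d P = fam_delta F k"
    "4 \<le> card (opposite_half (I - excluded F a b c) a b c)"
proof -
  note sq = square_frameD[OF assms(1)]
  note fr = frameD[OF sq(1)]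
  let ?S = "I - excluded F a b c"
  obtain k where k: "card ?S = 2 * k" using frame_card_even[OF sq(1)] by (elim evenE)
  have k2: "k \<ge> 2" using assms(2) k by simp
  have "0 < card ?S" using assms(2) by linarith
  then have ne: "?S \<noteq> {}" unfolding card_gt_0_iff by (rule conjunct1)
  have sub: "excluded F a b c \<subseteq> I" by (rule order_trans[OF excluded_subset]) (use sq(3-5) in simp)
  then have c: "2 * k + card (excluded F a b c) = d + 1"
    using fr(2,3) k card_Diff_subset[OF finite_subset[OF sub fr(2)] sub] card_mono[OF fr(2) sub] by simp
  have ce: "card (excluded F a b c) = (case F of Fam_A1 \<Rightarrow> 1 | Fam_A2 \<Rightarrow> 2 | Fam_A3 \<Rightarrow> 3 | Fam_B \<Rightarrow> 1)"
    using sq(6-8) by (cases F) auto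
  have d: "d = fam_dim F k" using c ce by (cases F) auto
  have opp: "card (opposite_half ?S a b c) = (if F = Fam_A2 then 2 * k + 2 else 2 * k)"
  proof (cases F)
    case Fam_A1
    then show ?thesis using k by (simp add: opposite_half_def)
  next
    case Fam_A2
    have "opposite_half ?S a b c = I" using Fam_A2 sq(3-8) by (auto simp: opposite_half_def)
    then show ?thesis using fr(3) c ce Fam_A2 by simp
  next
    case Fam_A3
    then show ?thesis using k by (simp add: opposite_half_def)
  next
    case Fam_B
    have "opposite_half ?S a b c = I - {c}" using Fam_B sq(3-8) by (auto simp: opposite_half_def)
    then show ?thesis using fr(2,3) c ce Fam_B sq(5) by simp
  qed
  have "delta d P = fam_delta F k"
    unfolding square_frame_delta[OF assms(1) ne] opp k using sq(3,6-8) by (cases F) (auto simp: algebra_simps)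
  then show ?thesis using that[OF k2 d] opp k2 by simp
qed

lemma fam_square_frame:
  assumes "k \<ge> 2" "d = fam_dim F k" "(a, b, c) = fam_square F d"
  defines "p \<equiv> \<lambda>j. evec (d + 1) + model_point d (fam_tail F d) j"
  shows "square_frame d {..d} p ({..d} - excluded F a b c) a b c (fam_polytope F k)"
    "4 \<le> card ({..d} - excluded F a b c)"
    "insert (model_point d (fam_tail F d) b + model_point d (fam_tail F d) c - model_point d (fam_tail F d) a)
       (model_point d (fam_tail F d) ` {..d}) = fam_vertices F d"
proof -
  let ?m = "model_point d (fam_tail F d)"
  have d4: "d \<ge> 4" using assms(1,2) by (cases F) auto
  have T: "fam_tail F d \<subseteq> {1..d} - {d}" using d4 by (cases F) auto
  have abc: "{a, b, c} \<subseteq> {..d}" "a \<noteq> b" "a \<noteq> c" "b \<noteq> c"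
    using assms(1-3) by (cases F; auto)+
  have base: "?m ` {..d} = insert ((\<Sum>i\<in>fam_tail F d. evec i) + 2 *\<^sub>R evec d) (base_points d)"
  proof -
    have "{..d} = insert 0 (insert d {1..d - 1})" using d4 by auto
    moreover have "?m 0 = 0" "?m d = (\<Sum>i\<in>fam_tail F d. evec i) + 2 *\<^sub>R evec d" using d4 by (auto simp: model_point_def)
    moreover have "?m ` {1..d - 1} = evec ` {1..d - 1}" using d4 by (intro image_cong) (auto simp: model_point_def)
    ultimately show ?thesis by (simp add: base_points_def insert_commute del: One_nat_def)
  qed
  show V: "insert (?m b + ?m c - ?m a) (?m ` {..d}) = fam_vertices F d"
    unfolding base using assms(1-3) by (cases F) (auto simp: model_point_def base_points_def)
  have half: "model_half d (fam_tail F d) = {..d} - excluded F a b c"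
  proof -
    have "card (fam_tail F d) = 2 * k - 2" "even (2 * k - 2)" using assms(1,2) by (cases F; auto)+
    then have "model_half d (fam_tail F d) = insert 0 (insert d (fam_tail F d))" by (simp add: model_half_def insert_commute)
    also have "\<dots> = {..d} - excluded F a b c" using assms(1-3) by (cases F) auto
    finally show ?thesis .
  qed
  have "square_frame d {..d} p (model_half d (fam_tail F d)) a b c (convex hull (insert (?m b + ?m c - ?m a) (?m ` {..d})))"
    unfolding p_def by (rule model_square_frame[OF _ T abc]) (use d4 in auto)
  then show "square_frame d {..d} p ({..d} - excluded F a b c) a b c (fam_polytope F k)"
    unfolding V half using assms(2) by (simp add: fam_polytope_def)
  have "card ({..d} - excluded F a b c) = d + 1 - card (excluded F a b c)"
    using excluded_subset[of F a b c] abc(1) by (subst card_Diff_subset) (auto intro: finite_subset)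
  moreover have "card (excluded F a b c) = (case F of Fam_A1 \<Rightarrow> 1 | Fam_A2 \<Rightarrow> 2 | Fam_A3 \<Rightarrow> 3 | Fam_B \<Rightarrow> 1)"
    using abc(2-4) by (cases F) auto
  ultimately show "4 \<le> card ({..d} - excluded F a b c)" using assms(1,2) by (cases F) auto
qed

text \<open>\<open>delta\<close> separates \<open>Fam_B\<close> from the rest and determines
  \<open>k\<close>; the dimension then tells the three remaining families apart.\<close>

lemma fam_delta_dim_inj:
  assumes "k \<ge> 2" "l \<ge> 2" "fam_dim F k = fam_dim G l" "fam_delta F k = fam_delta G l"
  shows "F = G \<and> k = l"
proof -
  have "fps_nth (fam_delta F k) i = fps_nth (fam_delta G l) i" for i using assms(4) by simp
  from this[of k] this[of l] this[of "k + 1"] this[of "l + 1"] assms(1-3) show ?thesis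
    by (cases F; cases G; simp add: fps_X_power_nth split: if_splits; presburger?)
qed

lemma fam_dim_le: "k \<ge> 2 \<Longrightarrow> k + 1 \<le> fam_dim F k"
  by (cases F) auto

lemma fam_delta_sum:
  assumes "k \<ge> 2"
  shows "(\<Sum>i\<le>fam_dim F k. fps_nth (fam_delta F k) i) = 4"
proof -
  have X: "(\<Sum>i\<le>n. fps_nth (fps_X ^ m :: int fps) i) = 1" if "m \<le> n" for m n
    using that by (simp add: fps_X_power_nth)
  have X0: "(\<Sum>i\<le>n. fps_nth (1 :: int fps) i) = 1" for n using X[of 0 n] by simp
  have X1: "(\<Sum>i\<le>n. fps_nth (fps_X :: int fps) i) = 1" if "1 \<le> n" for n using X[of 1 n] that by simp
  note le = fam_dim_le[OF assms, of F]
  define n where "n = fam_dim F k"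
  have n: "1 \<le> n" "k \<le> n" "k + 1 \<le> n" using le by (auto simp: n_def)
  have "(\<Sum>i\<le>n. fps_nth (1 + fps_X + fps_X ^ k + fps_X ^ (k + 1) :: int fps) i) = 4"
    unfolding fps_add_nth sum.distrib X0 X1[OF n(1)] X[OF n(2)] X[OF n(3)] by simp
  moreover have "(\<Sum>i\<le>n. fps_nth (1 + fps_X + (fps_X ^ k + fps_X ^ k) :: int fps) i) = 4"
    unfolding fps_add_nth sum.distrib X0 X1[OF n(1)] X[OF n(2)] by simp
  ultimately show ?thesis unfolding n_def[symmetric] by (cases F) (simp_all only: fam_delta.simps mult_2)
qed

lemma classification:
  assumes "V \<le> 4" "nonspanning_nonsimplex_nonpyramid V d P"
  shows "\<exists>F. \<exists>k\<ge>2. d = fam_dim F k \<and> delta d P = fam_delta F k \<and> unimod_equiv d P d (fam_polytope F k)"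
proof -
  have P: "full_lattice_polytope d P" "\<not> is_simplex P" "\<not> spanning d P" "Vol d P \<le> 4" "\<not> lattice_pyramid d P"
    using assms by (auto simp: nonspanning_nonsimplex_nonpyramid_def)
  obtain B S a b c where sq0: "square_frame d B (\<lambda>v. v) S a b c P" "S \<noteq> {}"
    and X0: "lift1 d P \<inter> Zd (d + 1) = insert (b + c - a) B"
    by (rule classification_square_frame[OF P(1-4)])
  note sq = square_frameD[OF sq0(1)]
  have S4: "4 \<le> card S" by (rule square_frame_card_ge_4[OF sq0]) (use X0 in simp)
  have SB: "S \<subseteq> B" by (rule frameD(4)[OF sq(1)])
  have rest: "B - {a, b, c} \<subseteq> S"
    using square_frame_pyramid[OF sq0(1) S4] P(5) by blast
  let ?x = "b + c - a"
  have "\<exists>F p a' b' c'. square_frame d B p (B - excluded F a' b' c') a' b' c' P \<and> 4 \<le> card (B - excluded F a' b' c')"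
  proof -
    have A: "square_frame d B (\<lambda>v. v) (B - excluded F a b c) a b c P \<and> 4 \<le> card (B - excluded F a b c)"
      if "S = B - excluded F a b c" for F using sq0(1) S4 that by simp
    have As: "square_frame d B (\<lambda>v. v) (B - excluded F a c b) a c b P \<and> 4 \<le> card (B - excluded F a c b)"
      if "S = B - excluded F a c b" for F using square_frame_swap[OF sq0(1)] S4 that by simp
    \<comment> \<open>Cases 1 to 4 are the families themselves and 5 mirrors 4. The rest reduce to
      \<open>Fam_A2\<close>: in 6 and 7 a rotation makes the only element of \<open>S\<close> among
      \<open>a\<close>, \<open>b\<close>, \<open>c\<close> the base corner, in 8 passing to the
      opposite corner removes \<open>b\<close> and \<open>c\<close> from \<open>S\<close>.\<close>
    consider "a \<notin> S \<and> b \<notin> S \<and> c \<notin> S" | "a \<notin> S \<and> b \<in> S \<and> c \<in> S" | "a \<in> S \<and> b \<notin> S \<and> c \<notin> S"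
      | "a \<in> S \<and> b \<notin> S \<and> c \<in> S" | "a \<in> S \<and> b \<in> S \<and> c \<notin> S" | "a \<notin> S \<and> b \<in> S \<and> c \<notin> S"
      | "a \<notin> S \<and> b \<notin> S \<and> c \<in> S" | "a \<in> S \<and> b \<in> S \<and> c \<in> S" by blast
    then show ?thesis
    proof cases
      case 1
      then have "S = B - excluded Fam_A3 a b c" using SB rest by auto
      then show ?thesis using A by blast
    next
      case 2
      then have "S = B - excluded Fam_A1 a b c" using SB rest by auto
      then show ?thesis using A by blast
    next
      case 3
      then have "S = B - excluded Fam_A2 a b c" using SB rest by auto
      then show ?thesis using A by blast
    next
      case 4
      then have "S = B - excluded Fam_B a b c" using SB rest by auto
      then show ?thesis using A by blast
    next
      case 5
      then have "S = B - excluded Fam_B a c b" using SB rest by auto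
      then show ?thesis using As by blast
    next
      case 6
      then have S: "S = B - excluded Fam_A2 b a c" using SB rest by auto
      have "square_frame d B ((\<lambda>v. v)(c := ?x)) S b a c P" using square_frame_rotate[OF sq0(1)] 6 by blast
      then show ?thesis using S S4 by blast
    next
      case 7
      then have S: "S = B - excluded Fam_A2 c a b" using SB rest by auto
      have "square_frame d B ((\<lambda>v. v)(b := c + b - a)) S c a b P"
        using square_frame_rotate[OF square_frame_swap[OF sq0(1)]] 7 by blast
      then show ?thesis using S S4 by blast
    next
      case 8
      define S' where "S' = B - excluded Fam_A2 a b c"
      have "(if a \<in> S then (S - {b, c}) \<union> ({b, c} - S) else S) = S'" using 8 SB rest sq(3-5) by (auto simp: S'_def)
      then have sq': "square_frame d B ((\<lambda>v. v)(a := ?x)) S' a b c P"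
        using square_frame_opposite[OF sq0(1)] by simp
      \<comment> \<open>\<open>S'\<close> is smaller than \<open>S\<close>, so the bound 4 is
        derived anew from the list of lattice points, which has not changed.\<close>
      have "S' \<noteq> {}" using sq(3,6,7) by (auto simp: S'_def)
      moreover have "insert (((\<lambda>v. v)(a := ?x)) b + ((\<lambda>v. v)(a := ?x)) c - ((\<lambda>v. v)(a := ?x)) a) (((\<lambda>v. v)(a := ?x)) ` B) = insert ?x B"
        using sq(3-8) by auto
      ultimately have "4 \<le> card S'" using square_frame_card_ge_4[OF sq'] X0 by simp
      then show ?thesis using sq' unfolding S'_def by blast
    qed
  qed
  then obtain F p a' b' c' where sqF: "square_frame d B p (B - excluded F a' b' c') a' b' c' P"
    and card4: "4 \<le> card (B - excluded F a' b' c')" by blast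
  obtain k where k: "k \<ge> 2" "d = fam_dim F k" "delta d P = fam_delta F k"
    by (rule square_frame_fam_delta[OF sqF card4])
  obtain i j l where ijl: "(i, j, l) = fam_square F d" by (metis prod_cases3)
  note fam = fam_square_frame[OF k(1,2) ijl]
  note sqi = square_frameD[OF fam(1)] and sqn = square_frameD[OF sqF]
  \<comment> \<open>The square of \<open>P\<close> is matched with that of the model. All indices
    off the square lie in the half set on both sides, so any bijection between them will do.\<close>
  define g where "g x = (if x = i then a' else if x = j then b' else c')" for x
  obtain \<pi> where \<pi>: "bij_betw \<pi> {..d} B" "\<And>x. x \<in> {i, j, l} \<Longrightarrow> \<pi> x = g x"
  proof (rule bij_betw_extend[of "{..d}" B "{i, j, l}" g])
    show "inj_on g {i, j, l}" using sqi(6-8) sqn(6-8) by (auto simp: g_def inj_on_def)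
    show "g ` {i, j, l} \<subseteq> B" using sqn(3-5) by (auto simp: g_def)
  qed (use frameD(2,3)[OF sqn(1)] sqi(3-5) in auto)
  have \<pi>ijl: "\<pi> i = a'" "\<pi> j = b'" "\<pi> l = c'" using \<pi>(2) sqi(6-8) by (auto simp: g_def)
  have "square_frame d {..d} (p \<circ> \<pi>) {x\<in>{..d}. \<pi> x \<in> B - excluded F a' b' c'} i j l P"
    by (rule square_frame_reindex[OF _ \<pi>(1)]) (use sqF \<pi>ijl sqi(3-5) in auto)
  moreover have "{x\<in>{..d}. \<pi> x \<in> B - excluded F a' b' c'} = {..d} - excluded F i j l"
  proof -
    have inj: "inj_on \<pi> {..d}" and im: "\<pi> ` {..d} = B" using \<pi>(1) by (auto simp: bij_betw_def)
    have sub: "excluded F i j l \<subseteq> {..d}" using excluded_subset[of F i j l] sqi(3-5) by blast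
    have "\<pi> x \<in> excluded F a' b' c' \<longleftrightarrow> x \<in> excluded F i j l" if "x \<in> {..d}" for x
      unfolding \<pi>ijl[symmetric] image_excluded[symmetric] by (rule inj_on_image_mem_iff[OF inj that sub])
    then show ?thesis using im by auto
  qed
  ultimately have "square_frame d {..d} (p \<circ> \<pi>) ({..d} - excluded F i j l) i j l P" by simp
  then have "unimod_equiv d P d (fam_polytope F k)" by (rule square_frame_equiv[OF _ fam(1)])
  then show ?thesis using k by blast
qed

lemma fam_properties:
  assumes "k \<ge> 2"
  shows "nonspanning_nonsimplex_nonpyramid 4 (fam_dim F k) (fam_polytope F k)"
    "delta (fam_dim F k) (fam_polytope F k) = fam_delta F k"
    "vertices (fam_polytope F k) = fam_vertices F (fam_dim F k)"
    "card (lift1 (fam_dim F k) (fam_polytope F k) \<inter> Zd (fam_dim F k + 1)) = fam_dim F k + 2"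
proof -
  define d where "d = fam_dim F k"
  obtain a b c where abc: "(a, b, c) = fam_square F d" by (metis prod_cases3)
  let ?m = "model_point d (fam_tail F d)"
  let ?p = "\<lambda>j. evec (d + 1) + ?m j"
  let ?S = "{..d} - excluded F a b c"
  note fam = fam_square_frame[OF assms d_def abc]
  note sq = square_frameD[OF fam(1)]
  note part = square_frame_partition[OF fam(1)]
  obtain l where l: "l \<ge> 2" "d = fam_dim F l" "delta d (fam_polytope F k) = fam_delta F l" "4 \<le> card (opposite_half ?S a b c)"
    by (rule square_frame_fam_delta[OF fam(1,2)])
  have "l = k" using l(2) d_def by (cases F) auto
  then have delta: "delta d (fam_polytope F k) = fam_delta F k" using l(3) by simp
  then show "delta (fam_dim F k) (fam_polytope F k) = fam_delta F k" by (simp add: d_def)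
  have pts: "lift1 d (fam_polytope F k) \<inter> Zd (d + 1) = insert (?p b + ?p c - ?p a) (?p ` {..d})"
    by (rule square_frame_lattice_points[OF fam(1,2) l(4)])
  have "card (insert (?p b + ?p c - ?p a) (?p ` {..d})) = d + 2"
    using part(4) indep_family_image(1)[OF frameD(1)[OF sq(1)]] by (simp add: card_image)
  then show "card (lift1 (fam_dim F k) (fam_polytope F k) \<inter> Zd (fam_dim F k + 1)) = fam_dim F k + 2"
    unfolding d_def[symmetric] pts .
  have "0 < card ?S" using fam(2) by linarith
  then have ne: "?S \<noteq> {}" unfolding card_gt_0_iff by (rule conjunct1)
  have "Vol d (fam_polytope F k) = 4" unfolding Vol_def delta using fam_delta_sum[OF assms, of F] by (simp add: d_def)
  moreover have "{..d} - {a, b, c} \<subseteq> ?S" using excluded_subset[of F a b c] by blast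
  ultimately show "nonspanning_nonsimplex_nonpyramid 4 (fam_dim F k) (fam_polytope F k)"
    unfolding nonspanning_nonsimplex_nonpyramid_def d_def[symmetric]
    using square_frame_full_lattice_polytope(1)[OF fam(1)] square_frame_not_simplex[OF fam(1)]
      square_frame_not_spanning[OF fam(1) ne pts] square_frame_not_pyramid[OF fam(1)] by blast
  have "vertices (fam_polytope F k) = (+) (- evec (d + 1)) ` insert (?p b + ?p c - ?p a) (?p ` {..d})"
    by (rule square_frame_vertices[OF fam(1)])
  also have "\<dots> = insert (?m b + ?m c - ?m a) (?m ` {..d})" by (simp add: image_image algebra_simps)
  finally show "vertices (fam_polytope F k) = fam_vertices F (fam_dim F k)" unfolding fam(3) by (simp add: d_def)
qed

text \<open>Counting lattice points gives one inequality between the dimensions, transporting the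
  frame the other. The transported frame computes \<open>delta\<close> of the second polytope from
  the labels of the first, so the two families share \<open>delta\<close> and dimension.\<close>

lemma fam_inequivalent:
  assumes "k \<ge> 2" "l \<ge> 2" and eq: "unimod_equiv (fam_dim F k) (fam_polytope F k) (fam_dim G l) (fam_polytope G l)"
  shows "F = G \<and> k = l"
proof -
  define d e where "d = fam_dim F k" and "e = fam_dim G l"
  note eq = eq[folded d_def e_def]
  obtain a b c where abc: "(a, b, c) = fam_square F d" by (metis prod_cases3)
  obtain a' b' c' where abc': "(a', b', c') = fam_square G e" by (metis prod_cases3)
  note P = fam_square_frame[OF assms(1) d_def abc] and Q = fam_square_frame[OF assms(2) e_def abc']
  note ptsP = fam_properties(4)[OF assms(1), of F, folded d_def] and ptsQ = fam_properties(4)[OF assms(2), of G, folded e_def]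
  have "finite (lift1 e (fam_polytope G l) \<inter> Zd (e + 1))" by (rule card_ge_0_finite) (simp only: ptsQ zero_less_Suc add_2_eq_Suc')
  then have "d \<le> e"
    using unimod_equiv_card_lattice_points[OF eq square_frameD(2)[OF P(1)] square_frameD(2)[OF Q(1)]] ptsP ptsQ by simp
  moreover have "e \<le> d" by (rule square_frame_transport(1)[OF P(1) Q(1) eq])
  ultimately have ed: "e = d" by simp
  obtain p' where p': "square_frame d {..d} p' ({..d} - excluded F a b c) a b c (fam_polytope G l)"
    using square_frame_transport(2)[OF P(1) Q(1) eq ed] by blast
  obtain m where m: "d = fam_dim F m" "delta d (fam_polytope G l) = fam_delta F m"
    by (rule square_frame_fam_delta[OF p' P(2)])
  have "m = k" using m(1) d_def by (cases F) auto
  then have "fam_delta F k = fam_delta G l" using m(2) fam_properties(2)[OF assms(2), of G] ed e_def by simp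
  moreover have "fam_dim F k = fam_dim G l" using ed d_def e_def by simp
  ultimately show ?thesis using fam_delta_dim_inj[OF assms(1,2)] by blast
qed

theorem theorem1p4:
  shows
    "(\<forall>(V :: int) (d :: nat) (P :: vect set).
        2 \<le> V \<and> V \<le> 4 \<and> nonspanning_nonsimplex_nonpyramid V d P \<longrightarrow>
        (\<exists>F. \<exists>k\<ge>2. d = fam_dim F k \<and> delta d P = fam_delta F k \<and>
                  unimod_equiv d P d (fam_polytope F k)))
   \<and> (\<forall>F. \<forall>k\<ge>2.
        nonspanning_nonsimplex_nonpyramid 4 (fam_dim F k) (fam_polytope F k) \<and>
        delta (fam_dim F k) (fam_polytope F k) = fam_delta F k \<and>
        vertices (fam_polytope F k) = fam_vertices F (fam_dim F k))
   \<and> (\<forall>F G. \<forall>k\<ge>2. \<forall>l\<ge>2.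
        unimod_equiv (fam_dim F k) (fam_polytope F k) (fam_dim G l) (fam_polytope G l) \<longrightarrow>
        F = G \<and> k = l)"
proof (intro conjI allI impI)
  fix V d P assume "2 \<le> V \<and> V \<le> 4 \<and> nonspanning_nonsimplex_nonpyramid V d P"
  then show "\<exists>F. \<exists>k\<ge>2. d = fam_dim F k \<and> delta d P = fam_delta F k \<and> unimod_equiv d P d (fam_polytope F k)"
    using classification by blast
next
  fix F and k :: nat assume k: "2 \<le> k"
  show "nonspanning_nonsimplex_nonpyramid 4 (fam_dim F k) (fam_polytope F k)"
    "delta (fam_dim F k) (fam_polytope F k) = fam_delta F k"
    "vertices (fam_polytope F k) = fam_vertices F (fam_dim F k)"
    by (fact fam_properties[OF k])+
next
  fix F G and k l :: nat
  assume "2 \<le> k" "2 \<le> l" "unimod_equiv (fam_dim F k) (fam_polytope F k) (fam_dim G l) (fam_polytope G l)"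
  then have "F = G \<and> k = l" by (rule fam_inequivalent)
  then show "F = G" "k = l" by auto
qed

end
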